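(* Let $k\in\mathbb N^*$ and $a_1,\dots,a_k\in\mathbb C^*$ be such that $\frac{a_i}{a_j}\notin q^{(n+1)\mathbb Z}$ and $\frac{a_i}{a_j}\notin q^{\pm2+(n+1)\mathbb Z}$ for all $i<j$. The tensor product of vector representations $$V(\boxed1_{a_1})\otimes V(\boxed1_{a_2})\otimes\cdots\otimes V(\boxed1_{a_k})$$ (with the action given by the Drinfeld coproduct $\Delta_D$) is an irreducible and thin extremal loop weight $\mathcal U_q(sl_{n+1}^{tor})$-module of $\ell$-weight $$e^{k\varpi_1}Y_{1,a_1}\cdots Y_{1,a_k}Y_{0,qa_1}^{-1}\cdots Y_{0,qa_k}^{-1}.$$
   Context: Fix an integer $n\ge 2$. $I=\{0,\dots,n\}$ is identified with $\mathbb Z/(n+1)\mathbb Z$ ($\bar j$ is the class of $j\in\mathbb Z$); $C=(C_{i,j})_{i,j\in I}$ is the Cartan matrix of type $A_n^{(1)}$ ($C_{i,i}=2$, $C_{i,i\pm1}=-1$, $C_{i,j}=0$ otherwise). Fix $t\in\mathbb C$ such that $q=e^t$ is not a root of unity; $q^x=e^{tx}$; $[l]_q=\frac{q^l-q^{-l}}{q-q^{-1}}$, $[r]_q!=[r]_q\cdots[1]_q$. $\mathfrak h=\mathbb Qh_0\oplus\dots\oplus\mathbb Qh_n\oplus\mathbb Qd$; $\alpha_i,\Lambda_i\in\mathfrak h^*$: $\alpha_i(h_j)=C_{j,i}$, $\alpha_i(d)=\delta_{0,i}$, $\Lambda_i(h_j)=\delta_{i,j}$, $\Lambda_i(d)=0$;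 $P=\{\lambda\in\mathfrak h^*:\lambda(h_i)\in\mathbb Z\ \forall i\}$; $\varpi_1=\Lambda_1-\Lambda_0$. $\mathcal U_q(sl_{n+1}^{tor})$ is the $\mathbb C$-algebra with generators $x_{i,r}^\pm$ ($i\in I,r\in\mathbb Z$), $k_h$ ($h\in\mathfrak h$), $h_{i,m}$ ($i\in I$, $m\in\mathbb Z\setminus\{0\}$). Put $x_i^\pm(z)=\sum_{r\in\mathbb Z}x_{i,r}^\pm z^r$, $\delta(z)=\sum_{s\in\mathbb Z}z^s$, $k_i^{\pm1}=k_{\pm h_i}$, $\phi_i^\pm(z)=\sum_{m\ge0}\phi^\pm_{i,\pm m}z^{\pm m}=k_i^{\pm1}\exp(\pm(q-q^{-1})\sum_{m\ge1}h_{i,\pm m}z^{\pm m})$. Relations: $k_hk_{h'}=k_{h+h'}$, $k_0=1$; the $k_h$ and all coefficients of all $\phi_i^\pm(z)$ commute; $k_hx_j^\pm(z)k_{-h}=q^{\pm\alpha_j(h)}x_j^\pm(z)$; $(w-q^{\pm C_{ij}}z)\phi_i^{\epsilon}(z)x_j^\pm(w)=(q^{\pm C_{ij}}w-z)x_j^\pm(w)\phi_i^{\epsilon}(z)$ for $\epsilon=+,-$; $[x_i^+(z),x_j^-(w)]=\frac{\delta_{i,j}}{q-q^{-1}}(\delta(\frac wz)\phi_i^+(w)-\delta(\frac zw)\phi_i^-(z))$; $(w-q^{\pm C_{ij}}z)x_i^\pm(z)x_j^\pm(w)=(q^{\pm C_{ij}}w-z)x_j^\pm(w)x_i^\pm(z)$;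 for $j=i\pm1$: $x_i^\pm(z_1)x_i^\pm(z_2)x_j^\pm(w)-(q+q^{-1})x_i^\pm(z_1)x_j^\pm(w)x_i^\pm(z_2)+x_j^\pm(w)x_i^\pm(z_1)x_i^\pm(z_2)+(z_1\leftrightarrow z_2)=0$; $[x_i^\pm(z),x_j^\pm(w)]=0$ for $i\ne j,j\pm1$. Let $\psi(z)=\frac{q-q^{-1}z}{1-z}$; rational functions describing $\phi_i^+$ (resp. $\phi_i^-$) are expanded at $z=0$ (resp. $z=\infty$). For $a\in\mathbb C^*$, the vector representation $V(\boxed1_a)$ has basis $\boxed{j}_a$, $j\in\mathbb Z$, with $x_i^+(z)\boxed j_a=\delta_{i,\overline{j-1}}\,\delta(aq^{j-1}z)\boxed{j-1}_a$, $x_i^-(z)\boxed j_a=\delta_{i,\bar j}\,\delta(aq^jz)\boxed{j+1}_a$, $\phi_i^\pm(z)\boxed j_a=\psi(aq^jz)\boxed j_a$ if $i=\bar j$, $=\psi(aq^{j+1}z)^{-1}\boxed j_a$ if $i=\overline{j-1}$, $=\boxed j_a$ otherwise; $\boxed j_a$ has weight $\varpi_1-\sum_{s=1}^{j-1}\alpha_{\bar s}$ if $j\ge1$, $\varpi_1+\sum_{s=j}^{0}\alpha_{\bar s}$ if $j\le0$. Drinfeld coproduct: $\Delta_D(x_i^+(z))=x_i^+(z)\otimes1+\phi_i^-(z)\otimes x_i^+(z)$, $\Delta_D(x_i^-(z))=x_i^-(z)\otimes\phi_i^+(z)+1\otimes x_i^-(z)$, $\Delta_D(\phi_i^\pm(z))=\phi_i^\pm(z)\otimes\phi_i^\pm(z)$,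 $\Delta_D(k_h)=k_h\otimes k_h$, iterated for $k$ factors. On tensors of basis vectors $b_1\otimes\cdots\otimes b_k$ on which $\phi_i^\pm(z)b_s=f_{i,s}(z)b_s$ with $f_{i,s}$ rational, this means $x_i^+(z)$ acts by $\sum_u\big(\prod_{s<u}f_{i,s}(z)\big)b_1\otimes\cdots\otimes x_i^+(z)b_u\otimes\cdots\otimes b_k$ and $x_i^-(z)$ by $\sum_u\big(\prod_{s>u}f_{i,s}(z)\big)b_1\otimes\cdots\otimes x_i^-(z)b_u\otimes\cdots\otimes b_k$, where $f(z)\delta(cz):=f(c^{-1})\delta(cz)$; it is well-defined if no pole occurs. Integrable module: direct sum of its weight spaces $V_\lambda=\{v:k_hv=q^{\lambda(h)}v\ \forall h\}$, $\lambda\in P$, with all $x_{i,0}^\pm$ acting locally nilpotently. For a monomial $m=e^{\omega}\prod_{i\in I,c\in\mathbb C^*}Y_{i,c}^{u_{i,c}}$ (finite product, $\omega\in P$, $\sum_cu_{i,c}=\omega(h_i)$), $V_m$ is the subspace of $V_\omega$ on which the $\phi^\pm_{i,\pm s}$ act with generalized eigenvalues the coefficients of the expansions of $\prod_c\psi(cqz)^{u_{i,c}}$. A module is thin if the commutative subalgebra generated by the $k_h$ and $h_{i,m}$ acts diagonalizably with one-dimensional joint eigenspaces. A vector $w$ of weight $\lambda$ is $i$-extremal if $x_{i,0}^{\pm}w=0$ when $\pm\lambda(h_i)\ge0$; then $S_i(w)=\frac{(x_{i,0}^\mp)^{\pm\lambda(h_i)}}{[\pm\lambda(h_i)]_q!}w$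 when $\pm\lambda(h_i)\geq 0$. It is extremal for the horizontal subalgebra (generated by the $x_{i,0}^\pm$, $k_h$) if every $S_{i_1}\circ\cdots\circ S_{i_l}(w)$ ($l\ge0$) is $i$-extremal for every $i$. An extremal loop weight module of $\ell$-weight $m$ is an integrable module $V$ with a $v\in V_m$ such that (i) $v$ generates $V$; (ii) $v$ is extremal for the horizontal subalgebra; (iii) for each $j\in I$ and $w\in V$, $\mathcal U_q^{v,j}(sl_{n+1}^{tor})\cdot w$ is finite-dimensional, where $\mathcal U_q^{v,j}(sl_{n+1}^{tor})$ is the subalgebra generated by $x_{i,r}^\pm,h_{i,m}$ ($i\ne j$) and $k_h$, $h\in\bigoplus_{i\ne j}\mathbb Qh_i$. *)

theory Defs
  imports
    Complex_Main
    "HOL-Library.Poly_Mapping"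
    "HOL-Computational_Algebra.Computational_Algebra"
begin

section \<open>Index set, Cartan datum and weights\<close>

text \<open>
  Elements of \<open>I = {0..n}\<close> are integers; \<open>cls n j\<close> is the representative in \<open>I\<close> of the class
  of \<open>j\<close> modulo \<open>n + 1\<close>. Signs (the superscripts plus and minus) are the integers \<open>1\<close> and \<open>-1\<close>.
\<close>

definition idx :: "nat \<Rightarrow> int set" where
  "idx n = {0..int n}"

definition cls :: "nat \<Rightarrow> int \<Rightarrow> int" where
  "cls n j = j mod (int n + 1)"

definition adjacent :: "nat \<Rightarrow> int \<Rightarrow> int \<Rightarrow> bool" where
  "adjacent n i j \<longleftrightarrow> j = cls n (i + 1) \<or> j = cls n (i - 1)"

definition cartan :: "nat \<Rightarrow> int \<Rightarrow> int \<Rightarrow> int" where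
  "cartan n i j = (if i = j then 2 else if adjacent n i j then -1 else 0)"

text \<open>
  \<open>hbasis\<close> indexes the basis \<open>h\<^sub>0, \<dots>, h\<^sub>n, d\<close> of the rational vector space \<open>\<hh>\<close>. Vectors of \<open>\<hh>\<close> are
  given by their coordinates in this basis, and elements of the dual space by their coordinates
  in the dual basis, that is, by their values on the basis. Both are supported on \<open>hsupp n\<close>.
\<close>

datatype hbasis = Hb int | Db

type_synonym hvec = "hbasis \<Rightarrow>\<^sub>0 rat"
type_synonym weight = "hbasis \<Rightarrow>\<^sub>0 rat"

definition hsupp :: "nat \<Rightarrow> hbasis set" where
  "hsupp n = insert Db (Hb ` idx n)"

definition hspace :: "nat \<Rightarrow> hvec set" where
  "hspace n = {h. Poly_Mapping.keys h \<subseteq> hsupp n}"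

definition hspace_dual :: "nat \<Rightarrow> weight set" where
  "hspace_dual n = {l. Poly_Mapping.keys l \<subseteq> hsupp n}"

definition pairing :: "weight \<Rightarrow> hvec \<Rightarrow> rat" where
  "pairing l h = (\<Sum>b\<in>Poly_Mapping.keys h. Poly_Mapping.lookup l b * Poly_Mapping.lookup h b)"

definition hvec_h :: "int \<Rightarrow> hvec" where
  "hvec_h i = Poly_Mapping.single (Hb i) 1"

definition simple_root :: "nat \<Rightarrow> int \<Rightarrow> weight" where
  "simple_root n i =
     (\<Sum>j\<in>idx n. Poly_Mapping.single (Hb j) (of_int (cartan n j i)))
       + Poly_Mapping.single Db (if i = 0 then 1 else 0)"

definition fund_weight :: "int \<Rightarrow> weight" where
  "fund_weight i = Poly_Mapping.single (Hb i) 1"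

definition varpi1 :: weight where
  "varpi1 = fund_weight 1 - fund_weight 0"

definition weight_lattice :: "nat \<Rightarrow> weight set" where
  "weight_lattice n = {l \<in> hspace_dual n. \<forall>i\<in>idx n. pairing l (hvec_h i) \<in> \<int>}"

definition qpow :: "complex \<Rightarrow> rat \<Rightarrow> complex" where
  "qpow t x = exp (t * of_rat x)"

definition qint :: "complex \<Rightarrow> nat \<Rightarrow> complex" where
  "qint q l = (q ^ l - inverse q ^ l) / (q - inverse q)"

definition qfact :: "complex \<Rightarrow> nat \<Rightarrow> complex" where
  "qfact q r = (\<Prod>l=1..r. qint q l)"

section \<open>Representations of the quantum toroidal algebra\<close>

text \<open>
  A representation is given by the operators by which the generators act on the space
  \<open>carr M\<close>, a subspace of the complex vector space on the type \<open>'v\<close> with scalar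
  multiplication \<open>scl M\<close>: \<open>xx M e i r\<close> is the action of \<open>x\<^sub>i\<^sub>,\<^sub>r\<close> with sign \<open>e\<close>, \<open>kk M h\<close> that of
  \<open>k\<^sub>h\<close>, and \<open>hh M i m\<close> that of \<open>h\<^sub>i\<^sub>,\<^sub>m\<close> for \<open>m \<noteq> 0\<close> (\<open>hh M i 0\<close> is irrelevant).
\<close>

record 'v tor_rep =
  carr :: "'v set"
  scl :: "complex \<Rightarrow> 'v \<Rightarrow> 'v"
  xx :: "int \<Rightarrow> int \<Rightarrow> int \<Rightarrow> 'v \<Rightarrow> 'v"
  kk :: "hvec \<Rightarrow> 'v \<Rightarrow> 'v"
  hh :: "int \<Rightarrow> int \<Rightarrow> 'v \<Rightarrow> 'v"

text \<open>
  \<open>conv_power A l m\<close> is the coefficient of \<open>z^m\<close> in the \<open>l\<close>-th power of the operator-valued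
  power series \<open>\<Sum>j\<ge>1. A j z^j\<close>, and \<open>exp_coeff s A m\<close> the coefficient of \<open>z^m\<close> in its exponential.
\<close>

primrec conv_power :: "(nat \<Rightarrow> 'v \<Rightarrow> 'v) \<Rightarrow> nat \<Rightarrow> nat \<Rightarrow> 'v \<Rightarrow> 'v::ab_group_add" where
  "conv_power A 0 m v = (if m = 0 then v else 0)"
| "conv_power A (Suc l) m v = (\<Sum>j=1..m. A j (conv_power A l (m - j) v))"

definition exp_coeff ::
  "(complex \<Rightarrow> 'v \<Rightarrow> 'v) \<Rightarrow> (nat \<Rightarrow> 'v \<Rightarrow> 'v) \<Rightarrow> nat \<Rightarrow> 'v \<Rightarrow> 'v::ab_group_add" where
  "exp_coeff s A m v = (\<Sum>l\<le>m. s (1 / fact l) (conv_power A l m v))"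

text \<open>
  \<open>phi t M e i a\<close> is the coefficient of \<open>z^a\<close>, for an arbitrary integer \<open>a\<close>, in the series
  \<open>\<phi>\<^sub>i(z)\<close> with sign \<open>e\<close>; it vanishes unless \<open>a\<close> is \<open>0\<close> or has sign \<open>e\<close>.
\<close>

definition phi :: "complex \<Rightarrow> 'v::ab_group_add tor_rep \<Rightarrow> int \<Rightarrow> int \<Rightarrow> int \<Rightarrow> 'v \<Rightarrow> 'v" where
  "phi t M e i a v =
     (if e * a < 0 then 0
      else kk M (if e = 1 then hvec_h i else - hvec_h i)
             (exp_coeff (scl M)
                (\<lambda>j u. scl M (of_int e * (exp t - inverse (exp t))) (hh M i (e * int j) u))
                (nat \<bar>a\<bar>) v))"

definition linear_on_carr :: "'v::ab_group_add tor_rep \<Rightarrow> ('v \<Rightarrow> 'v) \<Rightarrow> bool" where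
  "linear_on_carr M f \<longleftrightarrow>
     (\<forall>v\<in>carr M. f v \<in> carr M) \<and>
     (\<forall>u\<in>carr M. \<forall>v\<in>carr M. f (u + v) = f u + f v) \<and>
     (\<forall>c. \<forall>v\<in>carr M. f (scl M c v) = scl M c (f v))"

text \<open>
  Generators with node index in \<open>J\<close> and Cartan part in \<open>S\<close>, as operators.
\<close>

definition generators ::
  "'v tor_rep \<Rightarrow> int set \<Rightarrow> hvec set \<Rightarrow> ('v \<Rightarrow> 'v) set" where
  "generators M J S =
     {xx M e i r | e i r. e \<in> {1, -1} \<and> i \<in> J}
     \<union> {hh M i m | i m. i \<in> J \<and> m \<noteq> 0}
     \<union> {kk M h | h. h \<in> S}"

definition all_generators :: "nat \<Rightarrow> 'v tor_rep \<Rightarrow> ('v \<Rightarrow> 'v) set" where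
  "all_generators n M = generators M (idx n) (hspace n)"

text \<open>
  The defining relations, compared coefficientwise. For the relations involving
  \<open>w - q^(e C) z\<close> and for the commutator of the two kinds of currents, \<open>a\<close> and \<open>b\<close> are the
  exponents of \<open>z\<close> and \<open>w\<close>: the coefficient of \<open>z^a w^b\<close> in \<open>\<delta>(w/z) \<phi>\<^sub>i(w)\<close>, and also in
  \<open>\<delta>(z/w) \<phi>\<^sub>i(z)\<close>, is the coefficient of index \<open>a + b\<close> of \<open>\<phi>\<^sub>i\<close>.
\<close>

definition tor_relations :: "nat \<Rightarrow> complex \<Rightarrow> 'v::ab_group_add tor_rep \<Rightarrow> bool" where
  "tor_relations n t M \<longleftrightarrow> (let q = exp t; s = scl M; x = xx M; k = kk M; p = phi t M in
     \<forall>v\<in>carr M.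
     k 0 v = v \<and>
     (\<forall>h\<in>hspace n. \<forall>h'\<in>hspace n. k h (k h' v) = k (h + h') v) \<and>
     (\<forall>h\<in>hspace n. \<forall>i\<in>idx n. \<forall>e\<in>{1,-1}. \<forall>a. k h (p e i a v) = p e i a (k h v)) \<and>
     (\<forall>i\<in>idx n. \<forall>j\<in>idx n. \<forall>e\<in>{1,-1}. \<forall>e'\<in>{1,-1}. \<forall>a b.
        p e i a (p e' j b v) = p e' j b (p e i a v)) \<and>
     (\<forall>h\<in>hspace n. \<forall>j\<in>idx n. \<forall>e\<in>{1,-1}. \<forall>r.
        k h (x e j r (k (- h) v)) =
          s (qpow t (of_int e * pairing (simple_root n j) h)) (x e j r v)) \<and>
     (\<forall>i\<in>idx n. \<forall>j\<in>idx n. \<forall>e'\<in>{1,-1}. \<forall>e\<in>{1,-1}. \<forall>a b.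
        (let c = q powi (e * cartan n i j) in
         p e' i a (x e j (b - 1) v) - s c (p e' i (a - 1) (x e j b v)) =
         s c (x e j (b - 1) (p e' i a v)) - x e j b (p e' i (a - 1) v))) \<and>
     (\<forall>i\<in>idx n. \<forall>j\<in>idx n. \<forall>a b.
        x 1 i a (x (-1) j b v) - x (-1) j b (x 1 i a v) =
        s ((if i = j then 1 else 0) / (q - inverse q))
          (p 1 i (a + b) v - p (-1) i (a + b) v)) \<and>
     (\<forall>i\<in>idx n. \<forall>j\<in>idx n. \<forall>e\<in>{1,-1}. \<forall>a b.
        (let c = q powi (e * cartan n i j) in
         x e i a (x e j (b - 1) v) - s c (x e i (a - 1) (x e j b v)) =
         s c (x e j (b - 1) (x e i a v)) - x e j b (x e i (a - 1) v))) \<and>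
     (\<forall>i\<in>idx n. \<forall>j\<in>idx n. adjacent n i j \<longrightarrow> (\<forall>e\<in>{1,-1}. \<forall>a b c.
        (let f = (\<lambda>a b. x e i a (x e i b (x e j c v))
                        - s (q + inverse q) (x e i a (x e j c (x e i b v)))
                        + x e j c (x e i a (x e i b v)))
         in f a b + f b a = 0))) \<and>
     (\<forall>i\<in>idx n. \<forall>j\<in>idx n. i \<noteq> j \<and> \<not> adjacent n i j \<longrightarrow>
        (\<forall>e\<in>{1,-1}. \<forall>a b. x e i a (x e j b v) = x e j b (x e i a v))))"

definition tor_module :: "nat \<Rightarrow> complex \<Rightarrow> 'v::ab_group_add tor_rep \<Rightarrow> bool" where
  "tor_module n t M \<longleftrightarrow>
     vector_space (scl M) \<and> module.subspace (scl M) (carr M) \<and>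
     (\<forall>f\<in>all_generators n M. linear_on_carr M f) \<and> tor_relations n t M"

text \<open>The unital subalgebra of operators generated by \<open>G\<close>.\<close>

inductive_set gen_algebra ::
  "(complex \<Rightarrow> 'v \<Rightarrow> 'v) \<Rightarrow> ('v \<Rightarrow> 'v) set \<Rightarrow> ('v \<Rightarrow> 'v::ab_group_add) set"
  for s G where
  one: "(\<lambda>v. v) \<in> gen_algebra s G"
| gen: "f \<in> G \<Longrightarrow> f \<in> gen_algebra s G"
| add: "f \<in> gen_algebra s G \<Longrightarrow> g \<in> gen_algebra s G \<Longrightarrow> (\<lambda>v. f v + g v) \<in> gen_algebra s G"
| scale: "f \<in> gen_algebra s G \<Longrightarrow> (\<lambda>v. s c (f v)) \<in> gen_algebra s G"
| comp: "f \<in> gen_algebra s G \<Longrightarrow> g \<in> gen_algebra s G \<Longrightarrow> (\<lambda>v. f (g v)) \<in> gen_algebra s G"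

definition orbit :: "'v::ab_group_add tor_rep \<Rightarrow> ('v \<Rightarrow> 'v) set \<Rightarrow> 'v \<Rightarrow> 'v set" where
  "orbit M G w = (\<lambda>f. f w) ` gen_algebra (scl M) G"

definition finite_dim :: "'v::ab_group_add tor_rep \<Rightarrow> 'v set \<Rightarrow> bool" where
  "finite_dim M W \<longleftrightarrow> (\<exists>B. finite B \<and> W \<subseteq> module.span (scl M) B)"

definition submodule :: "nat \<Rightarrow> 'v::ab_group_add tor_rep \<Rightarrow> 'v set \<Rightarrow> bool" where
  "submodule n M W \<longleftrightarrow> module.subspace (scl M) W \<and> W \<subseteq> carr M \<and>
     (\<forall>f\<in>all_generators n M. f ` W \<subseteq> W)"

definition irreducible_rep :: "nat \<Rightarrow> complex \<Rightarrow> 'v::ab_group_add tor_rep \<Rightarrow> bool" where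
  "irreducible_rep n t M \<longleftrightarrow> tor_module n t M \<and> carr M \<noteq> {0} \<and>
     (\<forall>W. submodule n M W \<longrightarrow> W = {0} \<or> W = carr M)"

section \<open>Integrable, thin and extremal loop weight modules\<close>

definition weight_space ::
  "nat \<Rightarrow> complex \<Rightarrow> 'v tor_rep \<Rightarrow> weight \<Rightarrow> 'v set" where
  "weight_space n t M l =
     {v \<in> carr M. \<forall>h\<in>hspace n. kk M h v = scl M (qpow t (pairing l h)) v}"

text \<open>
  The first clause says that the module is the direct sum of its weight spaces: each vector has
  a unique finite family of components.
\<close>

definition integrable_rep :: "nat \<Rightarrow> complex \<Rightarrow> 'v::ab_group_add tor_rep \<Rightarrow> bool" where
  "integrable_rep n t M \<longleftrightarrow> tor_module n t M \<and>
     (\<forall>v\<in>carr M. \<exists>!c :: weight \<Rightarrow>\<^sub>0 'v.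
        Poly_Mapping.keys c \<subseteq> weight_lattice n \<and>
        (\<forall>l\<in>Poly_Mapping.keys c. Poly_Mapping.lookup c l \<in> weight_space n t M l) \<and>
        v = (\<Sum>l\<in>Poly_Mapping.keys c. Poly_Mapping.lookup c l)) \<and>
     (\<forall>v\<in>carr M. \<forall>i\<in>idx n. \<forall>e\<in>{1,-1}. \<exists>N. (xx M e i 0 ^^ N) v = 0)"

definition cartan_generators :: "nat \<Rightarrow> 'v tor_rep \<Rightarrow> ('v \<Rightarrow> 'v) set" where
  "cartan_generators n M =
     {kk M h | h. h \<in> hspace n} \<union> {hh M i m | i m. i \<in> idx n \<and> m \<noteq> 0}"

definition joint_eigenspace ::
  "nat \<Rightarrow> 'v::ab_group_add tor_rep \<Rightarrow> (('v \<Rightarrow> 'v) \<Rightarrow> complex) \<Rightarrow> 'v set" where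
  "joint_eigenspace n M \<chi> =
     {v \<in> carr M. \<forall>f\<in>gen_algebra (scl M) (cartan_generators n M). f v = scl M (\<chi> f) v}"

definition thin_rep :: "nat \<Rightarrow> complex \<Rightarrow> 'v::ab_group_add tor_rep \<Rightarrow> bool" where
  "thin_rep n t M \<longleftrightarrow> tor_module n t M \<and>
     carr M = module.span (scl M) (\<Union>\<chi>. joint_eigenspace n M \<chi>) \<and>
     (\<forall>\<chi>. joint_eigenspace n M \<chi> \<noteq> {0} \<longrightarrow>
        vector_space.dim (scl M) (joint_eigenspace n M \<chi>) = 1)"

text \<open>
  Rational functions are given by a numerator and a denominator. \<open>expand e f\<close> is the expansion of
  \<open>f\<close> at \<open>z = 0\<close> (in the variable \<open>z\<close>) for \<open>e = 1\<close>, and at \<open>z = \<infinity>\<close> (in the variable \<open>1/z\<close>) for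
  \<open>e = -1\<close>; it is only used for functions regular and nonzero at these points. In the second case,
  \<open>p(1/y) / r(1/y)\<close> is multiplied out by \<open>y ^ degree r\<close>.
\<close>

type_synonym ratfun = "complex poly \<times> complex poly"

definition rf_inverse :: "ratfun \<Rightarrow> ratfun" where
  "rf_inverse f = (snd f, fst f)"

definition rf_pole :: "ratfun \<Rightarrow> complex \<Rightarrow> bool" where
  "rf_pole f z \<longleftrightarrow> poly (snd f) z = 0"

definition rf_value :: "ratfun \<Rightarrow> complex \<Rightarrow> complex" where
  "rf_value f z = poly (fst f) z / poly (snd f) z"

definition expand :: "int \<Rightarrow> ratfun \<Rightarrow> complex fps" where
  "expand e f = (case f of (p, r) \<Rightarrow>
     if e = 1 then fps_of_poly p / fps_of_poly r
     else fps_of_poly (monom 1 (degree r - degree p) * reflect_poly p) / fps_of_poly (reflect_poly r))"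

text \<open>\<open>psi q c\<close> is the rational function \<open>\<psi>(c z)\<close> of \<open>z\<close>.\<close>

definition psi :: "complex \<Rightarrow> complex \<Rightarrow> ratfun" where
  "psi q c = ([:q, - (inverse q * c):], [:1, - c:])"

text \<open>
  The monomial \<open>e^\<omega> \<Prod> Y\<^sub>i\<^sub>,\<^sub>c^u\<^sub>i\<^sub>,\<^sub>c\<close> is represented by the pair \<open>(\<omega>, u)\<close>.
\<close>

type_synonym lmonomial = "weight \<times> (int \<times> complex \<Rightarrow>\<^sub>0 int)"

definition lmonomials :: "nat \<Rightarrow> lmonomial set" where
  "lmonomials n = {(\<omega>, u). \<omega> \<in> weight_lattice n \<and> Poly_Mapping.keys u \<subseteq> idx n \<times> (- {0}) \<and>
     (\<forall>i\<in>idx n. of_int (\<Sum>c\<in>{c. (i, c) \<in> Poly_Mapping.keys u}. Poly_Mapping.lookup u (i, c)) = pairing \<omega> (hvec_h i))}"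

definition lmonomial_series ::
  "complex \<Rightarrow> (int \<times> complex \<Rightarrow>\<^sub>0 int) \<Rightarrow> int \<Rightarrow> int \<Rightarrow> complex fps" where
  "lmonomial_series q u e i =
     (\<Prod>c\<in>{c. (i, c) \<in> Poly_Mapping.keys u}. expand e (psi q (c * q)) powi Poly_Mapping.lookup u (i, c))"

text \<open>As usual for \<open>\<ell>\<close>-weight spaces, one nilpotency exponent serves for all \<open>i\<close> and all \<open>s\<close>.\<close>

definition lweight_space ::
  "nat \<Rightarrow> complex \<Rightarrow> 'v::ab_group_add tor_rep \<Rightarrow> lmonomial \<Rightarrow> 'v set" where
  "lweight_space n t M m = (case m of (\<omega>, u) \<Rightarrow>
     {v \<in> weight_space n t M \<omega>. \<exists>N. \<forall>i\<in>idx n. \<forall>e\<in>{1,-1}. \<forall>s::nat.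
        ((\<lambda>y. phi t M e i (e * int s) y - scl M (fps_nth (lmonomial_series (exp t) u e i) s) y)
           ^^ N) v = 0})"

definition has_weight :: "nat \<Rightarrow> complex \<Rightarrow> 'v tor_rep \<Rightarrow> 'v \<Rightarrow> weight \<Rightarrow> bool" where
  "has_weight n t M w l \<longleftrightarrow> l \<in> weight_lattice n \<and> w \<in> weight_space n t M l"

text \<open>
  The weight of a nonzero weight vector is unique since \<open>q\<close> is not a root of unity;
  \<open>wt_at\<close> is its (integral) value on \<open>h\<^sub>i\<close>.
\<close>

definition weight_of :: "nat \<Rightarrow> complex \<Rightarrow> 'v tor_rep \<Rightarrow> 'v \<Rightarrow> weight" where
  "weight_of n t M w = (THE l. has_weight n t M w l)"

definition wt_at :: "nat \<Rightarrow> complex \<Rightarrow> 'v tor_rep \<Rightarrow> 'v \<Rightarrow> int \<Rightarrow> int" where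
  "wt_at n t M w i = \<lfloor>pairing (weight_of n t M w) (hvec_h i)\<rfloor>"

definition i_extremal :: "nat \<Rightarrow> complex \<Rightarrow> 'v::zero tor_rep \<Rightarrow> int \<Rightarrow> 'v \<Rightarrow> bool" where
  "i_extremal n t M i w \<longleftrightarrow> (\<exists>l. has_weight n t M w l) \<and>
     (wt_at n t M w i \<ge> 0 \<longrightarrow> xx M 1 i 0 w = 0) \<and>
     (wt_at n t M w i \<le> 0 \<longrightarrow> xx M (-1) i 0 w = 0)"

definition S_op :: "nat \<Rightarrow> complex \<Rightarrow> 'v tor_rep \<Rightarrow> int \<Rightarrow> 'v \<Rightarrow> 'v" where
  "S_op n t M i w = (let r = wt_at n t M w i; N = nat \<bar>r\<bar> in
     scl M (1 / qfact (exp t) N) ((xx M (if r \<ge> 0 then -1 else 1) i 0 ^^ N) w))"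

definition extremal :: "nat \<Rightarrow> complex \<Rightarrow> 'v::zero tor_rep \<Rightarrow> 'v \<Rightarrow> bool" where
  "extremal n t M w \<longleftrightarrow>
     (\<forall>js. set js \<subseteq> idx n \<longrightarrow> (\<forall>i\<in>idx n. i_extremal n t M i (foldr (S_op n t M) js w)))"

definition vertical_generators :: "nat \<Rightarrow> 'v tor_rep \<Rightarrow> int \<Rightarrow> ('v \<Rightarrow> 'v) set" where
  "vertical_generators n M j =
     generators M (idx n - {j}) {h. Poly_Mapping.keys h \<subseteq> Hb ` (idx n - {j})}"

definition extremal_loop_weight_rep ::
  "nat \<Rightarrow> complex \<Rightarrow> 'v::ab_group_add tor_rep \<Rightarrow> lmonomial \<Rightarrow> bool" where
  "extremal_loop_weight_rep n t M m \<longleftrightarrow>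
     m \<in> lmonomials n \<and> integrable_rep n t M \<and>
     (\<exists>v\<in>lweight_space n t M m.
        orbit M (all_generators n M) v = carr M \<and>
        extremal n t M v \<and>
        (\<forall>j\<in>idx n. \<forall>w\<in>carr M. finite_dim M (orbit M (vertical_generators n M j) w)))"

section \<open>Vector representations and their tensor products\<close>

text \<open>
  Action of the currents on a basis indexed by \<open>'b\<close>: \<open>cur e i b = Some (c, b')\<close> means that
  \<open>x\<^sub>i(z)\<close> with sign \<open>e\<close> maps \<open>b\<close> to \<open>\<delta>(c z) b'\<close>, and \<open>None\<close> means that it maps \<open>b\<close> to \<open>0\<close>;
  \<open>\<phi>\<^sub>i(z)\<close> acts on \<open>b\<close> by the expansions of \<open>eig i b\<close>; \<open>bwt b\<close> is the weight of \<open>b\<close>.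
\<close>

record 'b current_data =
  cur :: "int \<Rightarrow> int \<Rightarrow> 'b \<Rightarrow> (complex \<times> 'b) option"
  eig :: "int \<Rightarrow> 'b \<Rightarrow> ratfun"
  bwt :: "'b \<Rightarrow> weight"

definition box_weight :: "nat \<Rightarrow> int \<Rightarrow> weight" where
  "box_weight n j =
     (if j \<ge> 1 then varpi1 - (\<Sum>s=1..j - 1. simple_root n (cls n s))
      else varpi1 + (\<Sum>s=j..0. simple_root n (cls n s)))"

definition vector_rep :: "nat \<Rightarrow> complex \<Rightarrow> complex \<Rightarrow> int current_data" where
  "vector_rep n q a =
    \<lparr> cur = (\<lambda>e i j.
        if e = 1 then (if i = cls n (j - 1) then Some (a * q powi (j - 1), j - 1) else None)
        else (if i = cls n j then Some (a * q powi j, j + 1) else None)),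
      eig = (\<lambda>i j.
        if i = cls n j then psi q (a * q powi j)
        else if i = cls n (j - 1) then rf_inverse (psi q (a * q powi (j + 1)))
        else (1, 1)),
      bwt = box_weight n \<rparr>"

text \<open>
  The tensor product of the spaces described by a list \<open>Vs\<close> of length \<open>k\<close> has as basis the tensors
  \<open>bs!0 \<otimes> \<dots> \<otimes> bs!(k-1)\<close>, indexed by the lists \<open>bs\<close> of length \<open>k\<close>. For the sign plus (minus), the
  current acting on the \<open>u\<close>-th factor is accompanied by the \<open>\<phi>\<^sub>i(z)\<close> on the factors to its
  left (right).
\<close>

definition side :: "int \<Rightarrow> nat \<Rightarrow> nat \<Rightarrow> nat set" where
  "side e k u = (if e = 1 then {..<u} else {u<..<k})"

definition drinfeld_defined :: "nat \<Rightarrow> 'b current_data list \<Rightarrow> bool" where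
  "drinfeld_defined n Vs \<longleftrightarrow>
     (\<forall>bs i e u c b'. length bs = length Vs \<and> i \<in> idx n \<and> e \<in> {1, -1} \<and> u < length Vs \<and>
        cur (Vs!u) e i (bs!u) = Some (c, b') \<longrightarrow>
        (\<forall>s\<in>side e (length Vs) u. \<not> rf_pole (eig (Vs!s) i (bs!s)) (inverse c)))"

definition smul :: "complex \<Rightarrow> ('b \<Rightarrow>\<^sub>0 complex) \<Rightarrow> ('b \<Rightarrow>\<^sub>0 complex)" where
  "smul c = Poly_Mapping.map ((*) c)"

definition lin_ext :: "('b \<Rightarrow> 'c \<Rightarrow>\<^sub>0 complex) \<Rightarrow> ('b \<Rightarrow>\<^sub>0 complex) \<Rightarrow> ('c \<Rightarrow>\<^sub>0 complex)" where
  "lin_ext f v = (\<Sum>b\<in>Poly_Mapping.keys v. smul (Poly_Mapping.lookup v b) (f b))"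

definition tensor_x ::
  "'b current_data list \<Rightarrow> int \<Rightarrow> int \<Rightarrow> int \<Rightarrow> 'b list \<Rightarrow> 'b list \<Rightarrow>\<^sub>0 complex" where
  "tensor_x Vs e i r bs =
     (\<Sum>u<length Vs. case cur (Vs!u) e i (bs!u) of
        None \<Rightarrow> 0
      | Some (c, b') \<Rightarrow> Poly_Mapping.single (bs[u := b'])
          ((\<Prod>s\<in>side e (length Vs) u. rf_value (eig (Vs!s) i (bs!s)) (inverse c)) * c powi r))"

definition tensor_weight :: "'b current_data list \<Rightarrow> 'b list \<Rightarrow> weight" where
  "tensor_weight Vs bs = (\<Sum>s<length Vs. bwt (Vs!s) (bs!s))"

definition tensor_phi :: "'b current_data list \<Rightarrow> int \<Rightarrow> int \<Rightarrow> 'b list \<Rightarrow> complex fps" where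
  "tensor_phi Vs e i bs = (\<Prod>s<length Vs. expand e (eig (Vs!s) i (bs!s)))"

text \<open>
  The eigenvalue of \<open>h\<^sub>i\<^sub>,\<^sub>m\<close>, where \<open>m\<close> has sign \<open>e\<close>, is obtained from the eigenvalue \<open>F\<close> of \<open>\<phi>\<^sub>i\<close> with
  sign \<open>e\<close>, a series in \<open>y = z^e\<close>, by solving
  \<open>F = F(0) exp(e (q - 1/q) \<Sum>j\<ge>1. h\<^sub>i\<^sub>,\<^sub>e\<^sub>j y^j)\<close>; note that \<open>fps_ln 1\<close> is
  the series of \<open>ln (1 + X)\<close>.
\<close>

definition tensor_h :: "complex \<Rightarrow> 'b current_data list \<Rightarrow> int \<Rightarrow> int \<Rightarrow> 'b list \<Rightarrow> complex" where
  "tensor_h q Vs i m bs = (let e = sgn m; F = tensor_phi Vs e i bs in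
     of_int e / (q - inverse q) *
       fps_nth (fps_ln 1 oo (fps_const (inverse (fps_nth F 0)) * F - 1)) (nat \<bar>m\<bar>))"

definition drinfeld_tensor ::
  "complex \<Rightarrow> 'b current_data list \<Rightarrow> ('b list \<Rightarrow>\<^sub>0 complex) tor_rep" where
  "drinfeld_tensor t Vs =
    \<lparr> carr = {v. \<forall>bs\<in>Poly_Mapping.keys v. length bs = length Vs},
      scl = smul,
      xx = (\<lambda>e i r. lin_ext (tensor_x Vs e i r)),
      kk = (\<lambda>h. lin_ext (\<lambda>bs. Poly_Mapping.single bs (qpow t (pairing (tensor_weight Vs bs) h)))),
      hh = (\<lambda>i m. lin_ext (\<lambda>bs. Poly_Mapping.single bs (tensor_h (exp t) Vs i m bs))) \<rparr>"

end

theory Submission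
  imports Defs
begin

text \<open>
  The tensors of boxes form a basis on which every \<open>\<phi>\<^sub>i(z)\<close> is diagonal with rational eigenvalues, and
  on which \<open>x\<^sub>i(z)\<close> acts as a sum of components, one for each factor \<open>u\<close>: the component at \<open>u\<close> moves
  the box there by one step, if its class modulo \<open>n + 1\<close> fits \<open>i\<close>, and is supported at one point
  \<open>z\<close>, the inverse of \<open>a\<^sub>u q^m\<close> for some \<open>m\<close> in the class \<open>i\<close>. The two genericity conditions on
  \<open>a\<^sub>s / a\<^sub>u\<close> say exactly that at this point the eigenvalue of \<open>\<phi>\<^sub>i\<close> on any other factor has neither
  a pole (\<open>no_pole\<close>) nor a zero (\<open>value_nonzero\<close>). So the action is defined, no component that can
  occur vanishes, and the components of one current at different factors sit at different points.

  \<^emph>\<open>Relations.\<close> Moving a box with a current at node \<open>j\<close> multiplies the eigenvalue of \<open>\<phi>\<^sub>i\<close> by the factor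
  \<open>gam\<close>, the same rational function that occurs in the relation between \<open>x\<^sub>i\<close> and \<open>x\<^sub>j\<close>
  (\<open>rf_value_exchange\<close>). Hence the components of currents of one sign at two different factors commute
  up to \<open>gam\<close> (\<open>xc_exchange\<close>), and the quadratic and the Serre relations become identities between
  rational functions of the supporting points, with separate cases when two moves hit the same box. For
  currents of opposite signs the two factors \<open>gam\<close> cancel (\<open>xc_commute_opposite\<close>), so that only
  the components at equal factors contribute to the commutator. Their sum is the difference of the
  expansions at \<open>0\<close> and at \<open>\<infinity>\<close> of the eigenvalue of \<open>\<phi>\<^sub>i\<close>, by its decomposition into partial
  fractions (\<open>phi_eig_diff\<close>); all its poles are simple by \<open>no_pole\<close>.

  \<^emph>\<open>Thinness and irreducibility.\<close> If two basis vectors differ at some factor, the larger of their boxes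
  there causes a pole in the eigenvalue of one of the \<open>\<phi>\<^sub>i\<close>, which the other vector does not have and
  which no other factor cancels (\<open>tensor_phi_separates\<close>). So the Cartan currents have simple joint spectrum, and a
  nonzero submodule contains a basis vector. As the components of a current sit at different points,
  Lagrange interpolation yields a combination of the \<open>x\<^sub>i\<^sub>,\<^sub>r\<close> that isolates one of them
  (\<open>component_in_submodule\<close>). Hence each box can be moved alone, by any number of steps, and the
  submodule is everything. In particular every nonzero vector generates the module.

  \<^emph>\<open>Extremal loop weight structure.\<close> A current at node \<open>i\<close> moves each box at most once, which gives local
  nilpotency. Without the currents at node \<open>j\<close> a box stays in a block of \<open>n + 1\<close> consecutive
  integers, which gives finiteness for the vertical subalgebras. The vector of \<open>k\<close> boxes equal to \<open>1\<close>
  is extremal because its images under the operators \<open>S\<^sub>i\<close> are multiples of tensors of \<open>k\<close> equal boxes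
  (\<open>diagonal_extremal\<close>): all boxes of such a tensor are moved together or not at all.
\<close>

section \<open>Finitely supported vectors\<close>

abbreviation "lookup \<equiv> Poly_Mapping.lookup"
abbreviation "single \<equiv> Poly_Mapping.single"
abbreviation "keys \<equiv> Poly_Mapping.keys"

lemma lookup_smul [simp]: "lookup (smul c v) b = c * lookup v b"
  by (simp add: smul_def Poly_Mapping.map.rep_eq when_def)

lemma smul_single [simp]: "smul c (single b x) = single b (c * x)"
  by (rule poly_mapping_eqI) (simp add: lookup_single when_def)

lemma vector_space_smul: "vector_space smul"
  by unfold_locales (auto intro!: poly_mapping_eqI simp: lookup_add algebra_simps)

interpretation pm: vector_space smul
  by (rule vector_space_smul)

text \<open>
  The span of a set of basis vectors. Invariance of such spans under the currents can be
  checked on indices alone.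
\<close>

definition vecs :: "'b set \<Rightarrow> ('b \<Rightarrow>\<^sub>0 complex) set" where
  "vecs B = {v. keys v \<subseteq> B}"

lemma vecs_iff_lookup: "v \<in> vecs B \<longleftrightarrow> (\<forall>b. b \<notin> B \<longrightarrow> lookup v b = 0)"
  by (auto simp: vecs_def in_keys_iff)

lemma zero_in_vecs [simp]: "0 \<in> vecs B"
  by (simp add: vecs_def)

lemma single_in_vecs: "b \<in> B \<Longrightarrow> single b c \<in> vecs B"
  by (simp add: vecs_def)

lemma add_in_vecs: "u \<in> vecs B \<Longrightarrow> v \<in> vecs B \<Longrightarrow> u + v \<in> vecs B"
  by (simp add: vecs_iff_lookup lookup_add)

lemma smul_in_vecs: "v \<in> vecs B \<Longrightarrow> smul c v \<in> vecs B"
  by (simp add: vecs_iff_lookup)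

lemma sum_in_vecs: "(\<And>x. x \<in> S \<Longrightarrow> f x \<in> vecs B) \<Longrightarrow> sum f S \<in> vecs B"
  by (induction S rule: infinite_finite_induct) (auto simp: add_in_vecs)

lemma subspace_vecs: "pm.subspace (vecs B)"
  by (auto simp: pm.subspace_def add_in_vecs smul_in_vecs)

lemma vecs_expand:
  "v = (\<Sum>b\<in>keys v. smul (lookup v b) (single b 1))"
  by (rule poly_mapping_eqI) (auto simp: lookup_sum lookup_single when_def in_keys_iff)

lemma vecs_eq_span: "vecs B = pm.span ((\<lambda>b. single b 1) ` B)"
proof
  show "vecs B \<subseteq> pm.span ((\<lambda>b. single b 1) ` B)"
  proof
    fix v assume "v \<in> vecs B"
    then have "(\<Sum>b\<in>keys v. smul (lookup v b) (single b 1))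
        \<in> pm.span ((\<lambda>b. single b 1) ` B)"
      by (intro pm.span_sum pm.span_scale pm.span_base) (auto simp: vecs_def)
    then show "v \<in> pm.span ((\<lambda>b. single b 1) ` B)"
      by (simp only: vecs_expand [symmetric])
  qed
  show "pm.span ((\<lambda>b. single b 1) ` B) \<subseteq> vecs B"
    by (rule pm.span_minimal) (auto simp: subspace_vecs single_in_vecs)
qed

lemma lin_ext_superset:
  assumes "finite S" "keys v \<subseteq> S"
  shows "lin_ext f v = (\<Sum>b\<in>S. smul (lookup v b) (f b))"
  unfolding lin_ext_def using assms
  by (intro sum.mono_neutral_left) (auto simp: in_keys_iff)

lemma lin_ext_single [simp]: "lin_ext f (single b c) = smul c (f b)"
  using lin_ext_superset[of "{b}" "single b c" f] by simp

lemma lin_ext_0 [simp]: "lin_ext f 0 = 0"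
  by (simp add: lin_ext_def)

lemma lin_ext_add: "lin_ext f (u + v) = lin_ext f u + lin_ext f v"
proof -
  let ?S = "keys u \<union> keys v"
  have "keys (u + v) \<subseteq> ?S"
    by (rule Poly_Mapping.keys_add)
  then show ?thesis
    by (simp add: lin_ext_superset[of ?S] lookup_add pm.scale_left_distrib sum.distrib)
qed

lemma lin_ext_smul: "lin_ext f (smul c v) = smul c (lin_ext f v)"
proof -
  have "keys (smul c v) \<subseteq> keys v"
    by (auto simp: in_keys_iff)
  then show ?thesis
    by (simp add: lin_ext_superset[of "keys v"] pm.scale_sum_right)
qed

lemma lin_ext_sum: "lin_ext f (sum g S) = (\<Sum>x\<in>S. lin_ext f (g x))"
  by (induction S rule: infinite_finite_induct) (auto simp: lin_ext_add)

lemma lin_ext_lin_ext: "lin_ext f (lin_ext g v) = lin_ext (\<lambda>b. lin_ext f (g b)) v"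
  by (subst (2 3) lin_ext_def) (simp add: lin_ext_sum lin_ext_smul)

lemma lin_ext_fun_add: "lin_ext f v + lin_ext g v = lin_ext (\<lambda>b. f b + g b) v"
  by (simp add: lin_ext_def pm.scale_right_distrib sum.distrib)

lemma lin_ext_fun_diff: "lin_ext f v - lin_ext g v = lin_ext (\<lambda>b. f b - g b) v"
  by (simp add: lin_ext_def pm.scale_right_diff_distrib sum_subtractf)

lemma lin_ext_fun_smul: "smul c (lin_ext f v) = lin_ext (\<lambda>b. smul c (f b)) v"
  by (simp add: lin_ext_def pm.scale_sum_right mult.commute)

lemma lin_ext_fun_zero: "0 = lin_ext (\<lambda>b. 0) v"
  by (simp add: lin_ext_def)

text \<open>These rules turn an identity between composites of linear operators, evaluated at \<open>v\<close>, into
  one between linear extensions, which \<open>lin_ext_cong\<close> reduces to basis vectors.\<close>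

lemmas lin_ext_collect = lin_ext_lin_ext lin_ext_fun_add lin_ext_fun_diff lin_ext_fun_smul

lemma lin_ext_cong:
  "(\<And>b. b \<in> B \<Longrightarrow> f b = g b) \<Longrightarrow> v \<in> vecs B \<Longrightarrow> lin_ext f v = lin_ext g v"
  unfolding lin_ext_def vecs_def by (intro sum.cong) auto

lemma lin_ext_in_vecs:
  "(\<And>b. b \<in> B \<Longrightarrow> f b \<in> vecs B') \<Longrightarrow> v \<in> vecs B \<Longrightarrow> lin_ext f v \<in> vecs B'"
  unfolding lin_ext_def by (intro sum_in_vecs smul_in_vecs) (auto simp: vecs_def)

definition diag_op :: "('b \<Rightarrow> complex) \<Rightarrow> ('b \<Rightarrow>\<^sub>0 complex) \<Rightarrow> ('b \<Rightarrow>\<^sub>0 complex)" where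
  "diag_op d = lin_ext (\<lambda>b. single b (d b))"

lemma lookup_diag_op [simp]: "lookup (diag_op d v) b = d b * lookup v b"
  by (auto simp: diag_op_def lin_ext_def lookup_sum lookup_single when_def in_keys_iff)

lemma diag_op_single [simp]: "diag_op d (single b x) = single b (x * d b)"
  by (simp add: diag_op_def)

lemma diag_op_in_vecs: "v \<in> vecs B \<Longrightarrow> diag_op d v \<in> vecs B"
  by (simp add: vecs_iff_lookup)

section \<open>The series of Cartan currents on a basis of eigenvectors\<close>

text \<open>
  If every coefficient of an operator-valued series is diagonal, the powers of the series are computed
  separately on each basis vector, as powers of the scalar series of eigenvalues.
\<close>

lemma conv_power_diag_op:
  assumes A: "\<And>j. j \<ge> 1 \<Longrightarrow> A j = diag_op (\<lambda>b. fps_nth (H b) j)"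
    and H: "\<And>b. fps_nth (H b) 0 = 0"
  shows "conv_power A l m v = diag_op (\<lambda>b. fps_nth (H b ^ l) m) v"
proof (induction l arbitrary: m v)
  case 0
  show ?case by (rule poly_mapping_eqI) simp
next
  case (Suc l)
  have "fps_nth (H b ^ Suc l) m = (\<Sum>j=1..m. fps_nth (H b) j * fps_nth (H b ^ l) (m - j))" for b
  proof -
    have "fps_nth (H b ^ Suc l) m = (\<Sum>j=0..m. fps_nth (H b) j * fps_nth (H b ^ l) (m - j))"
      by (simp add: fps_mult_nth)
    also have "\<dots> = (\<Sum>j=1..m. fps_nth (H b) j * fps_nth (H b ^ l) (m - j))"
      by (rule sum.mono_neutral_right) (auto simp: H not_less_eq_eq Suc_le_eq)
    finally show ?thesis .
  qed
  then show ?case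
    by (intro poly_mapping_eqI) (simp add: Suc A lookup_sum sum_distrib_right mult.assoc)
qed

lemma exp_coeff_diag_op:
  assumes A: "\<And>j. j \<ge> 1 \<Longrightarrow> A j = diag_op (\<lambda>b. fps_nth (H b) j)"
    and H: "\<And>b. fps_nth (H b) 0 = 0"
  shows "exp_coeff smul A m v = diag_op (\<lambda>b. fps_nth (fps_exp 1 oo H b) m) v"
  by (rule poly_mapping_eqI)
    (simp add: exp_coeff_def conv_power_diag_op[OF assms] lookup_sum fps_compose_nth
      sum_distrib_right atLeast0AtMost mult.assoc)

lemma fps_exp_ln_compose:
  fixes F :: "complex fps"
  assumes "fps_nth F 0 = 0"
  shows "fps_exp 1 oo (fps_ln 1 oo F) = 1 + F"
proof -
  have "fps_exp 1 - 1 oo fps_ln (1 :: complex) = fps_X"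
    using fps_inv_right[of "fps_exp (1 :: complex) - 1"] by (simp add: fps_ln_fps_exp_inv)
  then have "fps_exp 1 oo fps_ln (1 :: complex) = 1 + fps_X"
    by (simp add: fps_compose_sub_distrib algebra_simps)
  moreover have "fps_exp 1 oo (fps_ln 1 oo F) = (fps_exp 1 oo fps_ln 1) oo F"
    using assms by (intro fps_compose_assoc) (auto simp: fps_ln_0)
  ultimately show ?thesis
    using assms by (simp add: fps_compose_add_distrib fps_X_fps_compose_startby0)
qed

text \<open>
  The coefficient of \<open>z^a\<close> for an integer \<open>a\<close>, when \<open>F\<close> is a series in \<open>z\<close> (\<open>e = 1\<close>) or in \<open>1/z\<close>
  (\<open>e = -1\<close>). Expansions at \<open>0\<close> and at \<open>\<infinity>\<close> can then be compared.
\<close>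

definition zcoeff :: "int \<Rightarrow> complex fps \<Rightarrow> int \<Rightarrow> complex" where
  "zcoeff e F a = (if e * a < 0 then 0 else fps_nth F (nat \<bar>a\<bar>))"

text \<open>
  The eigenvalues of the \<open>h\<^sub>i\<^sub>,\<^sub>m\<close> were defined by a logarithm, so exponentiating them returns the
  prescribed series up to its constant term, which has to agree with the eigenvalue of \<open>k\<^sub>i\<close>.
\<close>

lemma phi_drinfeld_tensor:
  assumes e: "e = 1 \<or> e = -1" and q: "exp t - inverse (exp t) \<noteq> 0"
    and F0: "\<And>bs. fps_nth (tensor_phi Vs e i bs) 0
               = qpow t (pairing (tensor_weight Vs bs) (if e = 1 then hvec_h i else - hvec_h i))"
  shows "phi t (drinfeld_tensor t Vs) e i a = diag_op (\<lambda>bs. zcoeff e (tensor_phi Vs e i bs) a)"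
proof
  fix v
  define K where "K bs = fps_nth (tensor_phi Vs e i bs) 0" for bs
  have K: "K bs \<noteq> 0" for bs
    by (simp add: K_def F0 qpow_def)
  define N where "N bs = fps_const (inverse (K bs)) * tensor_phi Vs e i bs - 1" for bs
  have N0: "fps_nth (N bs) 0 = 0" for bs
    using K[of bs] by (simp add: N_def K_def)
  define H where "H bs = fps_ln 1 oo N bs" for bs
  have H0: "fps_nth (H bs) 0 = 0" for bs
    by (simp add: H_def fps_ln_0)
  define A where "A = (\<lambda>j u. smul (of_int e * (exp t - inverse (exp t)))
      (hh (drinfeld_tensor t Vs) i (e * int j) u))"
  have A: "A j = diag_op (\<lambda>bs. fps_nth (H bs) j)" if j: "j \<ge> 1" for j
  proof (rule ext, rule poly_mapping_eqI)
    fix u bs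
    have s: "sgn (e * int j) = e" "nat \<bar>e * int j\<bar> = j"
      using e j by (auto simp: sgn_mult)
    show "lookup (A j u) bs
        = lookup (diag_op (\<lambda>bs. fps_nth (H bs) j) u) bs"
      using q e
      by (auto simp: A_def drinfeld_tensor_def tensor_h_def s H_def N_def K_def Let_def
          simp flip: diag_op_def)
  qed
  have "phi t (drinfeld_tensor t Vs) e i a v = (if e * a < 0 then 0 else
      diag_op K (exp_coeff smul A (nat \<bar>a\<bar>) v))"
    by (simp add: phi_def A_def drinfeld_tensor_def diag_op_def K_def F0)
  also have "\<dots> = diag_op (\<lambda>bs. zcoeff e (tensor_phi Vs e i bs) a) v"
  proof (rule poly_mapping_eqI)
    fix bs
    have "fps_exp 1 oo H bs = fps_const (inverse (K bs)) * tensor_phi Vs e i bs"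
      using N0[of bs] by (simp add: H_def fps_exp_ln_compose) (simp add: N_def)
    then show "lookup (if e * a < 0 then 0 else diag_op K (exp_coeff smul A (nat \<bar>a\<bar>) v)) bs
       = lookup (diag_op (\<lambda>bs. zcoeff e (tensor_phi Vs e i bs) a) v) bs"
      using K[of bs] by (simp add: exp_coeff_diag_op[OF A H0] zcoeff_def field_simps)
  qed
  finally show "phi t (drinfeld_tensor t Vs) e i a v
      = diag_op (\<lambda>bs. zcoeff e (tensor_phi Vs e i bs) a) v" .
qed

section \<open>Expansions of rational functions with simple poles\<close>

text \<open>
  The linear polynomial \<open>\<alpha> + \<beta> z\<close> as a series in \<open>z\<close> for \<open>e = 1\<close>, and multiplied by \<open>1/z\<close> as a
  series in \<open>1/z\<close> for \<open>e = -1\<close>. The shift is the same for all linear polynomials. It drops out of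
  every identity that is homogeneous in them, which is why both expansions can be treated at once.
\<close>

definition lin_fps :: "int \<Rightarrow> complex \<Rightarrow> complex \<Rightarrow> complex fps" where
  "lin_fps e \<alpha> \<beta> = (if e = 1 then fps_const \<alpha> + fps_const \<beta> * fps_X
                 else fps_const \<alpha> * fps_X + fps_const \<beta>)"

lemma lin_fps_scale: "fps_const k * lin_fps e \<alpha> \<beta> = lin_fps e (k * \<alpha>) (k * \<beta>)"
  by (simp add: lin_fps_def algebra_simps flip: fps_const_mult)

lemma lin_fps_add: "lin_fps e \<alpha> \<beta> + lin_fps e \<alpha>' \<beta>' = lin_fps e (\<alpha> + \<alpha>') (\<beta> + \<beta>')"
  by (simp add: lin_fps_def algebra_simps flip: fps_const_add)

lemma lin_fps_nonzero: "\<beta> \<noteq> 0 \<Longrightarrow> lin_fps e \<alpha> \<beta> \<noteq> 0"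
proof
  assume "\<beta> \<noteq> 0" and "lin_fps e \<alpha> \<beta> = 0"
  then show False
    using arg_cong[of "lin_fps e \<alpha> \<beta>" 0 "\<lambda>F. fps_nth F (if e = 1 then 1 else 0)"]
    by (auto simp: lin_fps_def split: if_splits)
qed

text \<open>
  An identity of products with linear polynomials, read off coefficientwise. The form of the
  conclusion is that in which the relations between \<open>\<phi>\<^sub>i\<close> and \<open>x\<^sub>j\<close> are stated.
\<close>

lemma zcoeff_lin_fps_mult_cong:
  assumes e: "e = 1 \<or> e = -1"
    and eq: "lin_fps e \<alpha> \<beta> * F = lin_fps e \<alpha>' \<beta>' * F'"
  shows "\<alpha> * zcoeff e F a + \<beta> * zcoeff e F (a - 1)
       = \<alpha>' * zcoeff e F' a + \<beta>' * zcoeff e F' (a - 1)"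
  using e
proof
  assume e1: "e = 1"
  have F: "fps_nth (lin_fps 1 \<gamma> \<epsilon> * H) m = \<gamma> * fps_nth H m + \<epsilon> * (if m = 0 then 0 else fps_nth H (m - 1))"
    for \<gamma> \<epsilon> H m by (simp add: lin_fps_def algebra_simps)
  show ?thesis
  proof (cases "a \<ge> 0")
    case True
    then obtain m where a: "a = int m" using nonneg_int_cases by blast
    have "zcoeff 1 H (a - 1) = (if m = 0 then 0 else fps_nth H (m - 1))" for H
      by (auto simp: a zcoeff_def nat_diff_distrib')
    moreover have "zcoeff 1 H a = fps_nth H m" for H
      by (simp add: a zcoeff_def)
    ultimately show ?thesis
      using arg_cong[OF eq, of "\<lambda>H. fps_nth H m"] by (simp only: e1 F)
  qed (simp add: e1 zcoeff_def)
next
  assume e1: "e = -1"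
  have F: "fps_nth (lin_fps (-1) \<gamma> \<epsilon> * H) m = \<gamma> * (if m = 0 then 0 else fps_nth H (m - 1)) + \<epsilon> * fps_nth H m"
    for \<gamma> \<epsilon> H m by (simp add: lin_fps_def algebra_simps)
  show ?thesis
  proof (cases "a \<le> 1")
    case True
    then obtain m where a: "a = 1 - int m" 
      using that[of "nat (1 - a)"] by simp
    have "zcoeff (-1) H a = (if m = 0 then 0 else fps_nth H (m - 1))" for H
    proof (cases m)
      case (Suc j)
      then show ?thesis by (simp add: a zcoeff_def)
    qed (simp add: a zcoeff_def)
    moreover have "zcoeff (-1) H (a - 1) = fps_nth H m" for H
      by (simp add: a zcoeff_def)
    ultimately show ?thesis
      using arg_cong[OF eq, of "\<lambda>H. fps_nth H m"] by (simp only: e1 F)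
  qed (simp add: e1 zcoeff_def)
qed

lemma zcoeff_mult_const [simp]: "zcoeff e (fps_const c * F) a = c * zcoeff e F a"
  by (simp add: zcoeff_def)

lemma zcoeff_add [simp]: "zcoeff e (F + G) a = zcoeff e F a + zcoeff e G a"
  by (simp add: zcoeff_def)

lemma zcoeff_sum: "zcoeff e (sum F S) a = (\<Sum>x\<in>S. zcoeff e (F x) a)"
  by (simp add: zcoeff_def fps_sum_nth)

text \<open>The expansion of \<open>1 / (1 - c z)\<close>.\<close>

definition geom :: "int \<Rightarrow> complex \<Rightarrow> complex fps" where
  "geom e c = lin_fps e 1 0 / lin_fps e 1 (- c)"

lemma geom_mult:
  assumes "c \<noteq> 0"
  shows "geom e c * lin_fps e 1 (- c) = lin_fps e 1 0"
proof -
  have "fps_nth (lin_fps e 1 (- c)) 0 \<noteq> 0"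
    using assms by (simp add: lin_fps_def)
  then show ?thesis
    by (simp add: geom_def fps_divide_unit mult.assoc inverse_mult_eq_1)
qed

lemma geom_product:
  assumes "c \<noteq> 0" "c' \<noteq> 0" "c \<noteq> c'"
  shows "geom e c * geom e c' = fps_const (c / (c - c')) * geom e c + fps_const (c' / (c' - c)) * geom e c'"
proof -
  let ?L = "lin_fps e 1 (- c)" and ?L' = "lin_fps e 1 (- c')" and ?u = "lin_fps e 1 0"
  let ?k = "c / (c - c')" and ?k' = "c' / (c' - c)"
  have sum: "fps_const ?k * ?L' + fps_const ?k' * ?L = ?u"
    unfolding lin_fps_scale lin_fps_add
    by (rule arg_cong2[where f = "lin_fps e"]) (use assms in \<open>simp_all add: divide_simps, simp_all add: algebra_simps\<close>)
  have "(fps_const ?k * geom e c + fps_const ?k' * geom e c') * (?L * ?L')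
      = (geom e c * geom e c') * (?L * ?L')"
  proof -
    have "(fps_const ?k * geom e c + fps_const ?k' * geom e c') * (?L * ?L')
        = fps_const ?k * (geom e c * ?L) * ?L' + fps_const ?k' * (geom e c' * ?L') * ?L"
      by (simp only: algebra_simps)
    also have "\<dots> = ?u * (fps_const ?k * ?L' + fps_const ?k' * ?L)"
      unfolding geom_mult[OF assms(1)] geom_mult[OF assms(2)] by (simp only: algebra_simps)
    also have "\<dots> = (geom e c * ?L) * (geom e c' * ?L')"
      unfolding geom_mult[OF assms(1)] geom_mult[OF assms(2)] sum ..
    finally show ?thesis by (simp only: algebra_simps)
  qed
  moreover have "?L * ?L' \<noteq> 0"
    using assms by (simp add: lin_fps_nonzero)
  ultimately show ?thesis
    by (metis mult_right_cancel)
qed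

text \<open>
  The difference of the two expansions of \<open>1 / (1 - c z)\<close> is the delta function \<open>\<delta>(c z)\<close>.
\<close>

lemma zcoeff_geom_diff:
  assumes "c \<noteq> 0"
  shows "zcoeff 1 (geom 1 c) a - zcoeff (-1) (geom (-1) c) a = c powi a"
proof -
  have g1: "geom 1 c = Abs_fps (\<lambda>m. c ^ m)"
  proof -
    have "Abs_fps (\<lambda>m. c ^ m) * lin_fps 1 1 (- c) = lin_fps 1 1 0"
    proof (rule fps_ext)
      fix m show "fps_nth (Abs_fps (\<lambda>m. c ^ m) * lin_fps 1 1 (- c)) m = fps_nth (lin_fps 1 1 0) m"
        by (cases m) (auto simp: lin_fps_def algebra_simps)
    qed
    then show ?thesis
      using geom_mult[OF assms, of 1] lin_fps_nonzero[of "- c" 1 1] assms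
      by (metis mult_right_cancel neg_equal_0_iff_equal)
  qed
  have g2: "geom (-1) c = Abs_fps (\<lambda>m. if m = 0 then 0 else - (inverse c ^ m))"
  proof -
    have "Abs_fps (\<lambda>m. if m = 0 then 0 else - (inverse c ^ m)) * lin_fps (-1) 1 (- c) = lin_fps (-1) 1 0"
    proof (rule fps_ext)
      fix m
      show "fps_nth (Abs_fps (\<lambda>m. if m = 0 then 0 else - (inverse c ^ m)) * lin_fps (-1) 1 (- c)) m
          = fps_nth (lin_fps (-1) 1 0) m"
        using assms by (cases m) (auto simp: lin_fps_def algebra_simps)
    qed
    then show ?thesis
      using geom_mult[OF assms, of "-1"] lin_fps_nonzero[of "- c" "-1" 1] assms
      by (metis mult_right_cancel neg_equal_0_iff_equal)
  qed
  show ?thesis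
    by (auto simp: g1 g2 zcoeff_def power_int_def)
qed

lemma fps_prod_nth_zero: "fps_nth (\<Prod>s\<in>S. F s) 0 = (\<Prod>s\<in>S. fps_nth (F s :: complex fps) 0)"
  by (induction S rule: infinite_finite_induct) auto

text \<open>
  Multiplying out replaces each product \<open>g\<^sub>s g\<^sub>u\<close> by a linear combination of \<open>g\<^sub>s\<close> and \<open>g\<^sub>u\<close>, so the
  product is a constant plus a combination of the \<open>g\<^sub>u\<close>. Only the rule for these products is assumed of
  \<open>g\<close>: it holds for either expansion of \<open>1 / (1 - c\<^sub>s z)\<close> and also for its values. The factors with
  \<open>B s = 0\<close> have no pole, and their \<open>c s\<close> may coincide with others.
\<close>

lemma partial_fractions:
  fixes g :: "'i \<Rightarrow> complex fps"
  assumes "finite S"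
    and "\<And>s. s \<in> S \<Longrightarrow> c s \<noteq> 0"
    and "\<And>s u. s \<in> S \<Longrightarrow> u \<in> S \<Longrightarrow> s \<noteq> u \<Longrightarrow> B s \<noteq> 0 \<Longrightarrow> B u \<noteq> 0 \<Longrightarrow>
      c s \<noteq> c u \<and> g s * g u = fps_const (c s / (c s - c u)) * g s + fps_const (c u / (c u - c s)) * g u"
  shows "(\<Prod>s\<in>S. fps_const (A s) + fps_const (B s) * g s) =
    fps_const (\<Prod>s\<in>S. A s)
    + (\<Sum>u\<in>S. fps_const (B u * (\<Prod>s\<in>S - {u}. A s + B s / (1 - c s / c u))) * g u)"
  using assms
proof (induction S arbitrary: g rule: finite_induct)
  case empty
  show ?case by simp
next
  case (insert x S)
  define R where "R u = B u * (\<Prod>s\<in>S - {u}. A s + B s / (1 - c s / c u))" for u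
  define P where "P = (\<Prod>s\<in>S. A s)"
  have IH: "(\<Prod>s\<in>S. fps_const (A s) + fps_const (B s) * g' s) = fps_const P + (\<Sum>u\<in>S. fps_const (R u) * g' u)"
    if "\<And>s u. s \<in> S \<Longrightarrow> u \<in> S \<Longrightarrow> s \<noteq> u \<Longrightarrow> B s \<noteq> 0 \<Longrightarrow> B u \<noteq> 0 \<Longrightarrow>
      c s \<noteq> c u \<and> g' s * g' u = fps_const (c s / (c s - c u)) * g' s + fps_const (c u / (c u - c s)) * g' u" for g'
    unfolding R_def P_def by (rule insert.IH) (use insert.prems that in auto)
  have c0: "c u \<noteq> 0" if "u \<in> insert x S" for u
    using insert.prems(1) that by blast
  have RB: "R u = 0" if "B u = 0" for u
    using that by (simp add: R_def)
  have ne: "c x \<noteq> c u" if "u \<in> S" "B u \<noteq> 0" "B x \<noteq> 0" for u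
    using insert.prems(2)[of x u] insert.hyps that by auto
  \<comment> \<open>The residue at the new pole is the value there of the product over \<open>S\<close>; the induction
    hypothesis applied to constant series yields this value.\<close>
  have val: "B x * (\<Prod>s\<in>S. A s + B s / (1 - c s / c x)) = B x * (P + (\<Sum>u\<in>S. R u / (1 - c u / c x)))"
  proof (cases "B x = 0")
    case False
    have "(\<Prod>s\<in>S. fps_const (A s) + fps_const (B s) * fps_const (1 / (1 - c s / c x)))
        = fps_const P + (\<Sum>u\<in>S. fps_const (R u) * fps_const (1 / (1 - c u / c x)))"
    proof (rule IH)
      fix s u assume su: "s \<in> S" "u \<in> S" "s \<noteq> u" "B s \<noteq> 0" "B u \<noteq> 0"
      have cs: "c s \<noteq> c u"
        using insert.prems(2)[of s u] su by auto
      have "1 / (1 - c s / c x) * (1 / (1 - c u / c x))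
          = c s / (c s - c u) * (1 / (1 - c s / c x)) + c u / (c u - c s) * (1 / (1 - c u / c x))"
      proof -
        have i: "1 / (1 - c y / c x) = c x / (c x - c y)" if "y \<in> S" "B y \<noteq> 0" for y
          using ne[of y] c0[of x] False that by (simp add: divide_simps)
        have d: "c x - c s \<noteq> 0" "c x - c u \<noteq> 0" "c s - c u \<noteq> 0" "c u - c s \<noteq> 0"
          using ne su False cs by auto
        show ?thesis
          unfolding i[OF su(1,4)] i[OF su(2,5)] using d
          by (simp add: divide_simps) (simp add: algebra_simps)
      qed
      then show "c s \<noteq> c u \<and> fps_const (1 / (1 - c s / c x)) * fps_const (1 / (1 - c u / c x))
        = fps_const (c s / (c s - c u)) * fps_const (1 / (1 - c s / c x))
          + fps_const (c u / (c u - c s)) * fps_const (1 / (1 - c u / c x))"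
        using cs by (simp only: fps_const_mult fps_const_add) simp
    qed
    from arg_cong[OF this, of "\<lambda>F. fps_nth F 0"]
    have "(\<Prod>s\<in>S. A s + B s / (1 - c s / c x)) = P + (\<Sum>u\<in>S. R u / (1 - c u / c x))"
      by (simp add: fps_sum_nth fps_prod_nth_zero)
    then show ?thesis by simp
  qed simp
  have upd: "B u * (\<Prod>s\<in>insert x S - {u}. A s + B s / (1 - c s / c u))
      = R u * (A x + B x / (1 - c x / c u))" if "u \<in> S" for u
  proof -
    have "insert x S - {u} = insert x (S - {u})" "x \<notin> S - {u}"
      using insert.hyps that by auto
    then show ?thesis using insert.hyps by (simp add: R_def mult.commute mult.left_commute)
  qed
  have prod: "fps_const (R u) * g u * (fps_const (A x) + fps_const (B x) * g x)
    = fps_const (R u * (A x + B x / (1 - c x / c u))) * g u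
      + fps_const (B x * (R u / (1 - c u / c x))) * g x" if u: "u \<in> S" for u
  proof (cases "B u = 0 \<or> B x = 0")
    case True
    then show ?thesis using RB[of u] by (auto simp: algebra_simps)
  next
    case False
    have n: "c x - c u \<noteq> 0" "c u - c x \<noteq> 0" "c x \<noteq> 0" "c u \<noteq> 0"
      using ne[OF u] False c0[of x] c0[of u] u by auto
    have "x \<noteq> u" using u insert.hyps by auto
    then have gg: "g x * g u = fps_const (c x / (c x - c u)) * g x + fps_const (c u / (c u - c x)) * g u"
      using insert.prems(2)[of x u] u False by auto
    have "fps_const (R u) * g u * (fps_const (A x) + fps_const (B x) * g x)
      = fps_const (R u * A x) * g u + fps_const (R u * B x) * (g x * g u)"
      by (simp add: algebra_simps flip: fps_const_mult)
    also have "\<dots> = fps_const (R u * A x + R u * B x * (c u / (c u - c x))) * g u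
        + fps_const (R u * B x * (c x / (c x - c u))) * g x"
      unfolding gg by (simp only: algebra_simps flip: fps_const_mult fps_const_add)
    also have "R u * A x + R u * B x * (c u / (c u - c x)) = R u * (A x + B x / (1 - c x / c u))"
      using n by (simp add: divide_simps) (simp add: algebra_simps)
    also have "R u * B x * (c x / (c x - c u)) = B x * (R u / (1 - c u / c x))"
      using n by (simp add: divide_simps)
    finally show ?thesis .
  qed
  have "(\<Prod>s\<in>insert x S. fps_const (A s) + fps_const (B s) * g s)
      = (fps_const P + (\<Sum>u\<in>S. fps_const (R u) * g u)) * (fps_const (A x) + fps_const (B x) * g x)"
    using IH[of g] insert.hyps insert.prems(2) by (simp add: mult.commute)
  also have "\<dots> = fps_const P * (fps_const (A x) + fps_const (B x) * g x)
      + (\<Sum>u\<in>S. fps_const (R u) * g u * (fps_const (A x) + fps_const (B x) * g x))"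
    by (simp add: distrib_right sum_distrib_right)
  also have "\<dots> = fps_const P * (fps_const (A x) + fps_const (B x) * g x)
      + (\<Sum>u\<in>S. fps_const (R u * (A x + B x / (1 - c x / c u))) * g u)
      + (\<Sum>u\<in>S. fps_const (B x * (R u / (1 - c u / c x)))) * g x"
    using prod by (simp add: sum.distrib sum_distrib_right)
  also have "(\<Sum>u\<in>S. fps_const (B x * (R u / (1 - c u / c x)))) = fps_const (B x * (\<Sum>u\<in>S. R u / (1 - c u / c x)))"
    by (rule fps_ext) (simp add: fps_sum_nth sum_distrib_left)
  also have "fps_const P * (fps_const (A x) + fps_const (B x) * g x)
      + (\<Sum>u\<in>S. fps_const (R u * (A x + B x / (1 - c x / c u))) * g u)
      + fps_const (B x * (\<Sum>u\<in>S. R u / (1 - c u / c x))) * g x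
    = fps_const (A x * P) + (fps_const (B x * (P + (\<Sum>u\<in>S. R u / (1 - c u / c x)))) * g x
      + (\<Sum>u\<in>S. fps_const (R u * (A x + B x / (1 - c x / c u))) * g u))"
    by (simp add: algebra_simps flip: fps_const_mult fps_const_add)
  also have "\<dots> = fps_const (\<Prod>s\<in>insert x S. A s)
    + (\<Sum>u\<in>insert x S. fps_const (B u * (\<Prod>s\<in>insert x S - {u}. A s + B s / (1 - c s / c u))) * g u)"
    unfolding val [symmetric] using insert.hyps upd by (simp add: P_def)
  finally show ?case .
qed

section \<open>Cartan integers modulo \<open>n + 1\<close>\<close>

lemma cls_eq_iff: "cls n x = cls n y \<longleftrightarrow> (int n + 1) dvd (x - y)"
  by (simp add: cls_def mod_eq_dvd_iff)

lemma cls_in_idx [simp]: "cls n x \<in> idx n"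
  using pos_mod_bound[of "int n + 1" x] by (simp add: cls_def idx_def)

lemma cls_add_cls: "cls n (cls n x + y) = cls n (x + y)"
  by (simp add: cls_def mod_simps)

lemma cls_diff_cls: "cls n (cls n x - y) = cls n (x - y)"
  by (simp add: cls_def mod_simps)

lemma cls_idx: "i \<in> idx n \<Longrightarrow> cls n i = i"
  by (simp add: cls_def idx_def)

lemma cls_shift_ne:
  assumes "n \<ge> 2" "d \<noteq> 0" "\<bar>d\<bar> \<le> 2" "x = y + d"
  shows "cls n x \<noteq> cls n y"
proof
  assume "cls n x = cls n y"
  then have "(int n + 1) dvd d"
    using assms(4) by (simp add: cls_eq_iff)
  then have "\<bar>int n + 1\<bar> \<le> \<bar>d\<bar>"
    using assms(2) dvd_imp_le_int by blast
  then show False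
    using assms by linarith
qed

text \<open>
  A current at the class of \<open>m\<close> moves a box between \<open>m\<close> and \<open>m + 1\<close>. For \<open>n \<ge> 2\<close> the nodes that are
  affected are the distinct classes of \<open>m - 1\<close>, \<open>m\<close> and \<open>m + 1\<close>.
\<close>

lemma cartan_cls_cases:
  assumes "n \<ge> 2" "i \<in> idx n"
  obtains (same) "i = cls n m" "cartan n i (cls n m) = 2"
  | (up) "i = cls n (m + 1)" "cartan n i (cls n m) = -1"
  | (down) "i = cls n (m - 1)" "cartan n i (cls n m) = -1"
  | (far) "i \<noteq> cls n m" "i \<noteq> cls n (m + 1)" "i \<noteq> cls n (m - 1)" "cartan n i (cls n m) = 0"
proof -
  have ne: "cls n (m + 1) \<noteq> cls n m" "cls n (m - 1) \<noteq> cls n m"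
    by (rule cls_shift_ne[OF assms(1), of 1], simp_all, rule cls_shift_ne[OF assms(1), of "-1"], simp_all)
  have "i = cls n (m + 1) \<or> i = cls n (m - 1)" if "adjacent n i (cls n m)"
  proof -
    have "cls n m = cls n (i + 1) \<or> cls n m = cls n (i - 1)"
      using that by (simp add: adjacent_def)
    then have "cls n (cls n m - 1) = i \<or> cls n (cls n m + 1) = i"
      using assms(2) by (metis cls_idx cls_diff_cls cls_add_cls add_diff_cancel_right' diff_add_cancel)
    then show ?thesis
      by (auto simp: cls_add_cls cls_diff_cls)
  qed
  moreover have "adjacent n (cls n (m + 1)) (cls n m)" "adjacent n (cls n (m - 1)) (cls n m)"
    by (simp_all add: adjacent_def cls_add_cls cls_diff_cls)
  ultimately have "cartan n i (cls n m) = (if i = cls n m then 2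
      else if i = cls n (m + 1) \<or> i = cls n (m - 1) then -1 else 0)"
    using ne by (auto simp: cartan_def)
  then show ?thesis
    using that ne by metis
qed

lemma adjacent_cartan: "n \<ge> 2 \<Longrightarrow> i \<in> idx n \<Longrightarrow> j \<in> idx n \<Longrightarrow> adjacent n i j \<Longrightarrow> cartan n i j = -1"
  using cls_shift_ne[of n 1 "j + 1" j] cls_shift_ne[of n "-1" "j - 1" j]
  by (auto simp: cartan_def adjacent_def cls_idx)

section \<open>One vector representation\<close>

locale quantum =
  fixes n :: nat and t q :: complex
  assumes n2: "n \<ge> 2" and q_exp: "q = exp t" and nonroot: "\<And>m::nat. m > 0 \<Longrightarrow> q ^ m \<noteq> 1"
begin

lemma q0 [simp]: "q \<noteq> 0"
  by (simp add: q_exp)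

lemma powi_ne_1: "d \<noteq> 0 \<Longrightarrow> q powi d \<noteq> 1"
  using nonroot[of "nat d"] nonroot[of "nat (- d)"]
  by (auto simp: power_int_def power_inverse)

lemma q2: "q * q \<noteq> 1"
  using nonroot[of 2] by (simp add: power2_eq_square)

lemma q_inv: "q - inverse q \<noteq> 0"
  using q2 by (simp add: field_simps)

lemma powi_add: "q powi (x + y) = q powi x * q powi y"
  by (simp add: power_int_add)

lemma qpow_int: "qpow t (of_int x) = q powi x"
  by (simp add: qpow_def q_exp exp_power_int mult.commute)

abbreviation beig :: "complex \<Rightarrow> int \<Rightarrow> int \<Rightarrow> ratfun" where
  "beig a \<equiv> eig (vector_rep n q a)"

lemma cls_pred_ne: "cls n (l - 1) \<noteq> cls n l"
  by (rule cls_shift_ne[OF n2, of "-1"]) auto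

lemma beig_simps:
  "beig a (cls n l) l = psi q (a * q powi l)"
  "beig a (cls n (l - 1)) l = rf_inverse (psi q (a * q powi (l + 1)))"
  "i \<noteq> cls n l \<Longrightarrow> i \<noteq> cls n (l - 1) \<Longrightarrow> beig a i l = (1, 1)"
  using cls_shift_ne[OF n2, of "-1" "l - 1" l] by (auto simp: vector_rep_def)

lemma expand_quotient:
  assumes "e = 1 \<or> e = -1" "p1 \<noteq> 0" "r0 \<noteq> 0" "r1 \<noteq> 0"
  shows "expand e ([:p0, p1:], [:r0, r1:]) * lin_fps e r0 r1 = lin_fps e p0 p1"
proof -
  have r: "reflect_poly [:r0, r1:] = [:r1, r0:]" "reflect_poly [:p0, p1:] = [:p1, p0:]"
    using assms by (simp_all add: reflect_poly_def cCons_def)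
  have f: "fps_of_poly [:x, y:] = lin_fps 1 x y" and g: "fps_of_poly [:y, x:] = lin_fps (-1) x y" for x y
    by (simp_all add: fps_of_poly_pCons lin_fps_def algebra_simps)
  have u: "fps_nth (lin_fps 1 r0 r1) 0 \<noteq> 0" "fps_nth (lin_fps (-1) r0 r1) 0 \<noteq> 0"
    using assms by (simp_all add: lin_fps_def)
  have "expand 1 ([:p0, p1:], [:r0, r1:]) = lin_fps 1 p0 p1 / lin_fps 1 r0 r1"
    by (simp add: expand_def f)
  moreover have "expand (-1) ([:p0, p1:], [:r0, r1:]) = lin_fps (-1) p0 p1 / lin_fps (-1) r0 r1"
    using assms by (simp add: expand_def r g)
  ultimately show ?thesis
    using assms(1) u by (auto simp: fps_divide_unit mult.assoc inverse_mult_eq_1)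
qed

lemma expand_psi:
  assumes "e = 1 \<or> e = -1" "c \<noteq> 0"
  shows "expand e (psi q c) * lin_fps e 1 (- c) = lin_fps e q (- (inverse q * c))"
    and "expand e (rf_inverse (psi q c)) * lin_fps e q (- (inverse q * c)) = lin_fps e 1 (- c)"
  unfolding psi_def rf_inverse_def fst_conv snd_conv
  by (rule expand_quotient; use assms in simp)+

lemma expand_one: "expand e (1, 1) = 1"
  by (simp add: expand_def)

text \<open>
  The eigenvalue of \<open>\<phi>\<^sub>i(z)\<close> on the box \<open>l\<close> is \<open>A + B / (1 - c z)\<close> with \<open>A\<close>, \<open>B\<close> and \<open>c\<close> given by the
  next three definitions. If \<open>i\<close> is neither the class of \<open>l\<close> nor that of \<open>l - 1\<close>, then \<open>B = 0\<close> and the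
  value of \<open>c\<close> is arbitrary.
\<close>

definition eig_const :: "int \<Rightarrow> int \<Rightarrow> complex" where
  "eig_const i l = (if i = cls n l then inverse q else if i = cls n (l - 1) then q else 1)"
definition eig_residue :: "int \<Rightarrow> int \<Rightarrow> complex" where
  "eig_residue i l = (if i = cls n l then q - inverse q
              else if i = cls n (l - 1) then inverse q - q else 0)"
definition eig_pole :: "complex \<Rightarrow> int \<Rightarrow> int \<Rightarrow> complex" where
  "eig_pole a i l = a * q powi (if i = cls n l then l else l - 1)"

lemma eig_pole_nonzero: "a \<noteq> 0 \<Longrightarrow> eig_pole a i l \<noteq> 0"
  by (simp add: eig_pole_def)

lemma expand_beig:
  assumes e: "e = 1 \<or> e = -1" and a: "a \<noteq> 0"
  shows "expand e (beig a i l) = fps_const (eig_const i l) + fps_const (eig_residue i l) * geom e (eig_pole a i l)"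
proof -
  note ne = cls_pred_ne[of l]
  consider "i = cls n l" | "i = cls n (l - 1)" | "i \<noteq> cls n l" "i \<noteq> cls n (l - 1)" by blast
  then show ?thesis
  proof cases
    case 1
    define c where "c = a * q powi l"
    have c: "c \<noteq> 0" using a by (simp add: c_def)
    have "(fps_const (inverse q) + fps_const (q - inverse q) * geom e c) * lin_fps e 1 (- c)
      = fps_const (inverse q) * lin_fps e 1 (- c) + fps_const (q - inverse q) * (geom e c * lin_fps e 1 (- c))"
      by (simp only: algebra_simps)
    also have "\<dots> = lin_fps e q (- (inverse q * c))"
      by (simp add: geom_mult[OF c] lin_fps_scale lin_fps_add)
    also have "\<dots> = expand e (psi q c) * lin_fps e 1 (- c)"
      by (simp add: expand_psi[OF e c])
    finally have "fps_const (inverse q) + fps_const (q - inverse q) * geom e c = expand e (psi q c)"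
      using lin_fps_nonzero[of "- c" e 1] c by simp
    then show ?thesis
      unfolding 1 by (simp add: beig_simps eig_const_def eig_residue_def eig_pole_def c_def)
  next
    case 2
    define c where "c = a * q powi (l - 1)"
    have c: "c \<noteq> 0" using a by (simp add: c_def)
    have c2: "a * q powi (l + 1) = q * q * c"
      using powi_add[of 2 "l - 1"] by (simp add: c_def power2_eq_square add.commute)
    have L: "lin_fps e q (- (inverse q * (q * q * c))) = fps_const q * lin_fps e 1 (- c)"
      by (simp add: lin_fps_scale field_simps)
    have "(fps_const q + fps_const (inverse q - q) * geom e c) * (fps_const q * lin_fps e 1 (- c))
      = fps_const q * (fps_const q * lin_fps e 1 (- c)) + fps_const (inverse q - q) * (fps_const q * (geom e c * lin_fps e 1 (- c)))"
      by (simp only: algebra_simps)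
    also have "\<dots> = lin_fps e 1 (- (q * q * c))"
      unfolding geom_mult[OF c] lin_fps_scale lin_fps_add by (simp add: field_simps)
    also have "\<dots> = expand e (rf_inverse (psi q (q * q * c))) * (fps_const q * lin_fps e 1 (- c))"
      using expand_psi(2)[OF e, of "q * q * c"] c unfolding L by simp
    finally have "fps_const q + fps_const (inverse q - q) * geom e c
        = expand e (rf_inverse (psi q (q * q * c)))"
      using lin_fps_nonzero[of "- c" e 1] c by simp
    then show ?thesis
      unfolding 2 using ne by (simp add: beig_simps eig_const_def eig_residue_def eig_pole_def c2 flip: c_def)
  next
    case 3
    then show ?thesis by (simp add: beig_simps eig_const_def eig_residue_def expand_one)
  qed
qed

lemma expand_beig_0:
  assumes e: "e = 1 \<or> e = -1" and a: "a \<noteq> 0"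
  shows "fps_nth (expand e (beig a i l)) 0
    = q powi (e * ((if i = cls n l then 1 else 0) - (if i = cls n (l - 1) then 1 else 0)))"
proof -
  note ne = cls_pred_ne[of l]
  have "fps_nth (geom e c * lin_fps e 1 (- c)) 0 = fps_nth (lin_fps e 1 0) 0" if "c \<noteq> 0" for c
    by (simp add: geom_mult that)
  then have g: "fps_nth (geom e c) 0 = (if e = 1 then 1 else 0)" if "c \<noteq> 0" for c
    using that e by (force simp: lin_fps_def)
  show ?thesis
    using e ne g[OF eig_pole_nonzero[OF a]]
    by (auto simp: expand_beig[OF e a] eig_const_def eig_residue_def power_int_minus)
qed

definition beig_active :: "int \<Rightarrow> int \<Rightarrow> bool" where
  "beig_active i l \<longleftrightarrow> i = cls n l \<or> i = cls n (l - 1)"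

lemma eig_pole_double: "i \<noteq> cls n l \<Longrightarrow> a * q powi (l + 1) = q * q * eig_pole a i l"
  using powi_add[of 2 "l - 1"] by (simp add: eig_pole_def power2_eq_square add.commute)

lemma rf_pole_beig: "rf_pole (beig a i l) z \<longleftrightarrow> beig_active i l \<and> eig_pole a i l * z = 1"
proof -
  note ne = cls_pred_ne[of l]
  consider "i = cls n l" | "i = cls n (l - 1)" | "i \<noteq> cls n l" "i \<noteq> cls n (l - 1)" by blast
  then show ?thesis
  proof cases
    case 1
    then show ?thesis
      by (auto simp: beig_simps rf_pole_def psi_def beig_active_def eig_pole_def algebra_simps)
  next
    case 2
    with ne have i: "i \<noteq> cls n l" by simp
    have "q - inverse q * (q * q * eig_pole a i l) * z = q * (1 - eig_pole a i l * z)"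
      by (simp add: algebra_simps)
    then have "(q - inverse q * (q * q * eig_pole a i l) * z = 0) = (eig_pole a i l * z = 1)"
      by auto
    then show ?thesis
      using i 2 eig_pole_double[OF i, of a]
      by (simp add: beig_simps rf_pole_def psi_def rf_inverse_def beig_active_def algebra_simps)
  next
    case 3
    then show ?thesis by (simp add: beig_simps rf_pole_def beig_active_def)
  qed
qed

lemma rf_value_beig:
  assumes "\<not> rf_pole (beig a i l) z"
  shows "rf_value (beig a i l) z = eig_const i l + eig_residue i l / (1 - eig_pole a i l * z)"
proof -
  note ne = cls_pred_ne[of l]
  consider "i = cls n l" | "i = cls n (l - 1)" | "i \<noteq> cls n l" "i \<noteq> cls n (l - 1)" by blast
  then show ?thesis
  proof cases
    case 1
    then have "1 - eig_pole a i l * z \<noteq> 0"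
      using assms by (auto simp: rf_pole_beig beig_active_def)
    then show ?thesis
      using 1 by (simp add: beig_simps rf_value_def psi_def eig_const_def eig_residue_def eig_pole_def field_simps)
  next
    case 2
    with ne have i: "i \<noteq> cls n l" by simp
    have "1 - eig_pole a i l * z \<noteq> 0"
      using assms 2 by (auto simp: rf_pole_beig beig_active_def)
    then show ?thesis
      using 2 i ne eig_pole_double[OF i, of a]
      by (simp add: beig_simps rf_value_def psi_def rf_inverse_def eig_const_def eig_residue_def)
        (simp add: divide_simps, simp add: algebra_simps)
  next
    case 3
    then show ?thesis by (simp add: beig_simps rf_value_def eig_const_def eig_residue_def)
  qed
qed

text \<open>
  \<open>\<psi>(c z)\<close> vanishes at \<open>c z = q^2\<close>, and \<open>1 / \<psi>(c z)\<close> at \<open>c z = 1\<close>.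
\<close>

lemma rf_value_beig_nonzero:
  assumes "\<not> rf_pole (beig a i l) z"
    and "i = cls n l \<Longrightarrow> a * q powi (l - 2) * z \<noteq> 1"
    and "i = cls n (l - 1) \<Longrightarrow> a * q powi (l + 1) * z \<noteq> 1"
  shows "rf_value (beig a i l) z \<noteq> 0"
proof -
  note ne = cls_pred_ne[of l]
  consider "i = cls n l" | "i = cls n (l - 1)" | "i \<noteq> cls n l" "i \<noteq> cls n (l - 1)" by blast
  then show ?thesis
  proof cases
    case 1
    have "q powi l = q * q * q powi (l - 2)"
      using powi_add[of 2 "l - 2"] by (simp add: power2_eq_square add.commute)
    then have "q - inverse q * (a * q powi l) * z = q * (1 - a * q powi (l - 2) * z)"
      by (simp add: algebra_simps)
    then have "q - inverse q * (a * q powi l) * z \<noteq> 0"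
      using assms(2)[OF 1] by simp
    then show ?thesis
      using assms(1) 1 by (simp add: beig_simps rf_value_def psi_def rf_pole_def algebra_simps)
  next
    case 2
    then show ?thesis
      using assms(1) assms(3)[OF 2]
      by (simp add: beig_simps rf_value_def psi_def rf_pole_def rf_inverse_def algebra_simps)
  next
    case 3
    then show ?thesis by (simp add: beig_simps rf_value_def)
  qed
qed

text \<open>
  The factor in \<open>\<phi>\<^sub>i(z) x\<^sub>j(w) = gam C w z x\<^sub>j(w) \<phi>\<^sub>i(z)\<close>, where \<open>C\<close> is the Cartan integer, taken with
  the sign of the current. For \<open>C = 0\<close> it is set to \<open>1\<close> even at \<open>w = z\<close>, a case that the genericity
  conditions do not exclude.
\<close>

definition gam :: "int \<Rightarrow> complex \<Rightarrow> complex \<Rightarrow> complex" where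
  "gam C w z = (if C = 0 then 1 else (q powi C * w - z) / (w - q powi C * z))"

text \<open>
  Neither the numerator nor the denominator of \<open>gam C w z\<close> vanishes.
\<close>

definition regular :: "int \<Rightarrow> complex \<Rightarrow> complex \<Rightarrow> bool" where
  "regular C w z \<longleftrightarrow> (C \<noteq> 0 \<longrightarrow> w \<noteq> q powi C * z \<and> q powi C * w \<noteq> z)"

lemma regular_minus: "regular (- C) w z \<longleftrightarrow> regular C w z"
  by (auto simp: regular_def power_int_minus field_simps)

lemma gam_minus:
  assumes "regular C w z"
  shows "gam (- C) w z = inverse (gam C w z)"
proof (cases "C = 0")
  case False
  let ?p = "q powi C"
  have "inverse ?p * w - z = (w - ?p * z) / ?p" "w - inverse ?p * z = (?p * w - z) / ?p"
    by (simp_all add: field_simps)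
  then show ?thesis
    using False by (simp add: gam_def power_int_minus)
qed (simp add: gam_def)

lemma gam_nonzero: "regular C w z \<Longrightarrow> gam C w z \<noteq> 0"
  by (auto simp: gam_def regular_def)

text \<open>
  The position \<open>m\<close> such that the current of sign \<open>e\<close> that moves the box \<open>l\<close> is at the class of \<open>m\<close> and
  supported at \<open>a q^m z = 1\<close>: the box is moved from \<open>m + 1\<close> to \<open>m\<close> for \<open>e = 1\<close>, and back for \<open>e = -1\<close>.
\<close>

definition bpos :: "int \<Rightarrow> int \<Rightarrow> int" where
  "bpos e l = (if e = 1 then l - 1 else l)"

lemma bpos_move: "e = 1 \<or> e = -1 \<Longrightarrow> bpos e (l - e) = bpos e l - e"
  by (auto simp: bpos_def)

text \<open>
  The relation between \<open>\<phi>\<^sub>i(z)\<close> and a current in one vector representation. The eigenvalues before and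
  after the move are compared by multiplying with both denominators; in each of the cases for the Cartan
  integer the linear polynomials on the two sides agree up to scalar factors.
\<close>

lemma expand_exchange_up:
  assumes i: "i \<in> idx n" and a: "a \<noteq> 0" and e': "e' = 1 \<or> e' = -1"
  fixes m defines "W \<equiv> inverse (a * q powi m)" and "C \<equiv> cartan n i (cls n m)"
  shows "lin_fps e' W (- (q powi C)) * expand e' (beig a i m)
       = lin_fps e' (q powi C * W) (-1) * expand e' (beig a i (m + 1))"
proof -
  let ?c = "inverse W"
  have c: "?c \<noteq> 0" "W \<noteq> 0" and am: "a * q powi m = ?c"
    using a by (auto simp: W_def)
  have pw: "a * q powi (m + 1) = q * ?c" "a * q powi (m + 1 + 1) = q * q * ?c"
    using powi_add[of m 1] powi_add[of 2 m] by (simp_all add: power2_eq_square flip: am)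
  have ne: "cls n (m + 1) \<noteq> cls n m" "cls n (m - 1) \<noteq> cls n m" "cls n (m + 1) \<noteq> cls n (m - 1)"
    by (rule cls_shift_ne[OF n2, of 1] cls_shift_ne[OF n2, of "-1"] cls_shift_ne[OF n2, of 2]; simp)+
  have b0: "beig a (cls n m) (m + 1) = rf_inverse (psi q (q * q * ?c))"
    using beig_simps(2)[of a "m + 1"] unfolding pw by simp
  have u: "inverse q * W * q = W" "inverse q * W * - (inverse q * (q * inverse W)) = - inverse q"
    "inverse q * W * - (q * inverse W) = -1" "inverse q * W * 1 = inverse q * W"
    using c by (simp_all add: field_simps)
  show ?thesis
  proof (cases rule: cartan_cls_cases[OF n2 i, of m, case_names same up down far])
    case same
    let ?P = "lin_fps e' 1 (- (q * q * ?c))" and ?R = "lin_fps e' q (- (inverse q * ?c))" and ?L = "lin_fps e' 1 (- ?c)"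
    have L: "?L \<noteq> 0" using c by (simp add: lin_fps_nonzero)
    have E: "W * - (q * q * inverse W) = - (q * q)"
      using c by (simp add: field_simps)
    have X: "lin_fps e' W (- (q powi C)) = fps_const W * ?P"
      unfolding lin_fps_scale E using same by (simp add: C_def power2_eq_square)
    have E': "q * W * - (inverse q * inverse W) = - 1" "q * W * q = q * q * W"
      using c by (simp_all add: field_simps)
    have Y: "lin_fps e' (q powi C * W) (-1) = fps_const (q * W) * ?R"
      unfolding lin_fps_scale E' using same by (simp add: C_def power2_eq_square)
    have A: "expand e' (beig a i m) * ?L = ?R"
      using expand_psi(1)[OF e' c(1)] same by (simp add: beig_simps am)
    have "lin_fps e' q (- (inverse q * (q * q * ?c))) = fps_const q * ?L"
      by (simp add: lin_fps_scale field_simps)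
    then have B: "expand e' (beig a i (m + 1)) * (fps_const q * ?L) = ?P"
      using expand_psi(2)[OF e', of "q * q * ?c"] c same b0 by simp
    have "lin_fps e' W (- (q powi C)) * expand e' (beig a i m) * ?L
        = fps_const W * ?P * (expand e' (beig a i m) * ?L)"
      by (simp only: X mult.assoc)
    also have "\<dots> = fps_const W * (expand e' (beig a i (m + 1)) * (fps_const q * ?L)) * ?R"
      by (simp only: A B)
    also have "\<dots> = fps_const (q * W) * ?R * expand e' (beig a i (m + 1)) * ?L"
      by (simp only: fps_const_mult[symmetric] mult.assoc mult.commute mult.left_commute)
    also have "\<dots> = lin_fps e' (q powi C * W) (-1) * expand e' (beig a i (m + 1)) * ?L"
      by (simp only: Y)
    finally show ?thesis using L by simp
  next
    case up
    have X: "lin_fps e' W (- (q powi C)) = fps_const (inverse q * W) * lin_fps e' q (- (inverse q * (q * ?c)))"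
      unfolding lin_fps_scale u using up by (simp add: C_def power_int_minus)
    have Y: "lin_fps e' (q powi C * W) (-1) = fps_const (inverse q * W) * lin_fps e' 1 (- (q * ?c))"
      unfolding lin_fps_scale u using up by (simp add: C_def power_int_minus)
    have "beig a i (m + 1) = psi q (q * ?c)"
      using up pw by (simp add: beig_simps)
    moreover have "beig a i m = (1, 1)"
      using up ne by (simp add: beig_simps)
    ultimately show ?thesis
      using expand_psi(1)[OF e', of "q * ?c"] c
      unfolding X Y by (simp add: expand_one mult.assoc mult.commute[of "lin_fps _ _ _" "expand _ _"])
  next
    case down
    have X: "lin_fps e' W (- (q powi C)) = fps_const (inverse q * W) * lin_fps e' q (- (inverse q * (q * ?c)))"
      unfolding lin_fps_scale u using down by (simp add: C_def power_int_minus)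
    have Y: "lin_fps e' (q powi C * W) (-1) = fps_const (inverse q * W) * lin_fps e' 1 (- (q * ?c))"
      unfolding lin_fps_scale u using down by (simp add: C_def power_int_minus)
    have "beig a i m = rf_inverse (psi q (q * ?c))"
      using down pw by (simp add: beig_simps)
    moreover have "beig a i (m + 1) = (1, 1)"
      using down ne by (simp add: beig_simps)
    ultimately show ?thesis
      using expand_psi(2)[OF e', of "q * ?c"] c
      unfolding X Y by (simp add: expand_one mult.assoc mult.commute[of "lin_fps _ _ _" "expand _ _"])
  next
    case far
    then show ?thesis by (simp add: beig_simps C_def)
  qed
qed

lemma expand_exchange:
  assumes i: "i \<in> idx n" and a: "a \<noteq> 0" and e': "e' = 1 \<or> e' = -1" and e: "e = 1 \<or> e = -1"
 fixes l defines "W \<equiv> inverse (a * q powi bpos e l)" and "D \<equiv> e * cartan n i (cls n (bpos e l))"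
  shows "lin_fps e' W (- (q powi D)) * expand e' (beig a i (l - e))
       = lin_fps e' (q powi D * W) (-1) * expand e' (beig a i l)"
  using e
proof
  assume "e = 1"
  then show ?thesis
    using expand_exchange_up[OF i a e', of "l - 1"] by (simp add: W_def D_def bpos_def)
next
  assume e1: "e = -1"
  let ?C = "cartan n i (cls n l)"
  \<comment> \<open>The move of a box by the current of sign \<open>-1\<close> is inverse to a move by the one of sign \<open>1\<close>, and
    passing from \<open>C\<close> to \<open>-C\<close> interchanges the two linear polynomials up to a scalar.\<close>
  have X: "lin_fps e' W (- (q powi D)) = fps_const (- (q powi (- ?C))) * lin_fps e' (- (q powi ?C * W)) 1"
    unfolding lin_fps_scale by (simp add: D_def e1 bpos_def power_int_minus mult.assoc[symmetric])
  have Y: "lin_fps e' (q powi D * W) (-1) = fps_const (- (q powi (- ?C))) * lin_fps e' (- W) (q powi ?C)"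
    unfolding lin_fps_scale by (simp add: D_def e1 bpos_def power_int_minus mult.assoc[symmetric])
  have Z: "lin_fps e' (- x) (- y) = - lin_fps e' x y" for x y
    by (simp add: lin_fps_def)
  show ?thesis
    using expand_exchange_up[OF i a e', of l] Z[of "q powi ?C * W" "-1"] Z[of W "- (q powi ?C)"]
    unfolding X Y by (simp add: e1 W_def bpos_def mult.assoc)
qed

text \<open>
  The same relation for values at a point \<open>z\<close>. In the case \<open>W = z\<close> of equal nodes both sides
  are \<open>0\<close> because of division by zero.
\<close>

lemma rf_value_exchange_up:
  assumes i: "i \<in> idx n" and a: "a \<noteq> 0"
  fixes m defines "W \<equiv> inverse (a * q powi m)" and "C \<equiv> cartan n i (cls n m)"
  assumes r: "regular C W z"
  shows "rf_value (beig a i m) z = gam C W z * rf_value (beig a i (m + 1)) z"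
proof -
  let ?c = "a * q powi m"
  have c: "?c \<noteq> 0" "W \<noteq> 0" and Wc: "?c = inverse W"
    using a by (auto simp: W_def)
  have pw: "a * q powi (m + 1) = q * inverse W" "a * q powi (m + 1 + 1) = q * q * inverse W"
    using powi_add[of m 1] powi_add[of 2 m] by (simp_all add: power2_eq_square flip: Wc)
  have ne: "cls n (m + 1) \<noteq> cls n m" "cls n (m - 1) \<noteq> cls n m" "cls n (m + 1) \<noteq> cls n (m - 1)"
    by (rule cls_shift_ne[OF n2, of 1] cls_shift_ne[OF n2, of "-1"] cls_shift_ne[OF n2, of 2]; simp)+
  have b0: "beig a (cls n m) (m + 1) = rf_inverse (psi q (q * q * inverse W))"
    using beig_simps(2)[of a "m + 1"] unfolding pw by simp
  have lin1: "q - inverse W * z = q / W * (W - inverse q * z)"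
    using c(2) by (simp add: field_simps)
  have lin2: "1 - q * inverse W * z = q / W * (inverse q * W - z)"
    using c(2) by (simp add: field_simps)
  show ?thesis
  proof (cases rule: cartan_cls_cases[OF n2 i, of m, case_names same up down far])
    case same
    have "W \<noteq> q * q * z" "q * q * W \<noteq> z"
      using r same by (simp_all add: regular_def C_def power2_eq_square)
    then have "rf_value (psi q (inverse W)) z
        = (q * q * W - z) / (W - q * q * z) * rf_value (rf_inverse (psi q (q * q * inverse W))) z"
    proof (cases "W = z")
      case True
      then show ?thesis using c(2) by (simp add: rf_value_def psi_def rf_inverse_def field_simps)
    next
      case False
      then have d: "W - z \<noteq> 0" "W - q * q * z \<noteq> 0"
        using \<open>W \<noteq> q * q * z\<close> by auto
      have "rf_value (psi q (inverse W)) z = (q - inverse q * inverse W * z) / (1 - inverse W * z)"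
        by (simp add: rf_value_def psi_def mult.commute mult.left_commute)
      moreover have "q - inverse q * inverse W * z = (q * q * W - z) / (q * W)"
        using c(2) by (simp add: field_simps)
      moreover have "1 - inverse W * z = (W - z) / W"
        using c(2) by (simp add: field_simps)
      moreover have "rf_value (rf_inverse (psi q (q * q * inverse W))) z
          = (1 - q * q * inverse W * z) / (q - q * inverse W * z)"
        by (simp add: rf_value_def psi_def rf_inverse_def mult.commute mult.left_commute)
      moreover have "1 - q * q * inverse W * z = (W - q * q * z) / W"
        using c(2) by (simp add: field_simps)
      moreover have "q - q * inverse W * z = q * (W - z) / W"
        using c(2) by (simp add: field_simps)
      ultimately show ?thesis
        using d c(2) by simp
    qed
    then show ?thesis
      using same Wc b0 by (simp add: beig_simps gam_def C_def power2_eq_square)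
  next
    case up
    have d: "W - inverse q * z \<noteq> 0" "inverse q * W - z \<noteq> 0"
      using r up by (simp_all add: regular_def C_def power_int_minus)
    have "rf_value (psi q (q * inverse W)) z = (q - inverse W * z) / (1 - q * inverse W * z)"
      by (simp add: rf_value_def psi_def mult.commute mult.left_commute)
    then have "1 = (inverse q * W - z) / (W - inverse q * z) * rf_value (psi q (q * inverse W)) z"
      using d c(2) by (simp add: lin1 lin2)
    moreover have "beig a i (m + 1) = psi q (q * inverse W)"
      using up pw by (simp add: beig_simps)
    moreover have "beig a i m = (1, 1)"
      using up ne by (simp add: beig_simps)
    ultimately show ?thesis
      using up by (simp add: gam_def C_def power_int_minus rf_value_def)
  next
    case down
    have d: "W - inverse q * z \<noteq> 0" "inverse q * W - z \<noteq> 0"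
      using r down by (simp_all add: regular_def C_def power_int_minus)
    have "rf_value (rf_inverse (psi q (q * inverse W))) z = (1 - q * inverse W * z) / (q - inverse W * z)"
      by (simp add: rf_value_def psi_def rf_inverse_def mult.commute mult.left_commute)
    then have "rf_value (rf_inverse (psi q (q * inverse W))) z = (inverse q * W - z) / (W - inverse q * z)"
      using d c(2) by (simp add: lin1 lin2)
    moreover have "beig a i m = rf_inverse (psi q (q * inverse W))"
      using down pw by (simp add: beig_simps)
    moreover have "beig a i (m + 1) = (1, 1)"
      using down ne by (simp add: beig_simps)
    ultimately show ?thesis
      using down by (simp add: gam_def C_def power_int_minus rf_value_def)
  next
    case far
    then show ?thesis by (simp add: beig_simps C_def gam_def)
  qed
qed

lemma rf_value_exchange:
  assumes i: "i \<in> idx n" and a: "a \<noteq> 0" and e: "e = 1 \<or> e = -1"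
 fixes l defines "W \<equiv> inverse (a * q powi bpos e l)" and "C \<equiv> cartan n i (cls n (bpos e l))"
  assumes r: "regular C W z"
  shows "rf_value (beig a i (l - e)) z = gam (e * C) W z * rf_value (beig a i l) z"
  using e
proof
  assume "e = 1"
  then show ?thesis
    using rf_value_exchange_up[OF i a, of "l - 1" z] r by (simp add: W_def C_def bpos_def)
next
  assume "e = -1"
  then show ?thesis
    using rf_value_exchange_up[OF i a, of l z] r gam_minus[OF r] gam_nonzero[OF r]
    by (simp add: W_def C_def bpos_def field_simps)
qed

end

section \<open>Weights\<close>

lemma pairing_superset:
  assumes "finite S" "keys h \<subseteq> S"
  shows "pairing l h = (\<Sum>b\<in>S. lookup l b * lookup h b)"
  unfolding pairing_def using assms by (intro sum.mono_neutral_left) (auto simp: in_keys_iff)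

lemma pairing_add_right: "pairing l (h + h') = pairing l h + pairing l h'"
  using Poly_Mapping.keys_add[of h h']
  by (simp add: pairing_superset[of "keys h \<union> keys h'"] lookup_add
      sum.distrib algebra_simps)

lemma pairing_0_right [simp]: "pairing l 0 = 0"
  by (simp add: pairing_def)

lemma pairing_minus_right: "pairing l (- h) = - pairing l h"
  using pairing_add_right[of l h "- h"] by simp

lemma pairing_add_left: "pairing (l + l') h = pairing l h + pairing l' h"
  by (simp add: pairing_def lookup_add sum.distrib algebra_simps)

lemma pairing_0_left [simp]: "pairing 0 h = 0"
  by (simp add: pairing_def)

lemma pairing_minus_left: "pairing (- l) h = - pairing l h"
  using pairing_add_left[of l "- l" h] by simp

lemma pairing_single [simp]: "pairing l (single b x) = lookup l b * x"
  by (simp add: pairing_superset[of "{b}"])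

lemma qpow_add: "qpow t (x + y) = qpow t x * qpow t y"
  by (simp add: qpow_def of_rat_add ring_distribs exp_add)

lemma qpow_0 [simp]: "qpow t 0 = 1"
  by (simp add: qpow_def)

lemma qpow_nonzero [simp]: "qpow t x \<noteq> 0"
  by (simp add: qpow_def)

lemma lookup_simple_root:
  "i \<in> idx n \<Longrightarrow> lookup (simple_root n j) (Hb i) = of_int (cartan n i j)"
  by (simp add: simple_root_def lookup_add lookup_sum lookup_single when_def idx_def)

lemma keys_simple_root: "keys (simple_root n j) \<subseteq> hsupp n"
proof
  fix b assume b: "b \<in> keys (simple_root n j)"
  show "b \<in> hsupp n"
  proof (rule ccontr)
    assume "b \<notin> hsupp n"
    then have "lookup (simple_root n j) b = 0"
      by (auto simp: simple_root_def lookup_add lookup_sum lookup_single when_def hsupp_def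
          intro!: sum.neutral)
    with b show False by (simp add: in_keys_iff)
  qed
qed

text \<open>
  The weights of the boxes are given by different formulas for positive and nonpositive indices; this
  recursion holds for all and allows for a uniform induction.
\<close>

lemma box_weight_pred: "box_weight n (l - 1) = box_weight n l + simple_root n (cls n (l - 1))"
proof -
  consider "l \<ge> 2" | "l = 1" | "l \<le> 0" by linarith
  then show ?thesis
  proof cases
    case 1
    then have "{1..l - 1} = insert (l - 1) {1..l - 1 - 1}" by auto
    then show ?thesis using 1 by (simp add: box_weight_def)
  next
    case 2
    then show ?thesis by (simp add: box_weight_def)
  next
    case 3
    then have "{l - 1..0} = insert (l - 1) {l..0}" by auto
    then show ?thesis using 3 by (simp add: box_weight_def add.commute add.left_commute)
  qed
qed

lemma box_weight_induct [case_names one pred succ]: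
  fixes l :: int
  assumes "P 1" "\<And>l. P l \<Longrightarrow> P (l - 1)" "\<And>l. P (l - 1) \<Longrightarrow> P l"
  shows "P l"
proof (induction l rule: int_induct[of _ 1])
  case (step1 i)
  then show ?case using assms(3)[of "i + 1"] by simp
qed (use assms in auto)

lemma cartan_cls:
  assumes "n \<ge> 2" "i \<in> idx n"
  shows "cartan n i (cls n m) = 2 * (if i = cls n m then 1 else 0)
    - (if i = cls n (m + 1) then 1 else 0) - (if i = cls n (m - 1) then 1 else 0)"
proof -
  have "cls n (m + 1) \<noteq> cls n m" "cls n (m - 1) \<noteq> cls n m" "cls n (m + 1) \<noteq> cls n (m - 1)"
    by (rule cls_shift_ne[OF assms(1), of 1] cls_shift_ne[OF assms(1), of "-1"]
        cls_shift_ne[OF assms(1), of 2]; simp)+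
  then show ?thesis
    by (cases rule: cartan_cls_cases[OF assms, of m, case_names same up down far]) auto
qed

lemma lookup_box_weight:
  assumes "n \<ge> 2" "i \<in> idx n"
  shows "lookup (box_weight n l) (Hb i)
    = of_int ((if i = cls n l then 1 else 0) - (if i = cls n (l - 1) then 1 else 0))"
proof (induction l rule: box_weight_induct)
  case one
  have "cls n 1 = 1" "cls n 0 = 0"
    using assms(1) by (simp_all add: cls_def)
  then show ?case
    by (auto simp: box_weight_def varpi1_def fund_weight_def lookup_minus lookup_single when_def)
next
  case (pred l)
  then show ?case
    using cartan_cls[OF assms, of "l - 1"]
    by (simp add: box_weight_pred lookup_add lookup_simple_root[OF assms(2)])
next
  case (succ l)
  then show ?case
    using cartan_cls[OF assms, of "l - 1"]
    by (simp add: box_weight_pred lookup_add lookup_simple_root[OF assms(2)])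
qed

lemma keys_box_weight: "n \<ge> 2 \<Longrightarrow> keys (box_weight n l) \<subseteq> hsupp n"
proof (induction l rule: box_weight_induct)
  case one
  then show ?case
    using keys_diff[of "single (Hb 1) 1" "single (Hb 0) (1 :: rat)"]
    by (auto simp: box_weight_def varpi1_def fund_weight_def hsupp_def idx_def)
next
  case (pred l)
  then show ?case
    using Poly_Mapping.keys_add[of "box_weight n l" "simple_root n (cls n (l - 1))"]
      keys_simple_root[of n "cls n (l - 1)"]
    by (auto simp: box_weight_pred)
next
  case (succ l)
  then show ?case
    using keys_diff[of "box_weight n (l - 1)" "simple_root n (cls n (l - 1))"]
      keys_simple_root[of n "cls n (l - 1)"]
    by (auto simp: box_weight_pred)
qed

lemma cartan_commute: "n \<ge> 2 \<Longrightarrow> i \<in> idx n \<Longrightarrow> j \<in> idx n \<Longrightarrow> cartan n i j = cartan n j i"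
proof -
  have A: "adjacent n j i" if "adjacent n i j" "i \<in> idx n" for i j
    using that by (auto simp: adjacent_def cls_add_cls cls_diff_cls cls_idx)
  show "i \<in> idx n \<Longrightarrow> j \<in> idx n \<Longrightarrow> cartan n i j = cartan n j i"
    using A[of i j] A[of j i] by (auto simp: cartan_def)
qed

section \<open>Tensor products of vector representations\<close>

text \<open>
  The differences \<open>d\<close> in the genericity condition are symmetric under \<open>d \<mapsto> -d\<close>. The condition is
  therefore imposed for all pairs of distinct factors, irrespective of their order.
\<close>

locale tensor_boxes = quantum +
  fixes a :: "complex list" and k :: nat
  assumes len: "length a = k" and kpos: "k \<ge> 1" and a_nz: "\<And>s. s < k \<Longrightarrow> a ! s \<noteq> 0"
    and generic: "\<And>s u d. s < k \<Longrightarrow> u < k \<Longrightarrow> s \<noteq> u \<Longrightarrow>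
      (int n + 1) dvd d \<or> (int n + 1) dvd (d - 2) \<or> (int n + 1) dvd (d + 2) \<Longrightarrow>
      a ! s \<noteq> a ! u * q powi d"
begin

abbreviation "Vs \<equiv> map (vector_rep n q) a"
abbreviation "V \<equiv> drinfeld_tensor t Vs"
abbreviation "boxes \<equiv> {bs :: int list. length bs = k}"

text \<open>
  The current of sign \<open>e\<close> that moves the box \<open>l\<close> in the factor \<open>u\<close> does so with \<open>\<delta>(pt e u l z)\<close>.
\<close>

definition pt :: "int \<Rightarrow> nat \<Rightarrow> int \<Rightarrow> complex" where
  "pt e u l = a ! u * q powi bpos e l"

definition act :: "int \<Rightarrow> int \<Rightarrow> int \<Rightarrow> bool" where
  "act e i l \<longleftrightarrow> i = cls n (bpos e l)"

definition move :: "int \<Rightarrow> nat \<Rightarrow> int list \<Rightarrow> int list" where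
  "move e u bs = bs[u := bs ! u - e]"

text \<open>
  The values of \<open>\<phi>\<^sub>i\<close> on the factors to one side of \<open>u\<close>, which the Drinfeld coproduct puts next to the
  current acting on the factor \<open>u\<close>.
\<close>

definition kap :: "int \<Rightarrow> int \<Rightarrow> nat \<Rightarrow> int list \<Rightarrow> complex" where
  "kap e i u bs = (\<Prod>s\<in>side e k u. rf_value (beig (a ! s) i (bs ! s)) (inverse (pt e u (bs ! u))))"

text \<open>
  The coefficient in the component of \<open>x\<^sub>i\<^sub>,\<^sub>r\<close> that moves the box in the factor \<open>u\<close>.
\<close>

definition xc :: "int \<Rightarrow> int \<Rightarrow> int \<Rightarrow> nat \<Rightarrow> int list \<Rightarrow> complex" where
  "xc e i r u bs = (if act e i (bs ! u) then kap e i u bs * pt e u (bs ! u) powi r else 0)"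

lemma length_move [simp]: "length (move e u bs) = length bs"
  by (simp add: move_def)

lemma nth_move [simp]: "u < length bs \<Longrightarrow> move e u bs ! v = (if v = u then bs ! u - e else bs ! v)"
  by (simp add: move_def nth_list_update)

lemma move_commute: "u < length bs \<Longrightarrow> v < length bs \<Longrightarrow> move e u (move e' v bs) = move e' v (move e u bs)"
  by (rule nth_equalityI) auto

lemma move_inverse [simp]: "u < length bs \<Longrightarrow> move (- e) u (move e u bs) = bs"
  by (rule nth_equalityI) auto

lemma pt_nonzero: "u < k \<Longrightarrow> pt e u l \<noteq> 0"
  by (simp add: pt_def a_nz)

lemma side_subset: "u < k \<Longrightarrow> s \<in> side e k u \<Longrightarrow> s < k \<and> s \<noteq> u"
  by (auto simp: side_def split: if_splits)

lemma finite_side [simp]: "finite (side e k u)"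
  by (simp add: side_def)

lemma tensor_x_eq:
  assumes "e = 1 \<or> e = -1"
  shows "tensor_x Vs e i r bs = (\<Sum>u<k. single (move e u bs) (xc e i r u bs))"
  unfolding tensor_x_def length_map len
proof (rule sum.cong)
  fix u assume "u \<in> {..<k}"
  then have u: "u < k" by simp
  have p: "(\<Prod>s\<in>side e k u. rf_value (eig (Vs ! s) i (bs ! s)) z)
      = (\<Prod>s\<in>side e k u. rf_value (beig (a ! s) i (bs ! s)) z)" for z
    using side_subset[OF u] by (intro prod.cong) (auto simp: len)
  have c: "cur (Vs ! u) e i (bs ! u)
      = (if act e i (bs ! u) then Some (pt e u (bs ! u), bs ! u - e) else None)"
    using u assms by (auto simp: vector_rep_def len act_def pt_def bpos_def)
  show "(case cur (Vs ! u) e i (bs ! u) of None \<Rightarrow> 0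
      | Some (c, b') \<Rightarrow> single (bs[u := b'])
          ((\<Prod>s\<in>side e k u. rf_value (eig (Vs ! s) i (bs ! s)) (inverse c)) * c powi r))
      = single (move e u bs) (xc e i r u bs)"
    by (simp add: c p move_def xc_def kap_def)
qed simp

text \<open>
  A pole at the point supporting a current at node \<open>i\<close> is of the form \<open>a\<^sub>s q^m'\<close> with \<open>m'\<close> in the
  class of \<open>i\<close>, just as the point itself is \<open>a\<^sub>u q^m\<close>. So \<open>a\<^sub>s / a\<^sub>u\<close> is \<open>q\<close> to a multiple of \<open>n + 1\<close>.
\<close>

lemma no_pole:
  assumes "s < k" "u < k" "s \<noteq> u" "i = cls n m"
  shows "\<not> rf_pole (beig (a ! s) i l) (inverse (a ! u * q powi m))"
proof
  assume "rf_pole (beig (a ! s) i l) (inverse (a ! u * q powi m))"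
  then have act: "beig_active i l" and eq: "eig_pole (a ! s) i l * inverse (a ! u * q powi m) = 1"
    by (simp_all add: rf_pole_beig)
  define m' where "m' = (if i = cls n l then l else l - 1)"
  have "i = cls n m'"
    using act by (auto simp: m'_def beig_active_def)
  then have "(int n + 1) dvd (m - m')"
    using assms(4) by (simp add: cls_eq_iff)
  moreover have "a ! s * q powi m' = a ! u * q powi m"
    using eq a_nz[OF assms(2)] by (simp add: eig_pole_def m'_def divide_simps split: if_splits)
  then have "a ! s = a ! u * q powi (m - m')"
    by (simp add: power_int_diff divide_simps)
  ultimately show False
    using generic[OF assms(1-3)] by blast
qed

text \<open>
  A zero differs from the pole of the same factor by \<open>q^2\<close> or \<open>q^-2\<close>, and this is the second
  genericity condition.
\<close>

lemma value_nonzero: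
  assumes "s < k" "u < k" "s \<noteq> u" "i = cls n m"
  shows "rf_value (beig (a ! s) i l) (inverse (a ! u * q powi m)) \<noteq> 0"
proof (rule rf_value_beig_nonzero[OF no_pole[OF assms]])
  have eq: "a ! s = a ! u * q powi (m - m')" if "a ! s * q powi m' * inverse (a ! u * q powi m) = 1" for m'
    using that a_nz[OF assms(2)] by (simp add: power_int_diff divide_simps)
  {
    assume "i = cls n l"
    then have "(int n + 1) dvd (m - (l - 2) - 2)"
      using assms(4) by (simp add: cls_eq_iff)
    then show "a ! s * q powi (l - 2) * inverse (a ! u * q powi m) \<noteq> 1"
      using eq[of "l - 2"] generic[OF assms(1-3), of "m - (l - 2)"] by blast
  next
    assume "i = cls n (l - 1)"
    then have "(int n + 1) dvd (m - (l + 1) + 2)"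
      using assms(4) by (simp add: cls_eq_iff algebra_simps)
    then show "a ! s * q powi (l + 1) * inverse (a ! u * q powi m) \<noteq> 1"
      using eq[of "l + 1"] generic[OF assms(1-3), of "m - (l + 1)"] by blast
  }
qed

lemma kap_nonzero:
  assumes "u < k" "act e i (bs ! u)"
  shows "kap e i u bs \<noteq> 0"
  using assms side_subset[OF assms(1)] value_nonzero
  by (auto simp: kap_def pt_def act_def)

text \<open>
  For adjacent nodes the exponents of \<open>a\<^sub>s q^m'\<close> and \<open>a\<^sub>u q^m\<close> differ by \<open>1\<close> or \<open>-1\<close> modulo \<open>n + 1\<close>, and
  shifting by the Cartan integer \<open>-1\<close> leads back to \<open>0\<close>, \<open>2\<close> or \<open>-2\<close>. For equal nodes the shift is
  by \<open>2\<close> or \<open>-2\<close> to begin with.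
\<close>

lemma regular_points:
  assumes "s < k" "u < k" "s \<noteq> u"
  shows "regular (cartan n (cls n m) (cls n m')) (inverse (a ! s * q powi m')) (inverse (a ! u * q powi m))"
proof -
  define C where "C = cartan n (cls n m) (cls n m')"
  have dvd: "(int n + 1) dvd d \<or> (int n + 1) dvd (d - 2) \<or> (int n + 1) dvd (d + 2)"
    if "C \<noteq> 0" "d = m' - m - C \<or> d = m' - m + C" for d
  proof (cases rule: cartan_cls_cases[OF n2 cls_in_idx, of m m', case_names same up down far])
    case same
    then have "(int n + 1) dvd (m' - m)" by (metis cls_eq_iff)
    moreover have "d + 2 = m' - m \<or> d - 2 = m' - m"
      using that(2) same by (auto simp: C_def)
    ultimately show ?thesis by metis
  next
    case up
    then have "(int n + 1) dvd (m' + 1 - m)" by (metis cls_eq_iff)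
    moreover have "d = m' + 1 - m \<or> d + 2 = m' + 1 - m"
      using that(2) up by (auto simp: C_def)
    ultimately show ?thesis by metis
  next
    case down
    then have "(int n + 1) dvd (m' - 1 - m)" by (metis cls_eq_iff)
    moreover have "d = m' - 1 - m \<or> d - 2 = m' - 1 - m"
      using that(2) down by (auto simp: C_def)
    ultimately show ?thesis by metis
  next
    case far
    then show ?thesis using that by (simp add: C_def)
  qed
  have g: "a ! u \<noteq> a ! s * q powi d" if "C \<noteq> 0" "d = m' - m - C \<or> d = m' - m + C" for d
    using generic[OF assms(2,1)] assms(3) dvd[OF that] by blast
  have s: "a ! s \<noteq> 0" "a ! u \<noteq> 0" using a_nz assms by auto
  show ?thesis
    unfolding regular_def C_def[symmetric]
  proof (intro impI conjI notI)
    assume "C \<noteq> 0" "inverse (a ! s * q powi m') = q powi C * inverse (a ! u * q powi m)"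
    then have "a ! u = a ! s * q powi (m' - m + C)"
      using s by (simp add: power_int_diff power_int_add divide_simps mult.assoc mult.commute[of "q powi C"])
    with g[OF \<open>C \<noteq> 0\<close>] show False by blast
  next
    assume "C \<noteq> 0" "q powi C * inverse (a ! s * q powi m') = inverse (a ! u * q powi m)"
    then have "a ! u = a ! s * q powi (m' - m - C)"
      using s by (simp add: power_int_diff power_int_add divide_simps mult.assoc mult.commute[of "q powi C"])
    with g[OF \<open>C \<noteq> 0\<close>] show False by blast
  qed
qed

lemma prod_scale_one_factor:
  assumes "finite S" "v \<in> S" "\<And>s. s \<in> S \<Longrightarrow> s \<noteq> v \<Longrightarrow> f' s = f s" "f' v = g * (f v :: 'c :: comm_semiring_1)"
  shows "prod f' S = g * prod f S"
proof -
  have "prod f' (S - {v}) = prod f (S - {v})"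
    using assms(3) by (intro prod.cong) auto
  then show ?thesis
    using assms(1,2,4) by (simp add: prod.remove[of S v] mult.assoc)
qed

text \<open>
  A move at \<open>v\<close> is noticed by the current at \<open>u\<close> only if \<open>v\<close> is on the proper side of \<open>u\<close>. Then it
  changes exactly one of the values of \<open>\<phi>\<^sub>i\<close>.
\<close>

lemma kap_move:
  assumes e: "e = 1 \<or> e = -1" and uv: "u < k" "v < k" "u \<noteq> v" "length bs = k"
    and i: "act e' i (bs ! u)" and j: "act e j (bs ! v)"
  shows "kap e' i u (move e v bs) = (if v \<in> side e' k u
    then gam (e * cartan n i j) (inverse (pt e v (bs ! v))) (inverse (pt e' u (bs ! u))) else 1)
    * kap e' i u bs"
proof -
  have "i \<in> idx n" "a ! v \<noteq> 0"
    using i uv a_nz by (auto simp: act_def)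
  moreover have "regular (cartan n i j) (inverse (pt e v (bs ! v))) (inverse (pt e' u (bs ! u)))"
    using regular_points[of v u "bpos e' (bs ! u)" "bpos e (bs ! v)"] uv i j
    by (simp add: pt_def act_def)
  ultimately have ex: "rf_value (beig (a ! v) i (bs ! v - e)) (inverse (pt e' u (bs ! u)))
    = gam (e * cartan n i j) (inverse (pt e v (bs ! v))) (inverse (pt e' u (bs ! u)))
      * rf_value (beig (a ! v) i (bs ! v)) (inverse (pt e' u (bs ! u)))"
    using rf_value_exchange[of i "a ! v" e "bs ! v" "inverse (pt e' u (bs ! u))"] e j
    by (simp add: act_def pt_def)
  show ?thesis
  proof (cases "v \<in> side e' k u")
    case True
    then show ?thesis
      unfolding kap_def using ex uv
      by (simp, intro prod_scale_one_factor[OF _ True]) auto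
  next
    case False
    then show ?thesis
      unfolding kap_def using uv by (auto intro!: prod.cong)
  qed
qed

lemma xc_move:
  assumes e: "e = 1 \<or> e = -1" and uv: "u < k" "v < k" "u \<noteq> v" "length bs = k"
    and j: "act e j (bs ! v)"
  shows "xc e' i r u (move e v bs) = (if v \<in> side e' k u
    then gam (e * cartan n i j) (inverse (pt e v (bs ! v))) (inverse (pt e' u (bs ! u))) else 1)
    * xc e' i r u bs"
  using kap_move[OF e uv _ j, of e' i] uv by (auto simp: xc_def)

lemma gam_swap: "regular C w z \<Longrightarrow> gam C w z * gam C z w = 1"
  by (auto simp: gam_def regular_def divide_simps) (simp_all add: algebra_simps)

lemma regular_pt:
  assumes "u < k" "v < k" "u \<noteq> v" "act e' i l" "act e j l'" "d = 1 \<or> d = -1"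
  shows "regular (d * cartan n i j) (inverse (pt e v l')) (inverse (pt e' u l))"
  using regular_points[of v u "bpos e' l" "bpos e l'"] assms
    regular_minus[of "cartan n i j" "inverse (pt e v l')" "inverse (pt e' u l)"]
  by (auto simp: act_def pt_def)

text \<open>
  For one sign, exactly one of the two factors is on the proper side of the other. If this is \<open>v\<close>, the
  left-hand side acquires \<open>gam\<close>; otherwise the right-hand side acquires \<open>gam\<close> with the points
  interchanged, and this is the inverse by \<open>gam_swap\<close>.
\<close>

lemma xc_exchange:
  assumes e: "e = 1 \<or> e = -1" and uv: "u < k" "v < k" "u \<noteq> v" "length bs = k"
  shows "xc e j b v bs * xc e i r u (move e v bs)
    = gam (e * cartan n i j) (inverse (pt e v (bs ! v))) (inverse (pt e u (bs ! u)))
      * (xc e i r u bs * xc e j b v (move e u bs))"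
proof (cases "act e i (bs ! u) \<and> act e j (bs ! v)")
  case False
  then show ?thesis using uv by (auto simp: xc_def)
next
  case True
  then have i: "act e i (bs ! u)" and j: "act e j (bs ! v)" by auto
  have r: "regular (e * cartan n i j) (inverse (pt e v (bs ! v))) (inverse (pt e u (bs ! u)))"
    using regular_pt[OF uv(1-3) i j, of e] e by auto
  have c: "cartan n j i = cartan n i j"
    using i j cartan_commute[OF n2, of i j] by (simp add: act_def)
  have "v \<in> side e k u \<longleftrightarrow> u \<notin> side e k v"
    using uv by (auto simp: side_def)
  then show ?thesis
    using xc_move[OF e uv j, of e i r] xc_move[OF e uv(2,1) uv(3)[symmetric] uv(4) i, of e j b]
      gam_swap[OF r]
    by (auto simp: c mult.assoc[symmetric])
qed

text \<open>
  For opposite signs, either both factors are on the proper side of each other or neither is. In the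
  first case both sides acquire the same factor: passing to the opposite Cartan integer and
  interchanging the points both invert \<open>gam\<close>.
\<close>

lemma xc_commute_opposite:
  assumes uv: "u < k" "v < k" "u \<noteq> v" "length bs = k"
  shows "xc (-1) j b v bs * xc 1 i r u (move (-1) v bs) = xc 1 i r u bs * xc (-1) j b v (move 1 u bs)"
proof (cases "act 1 i (bs ! u) \<and> act (-1) j (bs ! v)")
  case False
  then show ?thesis using uv by (auto simp: xc_def)
next
  case True
  then have i: "act 1 i (bs ! u)" and j: "act (-1) j (bs ! v)" by auto
  let ?w = "inverse (pt (-1) v (bs ! v))" and ?z = "inverse (pt 1 u (bs ! u))"
  have r: "regular (cartan n i j) ?w ?z"
    using regular_pt[OF uv(1-3) i j, of 1] by auto
  have c: "cartan n j i = cartan n i j"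
    using i j cartan_commute[OF n2, of i j] by (simp add: act_def)
  have "gam (- cartan n i j) ?w ?z = gam (cartan n i j) ?z ?w"
    using gam_minus[OF r] gam_swap[OF r] by (simp add: inverse_unique)
  moreover have "v \<in> side 1 k u \<longleftrightarrow> u \<in> side (-1) k v"
    using uv by (auto simp: side_def)
  ultimately show ?thesis
    using xc_move[OF _ uv j, of 1 i r] xc_move[OF _ uv(2,1) uv(3)[symmetric] uv(4) i, of "-1" j b]
    by (auto simp: c)
qed

lemma xc_step: "u < k \<Longrightarrow> xc e i r u bs = pt e u (bs ! u) * xc e i (r - 1) u bs"
  using power_int_add[of "pt e u (bs ! u)" 1 "r - 1"] pt_nonzero[of u e "bs ! u"]
  by (simp add: xc_def)

lemma pt_move: "e = 1 \<or> e = -1 \<Longrightarrow> pt e u (l - e) = inverse (q powi e) * pt e u l"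
  by (simp add: pt_def bpos_move power_int_diff divide_inverse)

text \<open>
  Two currents of one sign move a box in succession only if their nodes are neighbours. This settles
  all cases in which components at the same factor are composed.
\<close>

lemma consecutive_cartan:
  assumes "e = 1 \<or> e = -1" "act e j l" "act e i (l - e)"
  shows "cartan n i j = -1" "cartan n j i = -1" "i \<noteq> j" "adjacent n i j" "adjacent n j i"
proof -
  have i: "i = cls n (bpos e l - e)" and j: "j = cls n (bpos e l)"
    using assms by (auto simp: act_def bpos_move)
  show "i \<noteq> j"
    unfolding i j using assms(1) by (intro cls_shift_ne[OF n2, of "- e"]) auto
  show a: "adjacent n i j" "adjacent n j i"
    unfolding i j adjacent_def using assms(1) by (auto simp: cls_add_cls cls_diff_cls)
  have ij: "i \<in> idx n" "j \<in> idx n"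
    by (auto simp: i j)
  show "cartan n i j = -1" "cartan n j i = -1"
    using adjacent_cartan[OF n2] ij a by blast+
qed

end

section \<open>The defining relations on tensor products\<close>

context tensor_boxes
begin

abbreviation X :: "int \<Rightarrow> int \<Rightarrow> int \<Rightarrow> (int list \<Rightarrow>\<^sub>0 complex) \<Rightarrow> (int list \<Rightarrow>\<^sub>0 complex)" where
  "X e i r \<equiv> lin_ext (tensor_x Vs e i r)"

definition weight_eig :: "hvec \<Rightarrow> int list \<Rightarrow> complex" where
  "weight_eig h bs = qpow t (pairing (tensor_weight Vs bs) h)"

definition phi_eig :: "int \<Rightarrow> int \<Rightarrow> int \<Rightarrow> int list \<Rightarrow> complex" where
  "phi_eig e i r bs = zcoeff e (tensor_phi Vs e i bs) r"

lemma tensor_weight_eq: "tensor_weight Vs bs = (\<Sum>s<k. box_weight n (bs ! s))"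
  by (simp add: tensor_weight_def len vector_rep_def)

lemma tensor_phi_eq: "tensor_phi Vs e i bs = (\<Prod>s<k. expand e (beig (a ! s) i (bs ! s)))"
  by (simp add: tensor_phi_def len)

lemma lookup_tensor_weight:
  assumes "i \<in> idx n"
  shows "lookup (tensor_weight Vs bs) (Hb i)
    = of_int (\<Sum>s<k. (if i = cls n (bs ! s) then 1 else 0) - (if i = cls n (bs ! s - 1) then 1 else 0))"
  by (simp add: tensor_weight_eq lookup_sum lookup_box_weight[OF n2 assms])

text \<open>
  The box \<open>l\<close> contributes \<open>1\<close> at the class of \<open>l\<close> and \<open>-1\<close> at the class of \<open>l - 1\<close>, both to the value
  of the weight on \<open>h\<^sub>i\<close> and to the exponent of \<open>q^e\<close> in the constant term of \<open>\<phi>\<^sub>i\<close>.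
\<close>

lemma tensor_phi_0:
  assumes e: "e = 1 \<or> e = -1" and i: "i \<in> idx n"
  shows "fps_nth (tensor_phi Vs e i bs) 0
    = qpow t (pairing (tensor_weight Vs bs) (if e = 1 then hvec_h i else - hvec_h i))"
proof -
  let ?d = "\<lambda>s. (if i = cls n (bs ! s) then 1 else 0) - (if i = cls n (bs ! s - 1) then 1 else (0 :: int))"
  have "fps_nth (tensor_phi Vs e i bs) 0 = (\<Prod>s<k. q powi (e * ?d s))"
    by (simp add: tensor_phi_eq fps_prod_nth_zero expand_beig_0[OF e a_nz])
  also have "\<dots> = q powi (\<Sum>s<k. e * ?d s)"
    by (induction k) (simp_all add: powi_add mult.commute)
  also have "\<dots> = qpow t (of_int (e * (\<Sum>s<k. ?d s)))"
    by (simp only: qpow_int sum_distrib_left)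
  also have "of_int (e * (\<Sum>s<k. ?d s))
      = pairing (tensor_weight Vs bs) (if e = 1 then hvec_h i else - hvec_h i)"
    using e lookup_tensor_weight[OF i, of bs]
    by (auto simp: hvec_h_def pairing_minus_right)
  finally show ?thesis .
qed

lemma phi_V:
  assumes e: "e = 1 \<or> e = -1" and i: "i \<in> idx n"
  shows "phi t V e i r = diag_op (phi_eig e i r)"
  unfolding phi_eig_def
  by (rule phi_drinfeld_tensor[OF e _ tensor_phi_0[OF e i]]) (use q_inv in \<open>simp add: q_exp\<close>)

lemma V_simps [simp]:
  "carr V = vecs boxes" "scl V = smul" "xx V e i r = X e i r" "kk V h = diag_op (weight_eig h)"
  "hh V i m = diag_op (tensor_h q Vs i m)"
  by (simp_all add: drinfeld_tensor_def vecs_def len diag_op_def weight_eig_def subset_iff Ball_def flip: q_exp)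

lemma X_in_vecs:
  assumes "e = 1 \<or> e = -1" "v \<in> vecs boxes"
  shows "X e i r v \<in> vecs boxes"
  by (rule lin_ext_in_vecs[OF _ assms(2)])
    (auto simp: tensor_x_eq[OF assms(1)] intro!: sum_in_vecs single_in_vecs)

lemma X_X_basis:
  assumes "e = 1 \<or> e = -1" "e' = 1 \<or> e' = -1"
  shows "X e i r (tensor_x Vs e' j b bs) = (\<Sum>u<k. \<Sum>v<k. single (move e u (move e' v bs))
    (xc e' j b v bs * xc e i r u (move e' v bs)))"
proof -
  have "X e i r (tensor_x Vs e' j b bs) = (\<Sum>v<k. \<Sum>u<k. single (move e u (move e' v bs))
    (xc e' j b v bs * xc e i r u (move e' v bs)))"
    by (simp add: tensor_x_eq[OF assms(2)] lin_ext_sum tensor_x_eq[OF assms(1)] pm.scale_sum_right)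
  then show ?thesis
    by (subst sum.swap) simp
qed

text \<open>
  The coefficient of the composite of three components. The one listed first acts first.
\<close>

definition word3 :: "int \<Rightarrow> int \<times> int \<times> nat \<Rightarrow> int \<times> int \<times> nat \<Rightarrow> int \<times> int \<times> nat \<Rightarrow> int list \<Rightarrow> complex" where
  "word3 e = (\<lambda>(i, r, u) (i', r', u') (i'', r'', u'') bs.
     xc e i r u bs * (xc e i' r' u' (move e u bs) * xc e i'' r'' u'' (move e u' (move e u bs))))"

lemma X_X_X_basis:
  assumes "e = 1 \<or> e = -1"
  shows "X e i'' r'' (X e i' r' (tensor_x Vs e i r bs)) = (\<Sum>u<k. \<Sum>u'<k. \<Sum>u''<k.
    single (move e u'' (move e u' (move e u bs))) (word3 e (i, r, u) (i', r', u') (i'', r'', u'') bs))"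
  by (simp add: tensor_x_eq[OF assms] lin_ext_sum pm.scale_sum_right word3_def mult.assoc)

subsection \<open>Commutation of currents of one sign\<close>

text \<open>
  For \<open>u \<noteq> v\<close>, multiplication by \<open>z\<close> and \<open>w\<close> amounts to multiplication by the inverse points, and the
  claim is \<open>xc_exchange\<close> cleared of denominators. For \<open>u = v\<close>, the two moves follow each other on one box,
  the points differ by the factor \<open>q^(e C)\<close>, and both sides vanish.
\<close>

lemma quadratic_coeff:
  assumes e: "e = 1 \<or> e = -1" and uv: "u < k" "v < k" "length bs = k"
    and ij: "i \<in> idx n" "j \<in> idx n"
  defines "p \<equiv> q powi (e * cartan n i j)"
  shows "xc e j (b - 1) v bs * xc e i r u (move e v bs) - p * (xc e j b v bs * xc e i (r - 1) u (move e v bs))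
    = p * (xc e i r u bs * xc e j (b - 1) v (move e u bs)) - xc e i (r - 1) u bs * xc e j b v (move e u bs)"
proof (cases "u = v")
  case False
  let ?cu = "pt e u (bs ! u)" and ?cv = "pt e v (bs ! v)"
  let ?S = "xc e i (r - 1) u bs * xc e j (b - 1) v (move e u bs)"
  have T: "xc e j (b - 1) v bs * xc e i (r - 1) u (move e v bs)
      = gam (e * cartan n i j) (inverse ?cv) (inverse ?cu) * ?S"
    by (rule xc_exchange[OF e uv(1,2) False uv(3)])
  have st: "xc e j b v bs = ?cv * xc e j (b - 1) v bs" "xc e j b v (move e u bs) = ?cv * xc e j (b - 1) v (move e u bs)"
    "xc e i r u bs = ?cu * xc e i (r - 1) u bs" "xc e i r u (move e v bs) = ?cu * xc e i (r - 1) u (move e v bs)"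
    using False uv xc_step[of v e j b bs] xc_step[of v e j b "move e u bs"]
      xc_step[of u e i r bs] xc_step[of u e i r "move e v bs"] by simp_all
  have key: "(?cu - p * ?cv) * (gam (e * cartan n i j) (inverse ?cv) (inverse ?cu) * ?S)
      = (p * ?cu - ?cv) * ?S"
  proof (cases "?S = 0 \<or> cartan n i j = 0")
    case True
    then show ?thesis by (auto simp: p_def gam_def)
  next
    case S: False
    then have "act e i (bs ! u)" "act e j (bs ! v)"
      using False uv by (auto simp: xc_def split: if_splits)
    then have "regular (e * cartan n i j) (inverse ?cv) (inverse ?cu)"
      using regular_pt[OF uv(1,2) False, of e i "bs ! u" e j "bs ! v" e] e by auto
    moreover have nz: "?cu \<noteq> 0" "?cv \<noteq> 0" "e \<noteq> 0" using uv pt_nonzero e by auto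
    ultimately have d: "inverse ?cv - p * inverse ?cu \<noteq> 0"
      using S by (auto simp: regular_def p_def)
    have "?cu - p * ?cv = ?cu * ?cv * (inverse ?cv - p * inverse ?cu)"
      "p * ?cu - ?cv = ?cu * ?cv * (p * inverse ?cv - inverse ?cu)"
      using nz by (simp_all add: algebra_simps)
    then show ?thesis
      using d S nz by (simp add: gam_def flip: p_def)
  qed
  have "xc e j (b - 1) v bs * xc e i r u (move e v bs) - p * (xc e j b v bs * xc e i (r - 1) u (move e v bs))
    = (?cu - p * ?cv) * (xc e j (b - 1) v bs * xc e i (r - 1) u (move e v bs))"
    unfolding st by (simp add: algebra_simps)
  also have "\<dots> = (p * ?cu - ?cv) * ?S"
    unfolding T by (rule key)
  finally show ?thesis
    unfolding st by (simp add: algebra_simps)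
next
  case True
  have z: "?thesis" if "p = inverse (q powi e)"
  proof -
    have p1: "pt e u (bs ! u - e) = p * pt e u (bs ! u)"
      using pt_move[OF e] that by simp
    have st: "xc e j b u (move e u bs) = p * pt e u (bs ! u) * xc e j (b - 1) u (move e u bs)"
      "xc e i r u (move e u bs) = p * pt e u (bs ! u) * xc e i (r - 1) u (move e u bs)"
      "xc e j b u bs = pt e u (bs ! u) * xc e j (b - 1) u bs"
      "xc e i r u bs = pt e u (bs ! u) * xc e i (r - 1) u bs"
      using uv xc_step[of u e j b bs] xc_step[of u e j b "move e u bs"]
        xc_step[of u e i r bs] xc_step[of u e i r "move e u bs"] by (simp_all add: p1)
    show ?thesis
      unfolding True[symmetric] st by (simp add: algebra_simps)
  qed
  show ?thesis
  proof (cases "(act e j (bs ! u) \<and> act e i (bs ! u - e)) \<or> (act e i (bs ! u) \<and> act e j (bs ! u - e))")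
    case True
    then have "cartan n i j = -1"
      using consecutive_cartan(1,2)[OF e] by blast
    then show ?thesis by (intro z) (simp add: p_def power_int_minus)
  next
    case F: False
    then show ?thesis using uv unfolding True[symmetric] by (auto simp: xc_def)
  qed
qed

lemma quadratic_basis:
  assumes e: "e = 1 \<or> e = -1" and bs: "length bs = k" and ij: "i \<in> idx n" "j \<in> idx n"
  defines "p \<equiv> q powi (e * cartan n i j)"
  shows "X e i r (tensor_x Vs e j (b - 1) bs) - smul p (X e i (r - 1) (tensor_x Vs e j b bs))
    = smul p (X e j (b - 1) (tensor_x Vs e i r bs)) - X e j b (tensor_x Vs e i (r - 1) bs)"
proof -
  have "X e i r (tensor_x Vs e j (b - 1) bs) - smul p (X e i (r - 1) (tensor_x Vs e j b bs))
    = (\<Sum>u<k. \<Sum>v<k. single (move e u (move e v bs))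
      (xc e j (b - 1) v bs * xc e i r u (move e v bs) - p * (xc e j b v bs * xc e i (r - 1) u (move e v bs))))"
    by (simp add: X_X_basis[OF e e] pm.scale_sum_right sum_subtractf single_diff)
  also have "\<dots> = (\<Sum>u<k. \<Sum>v<k. single (move e v (move e u bs))
      (p * (xc e i r u bs * xc e j (b - 1) v (move e u bs)) - xc e i (r - 1) u bs * xc e j b v (move e u bs)))"
    using quadratic_coeff[OF e _ _ bs ij] move_commute[of _ bs _ e e] bs
    by (intro sum.cong refl) (simp add: p_def)
  also have "\<dots> = (\<Sum>v<k. \<Sum>u<k. single (move e v (move e u bs))
      (p * (xc e i r u bs * xc e j (b - 1) v (move e u bs)) - xc e i (r - 1) u bs * xc e j b v (move e u bs)))"
    by (rule sum.swap)
  also have "\<dots> = smul p (X e j (b - 1) (tensor_x Vs e i r bs)) - X e j b (tensor_x Vs e i (r - 1) bs)"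
    by (simp add: X_X_basis[OF e e] pm.scale_sum_right sum_subtractf single_diff)
  finally show ?thesis .
qed

lemma far_basis:
  assumes e: "e = 1 \<or> e = -1" and bs: "length bs = k" and ij: "i \<in> idx n" "j \<in> idx n"
    and far: "i \<noteq> j" "\<not> adjacent n i j"
  shows "X e i r (tensor_x Vs e j b bs) = X e j b (tensor_x Vs e i r bs)"
proof -
  have C: "cartan n i j = 0"
    using far by (simp add: cartan_def)
  have "xc e j b v bs * xc e i r u (move e v bs) = xc e i r u bs * xc e j b v (move e u bs)"
    if "u < k" "v < k" for u v
  proof (cases "u = v")
    case False
    then show ?thesis
      using xc_exchange[OF e that False bs, of j b i r] by (simp add: C gam_def)
  next
    case True
    then show ?thesis
      using consecutive_cartan(4,5)[OF e, of j "bs ! u" i] consecutive_cartan(4,5)[OF e, of i "bs ! u" j]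
        far that bs by (auto simp: xc_def)
  qed
  then have "(\<Sum>u<k. \<Sum>v<k. single (move e u (move e v bs)) (xc e j b v bs * xc e i r u (move e v bs)))
    = (\<Sum>u<k. \<Sum>v<k. single (move e v (move e u bs)) (xc e i r u bs * xc e j b v (move e u bs)))"
    using move_commute[of _ bs _ e e] bs by (intro sum.cong refl) simp
  also have "\<dots> = (\<Sum>v<k. \<Sum>u<k. single (move e v (move e u bs)) (xc e i r u bs * xc e j b v (move e u bs)))"
    by (rule sum.swap)
  finally show ?thesis
    by (simp only: X_X_basis[OF e e])
qed

subsection \<open>Serre relations\<close>

lemma gam_adjacent:
  assumes "e = 1 \<or> e = -1"
  shows "gam (e * - 1) w z = (w - q powi e * z) / (q powi e * w - z)"
proof -
  let ?p = "q powi e"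
  have "inverse ?p * w - z = (w - ?p * z) / ?p" "w - inverse ?p * z = (?p * w - z) / ?p"
    by (simp_all add: field_simps)
  then show ?thesis
    using assms by (auto simp: gam_def power_int_minus)
qed

lemma gam_same:
  assumes "e = 1 \<or> e = -1"
  shows "gam (e * 2) w z = (q powi e * q powi e * w - z) / (w - q powi e * q powi e * z)"
proof -
  have "q powi (e * 2) = q powi e * q powi e"
    using powi_add[of e e] by (simp add: mult.commute[of e])
  then show ?thesis
    using assms by (auto simp: gam_def)
qed

lemma regular_adjacent:
  assumes "e = 1 \<or> e = -1" "regular (e * - 1) w z"
  shows "q powi e * w - z \<noteq> 0" "w - q powi e * z \<noteq> 0"
proof -
  let ?p = "q powi e"
  have "w - inverse ?p * z \<noteq> 0" "inverse ?p * w - z \<noteq> 0"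
    using assms by (auto simp: regular_def power_int_minus)
  moreover have "?p * w - z = ?p * (w - inverse ?p * z)" "w - ?p * z = ?p * (inverse ?p * w - z)"
    by (simp_all add: right_diff_distrib flip: mult.assoc)
  ultimately show "?p * w - z \<noteq> 0" "w - ?p * z \<noteq> 0"
    by auto
qed

lemma regular_same:
  assumes "e = 1 \<or> e = -1" "regular (e * 2) w z"
  shows "w - q powi e * q powi e * z \<noteq> 0"
proof -
  have "q powi (e * 2) = q powi e * q powi e"
    using powi_add[of e e] by (simp add: mult.commute[of e])
  then show ?thesis
    using assms by (auto simp: regular_def)
qed

text \<open>
  The relation between the coefficients of the six orders in which boxes at three different factors can
  be moved, with \<open>u\<close>, \<open>v\<close> and \<open>w\<close> the points of the two moves at \<open>i\<close> and of the move at \<open>j\<close>. The two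
  brackets have the numerators \<open>p^2 u - v\<close> and \<open>p^2 v - u\<close> up to a common factor, and \<open>G\<close> turns the second
  into the negative of the first.
\<close>

lemma serre_identity:
  fixes p :: complex
  assumes "p \<noteq> 0" "p * w - u \<noteq> 0" "p * w - v \<noteq> 0" "u - p * p * v \<noteq> 0"
  defines "A \<equiv> (w - p * u) / (p * w - u)" and "B \<equiv> (w - p * v) / (p * w - v)"
    and "G \<equiv> (p * p * u - v) / (u - p * p * v)"
  shows "A * B - (p + inverse p) * A + 1 + G * (A * B - (p + inverse p) * B + 1) = 0"
proof -
  let ?D = "(p * w - u) * (p * w - v)"
  have D: "?D \<noteq> 0" using assms by simp
  have A: "A * (p * w - u) = w - p * u" and B: "B * (p * w - v) = w - p * v"
    using assms by (simp_all add: A_def B_def)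
  have "?D * (A * B - (p + inverse p) * A + 1)
      = (A * (p * w - u)) * (B * (p * w - v)) - (p + inverse p) * (A * (p * w - u)) * (p * w - v) + ?D"
    by (simp only: algebra_simps mult_1_left mult_1_right)
  also have "\<dots> = (w - p * u) * (w - p * v) - (p + inverse p) * (w - p * u) * (p * w - v) + ?D"
    by (simp only: A B)
  also have "\<dots> = w * (p - inverse p) * (p * p * u - v)"
    using assms(1) by (simp add: field_simps) 
  finally have 1: "?D * (A * B - (p + inverse p) * A + 1) = w * (p - inverse p) * (p * p * u - v)" .
  have "?D * (A * B - (p + inverse p) * B + 1)
      = (A * (p * w - u)) * (B * (p * w - v)) - (p + inverse p) * (B * (p * w - v)) * (p * w - u) + ?D"
    by (simp only: algebra_simps mult_1_left mult_1_right)
  also have "\<dots> = (w - p * u) * (w - p * v) - (p + inverse p) * (w - p * v) * (p * w - u) + ?D"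
    by (simp only: A B)
  also have "\<dots> = w * (p - inverse p) * (p * p * v - u)"
    using assms(1) by (simp add: field_simps)
  finally have 2: "?D * (A * B - (p + inverse p) * B + 1) = w * (p - inverse p) * (p * p * v - u)" .
  have 3: "G * (p * p * v - u) = - (p * p * u - v)"
    using assms(4) by (simp add: G_def field_simps)
  have "?D * (A * B - (p + inverse p) * A + 1 + G * (A * B - (p + inverse p) * B + 1))
    = ?D * (A * B - (p + inverse p) * A + 1) + G * (?D * (A * B - (p + inverse p) * B + 1))"
    by (simp only: ring_distribs mult.left_commute)
  also have "\<dots> = w * (p - inverse p) * (p * p * u - v) + w * (p - inverse p) * (G * (p * p * v - u))"
    unfolding 1 2 by (simp only: mult.left_commute mult.assoc)
  also have "\<dots> = 0"
    unfolding 3 by (simp add: algebra_simps)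
  finally show ?thesis using D by simp
qed

text \<open>
  What is left of \<open>serre_identity\<close> when the moves at \<open>j\<close> and then at \<open>i\<close> hit the same box: the other
  orders do not contribute.
\<close>

lemma serre_identity_then:
  fixes p :: complex
  assumes "p \<noteq> 0" "p * u - v \<noteq> 0" "u - p * v \<noteq> 0"
  shows "(1 + (p * p * (p * u) - v) / (p * u - p * p * v)) * ((u - p * v) / (p * u - v)) = p + inverse p"
proof -
  have "p * u - p * p * v = p * (u - p * v)"
    "p * (u - p * v) + (p * p * (p * u) - v) = (p * p + 1) * (p * u - v)"
    by (simp_all add: algebra_simps)
  moreover have "1 + x / y = (y + x) / y" if "y \<noteq> 0" for x y :: complex
    using that by (simp add: add_divide_distrib)
  ultimately have "1 + (p * p * (p * u) - v) / (p * u - p * p * v) = (p * p + 1) * (p * u - v) / (p * (u - p * v))"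
    using assms by simp
  moreover have "(p * p + 1) / p = p + inverse p"
    using assms(1) by (simp add: field_simps)
  ultimately show ?thesis
    using assms(2,3) by simp
qed

text \<open>
  The same for the moves at \<open>i\<close> and then at \<open>j\<close> on one box.
\<close>

lemma serre_identity_else:
  fixes p :: complex
  assumes "p \<noteq> 0" "v - u \<noteq> 0" "v - p * p * u \<noteq> 0"
  shows "(1 + (p * p * v - u) / (v - p * p * u)) * ((v - p * (p * u)) / (p * v - p * u)) = p + inverse p"
proof -
  have e1: "p * v - p * u = p * (v - u)" and e2: "v - p * (p * u) = v - p * p * u"
    and e3: "v - p * p * u + (p * p * v - u) = (p * p + 1) * (v - u)"
    by (simp_all add: algebra_simps)
  have "1 + x / y = (y + x) / y" if "y \<noteq> 0" for x y :: complex
    using that by (simp add: add_divide_distrib)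
  then have "1 + (p * p * v - u) / (v - p * p * u) = (p * p + 1) * (v - u) / (v - p * p * u)"
    using assms(3) e3 by simp
  moreover have "(p * p + 1) / p = p + inverse p"
    using assms(1) by (simp add: field_simps)
  ultimately show ?thesis
    unfolding e1 e2 using assms(2,3) by simp
qed

lemma q_sum: "e = 1 \<or> e = -1 \<Longrightarrow> q + inverse q = q powi e + inverse (q powi e)"
  by (auto simp: power_int_minus)

lemma act_twice:
  assumes "e = 1 \<or> e = -1" "act e i l" "act e i (l - e)"
  shows False
  using consecutive_cartan(3)[OF assms] by simp

lemma act_twice':
  assumes "e = 1 \<or> e = -1" "act e i l" "act e i (l - e - e)"
  shows False
proof -
  have "cls n (bpos e l - 2 * e) \<noteq> cls n (bpos e l)"
    using assms(1) by (intro cls_shift_ne[OF n2, of "-2 * e"]) auto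
  then show False
    using assms by (auto simp: act_def bpos_def)
qed

lemma word3_swap_first:
  assumes "e = 1 \<or> e = -1" "u < k" "v < k" "u \<noteq> v" "w < k" "length bs = k"
  shows "word3 e (j, b, v) (i, r, u) (i', c, w) bs
    = gam (e * cartan n i j) (inverse (pt e v (bs ! v))) (inverse (pt e u (bs ! u)))
      * word3 e (i, r, u) (j, b, v) (i', c, w) bs"
  using xc_exchange[OF assms(1-4,6), of j b i r] move_commute[of u bs v e e] assms
  by (simp add: word3_def flip: mult.assoc)

lemma word3_swap_last:
  assumes "e = 1 \<or> e = -1" "u < k" "v < k" "u \<noteq> v" "w < k" "length bs = k"
  shows "word3 e (i', c, w) (j, b, v) (i, r, u) bs
    = gam (e * cartan n i j) (inverse (pt e v (move e w bs ! v))) (inverse (pt e u (move e w bs ! u)))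
      * word3 e (i', c, w) (i, r, u) (j, b, v) bs"
proof -
  have "length (move e w bs) = k" using assms by simp
  from xc_exchange[OF assms(1-4) this, of j b i r] show ?thesis
    by (simp add: word3_def)
qed

text \<open>
  Every order is reached from the order \<open>v\<close>, \<open>u\<close>, \<open>w\<close> by transpositions of neighbours, each of
  which costs a factor \<open>gam\<close>.
\<close>

lemma serre_distinct:
  assumes e: "e = 1 \<or> e = -1" and bs: "length bs = k"
    and uvw: "u < k" "v < k" "w < k" "u \<noteq> v" "u \<noteq> w" "v \<noteq> w"
    and C: "cartan n i i = 2" "cartan n i j = -1"
  shows "word3 e (j, c, w) (i, b, v) (i, r, u) bs + word3 e (j, c, w) (i, r, u) (i, b, v) bs
    - (q + inverse q) * (word3 e (i, b, v) (j, c, w) (i, r, u) bs + word3 e (i, r, u) (j, c, w) (i, b, v) bs)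
    + word3 e (i, b, v) (i, r, u) (j, c, w) bs + word3 e (i, r, u) (i, b, v) (j, c, w) bs = 0"
proof -
  let ?p = "q powi e"
  let ?u = "inverse (pt e u (bs ! u))" and ?v = "inverse (pt e v (bs ! v))" and ?w = "inverse (pt e w (bs ! w))"
  let ?T = "word3 e (i, b, v) (i, r, u) (j, c, w) bs"
  let ?A = "(?w - ?p * ?u) / (?p * ?w - ?u)" and ?B = "(?w - ?p * ?v) / (?p * ?w - ?v)"
    and ?G = "(?p * ?p * ?u - ?v) / (?u - ?p * ?p * ?v)"
  have n: "move e v bs ! w = bs ! w" "move e v bs ! u = bs ! u" "move e u bs ! w = bs ! w" "move e u bs ! v = bs ! v"
    using uvw bs by simp_all
  have 1: "word3 e (i, r, u) (i, b, v) (j, c, w) bs = ?G * ?T"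
    using word3_swap_first[OF e uvw(2,1) uvw(4)[symmetric] uvw(3) bs, of i r i b j c]
    by (simp only: C gam_same[OF e])
  have 2: "word3 e (i, b, v) (j, c, w) (i, r, u) bs = ?A * ?T"
    using word3_swap_last[OF e uvw(1,3,5,2) bs, of i b j c i r] n
    by (simp only: C gam_adjacent[OF e])
  have 3: "word3 e (j, c, w) (i, b, v) (i, r, u) bs = ?B * (?A * ?T)"
    using word3_swap_first[OF e uvw(2,3,6,1) bs, of j c i b i r]
    by (simp only: C gam_adjacent[OF e] 2)
  have 4: "word3 e (i, r, u) (j, c, w) (i, b, v) bs = ?B * (?G * ?T)"
    using word3_swap_last[OF e uvw(2,3,6,1) bs, of i r j c i b] n
    by (simp only: C gam_adjacent[OF e] 1)
  have 5: "word3 e (j, c, w) (i, r, u) (i, b, v) bs = ?A * (?B * (?G * ?T))"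
    using word3_swap_first[OF e uvw(1,3,5,2) bs, of j c i r i b]
    by (simp only: C gam_adjacent[OF e] 4)
  show ?thesis
  proof (cases "?T = 0")
    case True
    then show ?thesis unfolding 3 5 2 4 1 by simp
  next
    case False
    then have acts: "act e i (bs ! u)" "act e i (bs ! v)" "act e j (bs ! w)"
      using uvw bs by (auto simp: word3_def xc_def split: if_splits)
    have "regular (e * 2) ?u ?v" "regular (e * - 1) ?w ?u" "regular (e * - 1) ?w ?v"
      unfolding C[symmetric] using regular_pt[OF uvw(2,1) _ acts(2,1), of e] regular_pt[OF uvw(1,3,5) acts(1,3), of e]
        regular_pt[OF uvw(2,3,6) acts(2,3), of e] uvw e by auto
    then have "?u - ?p * ?p * ?v \<noteq> 0" "?p * ?w - ?u \<noteq> 0" "?p * ?w - ?v \<noteq> 0"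
      using regular_same[OF e, of ?u ?v] regular_adjacent(1)[OF e, of ?w ?u]
        regular_adjacent(1)[OF e, of ?w ?v] by blast+
    then have "?A * ?B - (?p + inverse ?p) * ?A + 1 + ?G * (?A * ?B - (?p + inverse ?p) * ?B + 1) = 0"
      by (intro serre_identity) auto
    then have "(?A * ?B - (?p + inverse ?p) * ?A + 1 + ?G * (?A * ?B - (?p + inverse ?p) * ?B + 1)) * ?T = 0"
      by simp
    then show ?thesis
      unfolding 3 5 2 4 1 q_sum[OF e]
        by (simp only: algebra_simps mult_1_left mult_1_right add_0_left add_0_right)
  qed
qed

text \<open>
  The three orders with the move at \<open>j\<close> before that at \<open>i\<close> on the common box, and the three opposite
  ones, cancel separately. At most one of the two groups is nonzero.
\<close>

lemma serre_coincident:
  assumes e: "e = 1 \<or> e = -1" and bs: "length bs = k"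
    and uv: "u < k" "v < k" "u \<noteq> v"
    and C: "cartan n i i = 2" "cartan n i j = -1" "cartan n j i = -1"
  shows "word3 e (j, c, u) (i, b, v) (i, r, u) bs + word3 e (j, c, u) (i, r, u) (i, b, v) bs
    - (q + inverse q) * (word3 e (i, b, v) (j, c, u) (i, r, u) bs + word3 e (i, r, u) (j, c, u) (i, b, v) bs)
    + word3 e (i, b, v) (i, r, u) (j, c, u) bs + word3 e (i, r, u) (i, b, v) (j, c, u) bs = 0"
proof -
  let ?p = "q powi e"
  let ?u = "inverse (pt e u (bs ! u))" and ?v = "inverse (pt e v (bs ! v))"
  have pu: "inverse (pt e u (bs ! u - e)) = ?p * ?u"
    by (simp add: pt_move[OF e])
  have p0: "?p \<noteq> 0" by simp
  have nu: "move e u bs ! u = bs ! u - e" and nv: "move e u bs ! v = bs ! v"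
    using uv bs by simp_all
  have "word3 e (j, c, u) (i, b, v) (i, r, u) bs + word3 e (j, c, u) (i, r, u) (i, b, v) bs
    - (q + inverse q) * word3 e (i, b, v) (j, c, u) (i, r, u) bs = 0"
  proof -
    let ?T = "word3 e (i, b, v) (j, c, u) (i, r, u) bs"
    let ?B = "(?u - ?p * ?v) / (?p * ?u - ?v)" and ?G = "(?p * ?p * (?p * ?u) - ?v) / (?p * ?u - ?p * ?p * ?v)"
    have 1: "word3 e (j, c, u) (i, b, v) (i, r, u) bs = ?B * ?T"
      using word3_swap_first[OF e uv(2,1) uv(3)[symmetric] uv(1) bs, of j c i b i r]
      by (simp only: C gam_adjacent[OF e])
    have 2: "word3 e (j, c, u) (i, r, u) (i, b, v) bs = ?G * (?B * ?T)"
      using word3_swap_last[OF e uv(2,1) uv(3)[symmetric] uv(1) bs, of j c i r i b] pu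
      by (simp only: C gam_same[OF e] nu nv 1)
    show ?thesis
    proof (cases "?T = 0")
      case True
      then show ?thesis unfolding 1 2 by simp
    next
      case False
      then have acts: "act e j (bs ! u)" "act e i (bs ! v)" "act e i (bs ! u - e)"
        using uv bs by (auto simp: word3_def xc_def split: if_splits)
      have "regular (e * - 1) ?u ?v"
        unfolding C(2)[symmetric] using regular_pt[OF uv(2,1) _ acts(2,1), of e] uv e by auto
      then have d: "?p * ?u - ?v \<noteq> 0" "?u - ?p * ?v \<noteq> 0"
        using regular_adjacent[OF e, of ?u ?v] by blast+
      from serre_identity_then[OF p0 d] have "(1 + ?G) * ?B = ?p + inverse ?p" .
      then have "(1 + ?G) * ?B * ?T = (?p + inverse ?p) * ?T" by simp
      then show ?thesis
        unfolding 1 2 q_sum[OF e]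
        by (simp only: algebra_simps mult_1_left mult_1_right add_0_left add_0_right)
    qed
  qed
  moreover have "word3 e (i, b, v) (i, r, u) (j, c, u) bs + word3 e (i, r, u) (i, b, v) (j, c, u) bs
    - (q + inverse q) * word3 e (i, r, u) (j, c, u) (i, b, v) bs = 0"
  proof -
    let ?T = "word3 e (i, r, u) (j, c, u) (i, b, v) bs"
    let ?A = "(?v - ?p * (?p * ?u)) / (?p * ?v - ?p * ?u)" and ?G = "(?p * ?p * ?v - ?u) / (?v - ?p * ?p * ?u)"
    have 1: "word3 e (i, r, u) (i, b, v) (j, c, u) bs = ?A * ?T"
      using word3_swap_last[OF e uv(1,2,3,1) bs, of i r i b j c] pu
      by (simp only: C gam_adjacent[OF e] nu nv)
    have 2: "word3 e (i, b, v) (i, r, u) (j, c, u) bs = ?G * (?A * ?T)"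
      using word3_swap_first[OF e uv(1,2,3,1) bs, of i b i r j c]
      by (simp only: C gam_same[OF e] 1)
    show ?thesis
    proof (cases "?T = 0")
      case True
      then show ?thesis unfolding 1 2 by simp
    next
      case False
      then have acts: "act e i (bs ! u)" "act e i (bs ! v)" "act e j (bs ! u - e)"
        using uv bs by (auto simp: word3_def xc_def split: if_splits)
      have "regular (e * cartan n j i) ?v (?p * ?u)" "regular (e * cartan n i i) ?v ?u"
        using regular_pt[OF uv acts(3,2), of e] regular_pt[OF uv acts(1,2), of e] uv e
        by (auto simp: pu)
      then have "?p * ?v - ?p * ?u \<noteq> 0" and d2: "?v - ?p * ?p * ?u \<noteq> 0"
        unfolding C using regular_adjacent(1)[OF e, of ?v "?p * ?u"] regular_same[OF e, of ?v ?u] by blast+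
      then have d: "?v - ?u \<noteq> 0" "?v - ?p * ?p * ?u \<noteq> 0"
        by auto
      from serre_identity_else[OF p0 d] have "(1 + ?G) * ?A = ?p + inverse ?p" .
      then have "(1 + ?G) * ?A * ?T = (?p + inverse ?p) * ?T" by simp
      then show ?thesis
        unfolding 1 2 q_sum[OF e]
        by (simp only: algebra_simps mult_1_left mult_1_right add_0_left add_0_right)
    qed
  qed
  ultimately show ?thesis
    by (simp add: algebra_simps)
qed

text \<open>
  Two moves at \<open>i\<close> of the same box are impossible, even with a move at \<open>j\<close> in between, since \<open>n \<ge> 2\<close>.
\<close>

lemma serre_coeff:
  assumes e: "e = 1 \<or> e = -1" and bs: "length bs = k"
    and uvw: "u < k" "v < k" "w < k"
    and ij: "i \<in> idx n" "j \<in> idx n" "adjacent n i j"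
  shows "word3 e (j, c, w) (i, b, v) (i, r, u) bs + word3 e (j, c, w) (i, r, u) (i, b, v) bs
    - (q + inverse q) * (word3 e (i, b, v) (j, c, w) (i, r, u) bs + word3 e (i, r, u) (j, c, w) (i, b, v) bs)
    + word3 e (i, b, v) (i, r, u) (j, c, w) bs + word3 e (i, r, u) (i, b, v) (j, c, w) bs = 0"
proof -
  have C: "cartan n i i = 2" "cartan n i j = -1" "cartan n j i = -1"
    using adjacent_cartan[OF n2 ij] cartan_commute[OF n2 ij(1,2)] by (simp_all add: cartan_def)
  consider "u = v" | "u \<noteq> v" "w = u" | "u \<noteq> v" "w = v" | "u \<noteq> v" "w \<noteq> u" "w \<noteq> v" by blast
  then show ?thesis
  proof cases
    case 1
    then show ?thesis
      using uvw bs act_twice[OF e, of i "bs ! u"] act_twice[OF e, of i "bs ! u - e"]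
        act_twice'[OF e, of i "bs ! u"]
      by (cases "w = u") (auto simp: word3_def xc_def)
  next
    case 2
    then show ?thesis
      using serre_coincident[OF e bs uvw(1,2) 2(1) C] by simp
  next
    case 3
    then show ?thesis
      using serre_coincident[OF e bs uvw(2,1) _ C, of c r b] by (simp add: algebra_simps)
  next
    case 4
    then show ?thesis
      using serre_distinct[OF e bs uvw _ _ _ C(1,2)] by simp
  qed
qed

lemma serre_basis:
  assumes e: "e = 1 \<or> e = -1" and bs: "length bs = k"
    and ij: "i \<in> idx n" "j \<in> idx n" "adjacent n i j"
  fixes c defines "f \<equiv> \<lambda>r b. X e i r (X e i b (tensor_x Vs e j c bs))
    - smul (q + inverse q) (X e i r (X e j c (tensor_x Vs e i b bs)))
    + X e j c (X e i r (tensor_x Vs e i b bs))"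
  shows "f r b + f b r = 0"
proof -
  define F where "F = (\<lambda>u v w. move e u (move e v (move e w bs)))"
  let ?S = "\<lambda>g. (\<Sum>u<k. \<Sum>v<k. \<Sum>w<k. single (F u v w) (g u v w))"
  have F: "F u v w = F u w v" "F u v w = F v u w" if "u < k" "v < k" "w < k" for u v w
    using that bs move_commute[of _ bs _ e e] move_commute[of u "move e w bs" v e e] by (simp_all add: F_def)
  have perm1: "(\<Sum>u<k. \<Sum>v<k. \<Sum>w<k. single (F w v u) (g u v w)) = ?S (\<lambda>u v w. g w v u)" for g :: "nat \<Rightarrow> nat \<Rightarrow> nat \<Rightarrow> complex"
  proof -
    have "(\<Sum>u<k. \<Sum>v<k. \<Sum>w<k. single (F w v u) (g u v w))
      = (\<Sum>u<k. \<Sum>w<k. \<Sum>v<k. single (F w v u) (g u v w))"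
      by (intro sum.cong refl sum.swap)
    also have "\<dots> = (\<Sum>w<k. \<Sum>u<k. \<Sum>v<k. single (F w v u) (g u v w))"
      by (rule sum.swap)
    also have "\<dots> = (\<Sum>w<k. \<Sum>v<k. \<Sum>u<k. single (F w v u) (g u v w))"
      by (intro sum.cong refl sum.swap)
    finally show ?thesis .
  qed
  \<comment> \<open>All six orders in which the three factors are moved lead to the same basis vector.\<close>
  have X3: "X e i1 r1 (X e i2 r2 (tensor_x Vs e i3 r3 bs))
      = ?S (\<lambda>u v w. word3 e (i3, r3, w) (i2, r2, v) (i1, r1, u) bs)" for i1 r1 i2 r2 i3 r3
    unfolding X_X_X_basis[OF e] F_def[symmetric]
    using perm1[of "\<lambda>u v w. word3 e (i3, r3, u) (i2, r2, v) (i1, r1, w) bs"] by (simp add: F_def)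
  have s12: "?S (\<lambda>u v w. g v u w) = ?S g" for g
  proof -
    have "?S (\<lambda>u v w. g v u w) = (\<Sum>v<k. \<Sum>u<k. \<Sum>w<k. single (F u v w) (g v u w))"
      by (rule sum.swap)
    also have "\<dots> = ?S g"
      using F(2) by (intro sum.cong refl) simp
    finally show ?thesis .
  qed
  have s23: "?S (\<lambda>u v w. g u w v) = ?S g" for g
  proof -
    have "?S (\<lambda>u v w. g u w v) = (\<Sum>u<k. \<Sum>w<k. \<Sum>v<k. single (F u v w) (g u w v))"
      by (intro sum.cong refl sum.swap)
    also have "\<dots> = ?S g"
      using F(1) by (intro sum.cong refl) simp
    finally show ?thesis .
  qed
  let ?W = "word3 e"
  have T1: "X e i r (X e i b (tensor_x Vs e j c bs)) = ?S (\<lambda>u v w. ?W (j, c, w) (i, b, v) (i, r, u) bs)"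
    by (rule X3)
  have T2: "X e i r (X e j c (tensor_x Vs e i b bs)) = ?S (\<lambda>u v w. ?W (i, b, v) (j, c, w) (i, r, u) bs)"
    unfolding X3 by (rule s23[of "\<lambda>u v w. ?W (i, b, v) (j, c, w) (i, r, u) bs"])
  have T3: "X e j c (X e i r (tensor_x Vs e i b bs)) = ?S (\<lambda>u v w. ?W (i, b, v) (i, r, u) (j, c, w) bs)"
    unfolding X3 using s12[of "\<lambda>v u w. ?W (i, b, w) (i, r, u) (j, c, v) bs"]
      s23[of "\<lambda>u v w. ?W (i, b, v) (i, r, u) (j, c, w) bs"] by simp
  have U1: "X e i b (X e i r (tensor_x Vs e j c bs)) = ?S (\<lambda>u v w. ?W (j, c, w) (i, r, u) (i, b, v) bs)"
    unfolding X3 by (rule s12[of "\<lambda>u v w. ?W (j, c, w) (i, r, u) (i, b, v) bs"])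
  have U2: "X e i b (X e j c (tensor_x Vs e i r bs)) = ?S (\<lambda>u v w. ?W (i, r, u) (j, c, w) (i, b, v) bs)"
    unfolding X3 using s23[of "\<lambda>v u w. ?W (i, r, u) (j, c, w) (i, b, v) bs"]
      s12[of "\<lambda>u v w. ?W (i, r, u) (j, c, w) (i, b, v) bs"] by simp
  have U3: "X e j c (X e i b (tensor_x Vs e i r bs)) = ?S (\<lambda>u v w. ?W (i, r, u) (i, b, v) (j, c, w) bs)"
    unfolding X3 using s12[of "\<lambda>w v u. ?W (i, r, u) (i, b, v) (j, c, w) bs"]
      s23[of "\<lambda>v w u. ?W (i, r, u) (i, b, v) (j, c, w) bs"]
      s12[of "\<lambda>u v w. ?W (i, r, u) (i, b, v) (j, c, w) bs"] by simp
  have "f r b + f b r = ?S (\<lambda>u v w. ?W (j, c, w) (i, b, v) (i, r, u) bs + ?W (j, c, w) (i, r, u) (i, b, v) bs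
    - (q + inverse q) * (?W (i, b, v) (j, c, w) (i, r, u) bs + ?W (i, r, u) (j, c, w) (i, b, v) bs)
    + ?W (i, b, v) (i, r, u) (j, c, w) bs + ?W (i, r, u) (i, b, v) (j, c, w) bs)"
    unfolding f_def T1 T2 T3 U1 U2 U3
    by (simp only: single_add single_diff sum.distrib sum_subtractf distrib_left smul_single[symmetric]
        pm.scale_sum_right[symmetric]) (simp add: algebra_simps)
  also have "\<dots> = 0"
    using serre_coeff[OF e bs _ _ _ ij] by (intro sum.neutral ballI) simp
  finally show ?thesis .
qed

subsection \<open>Cartan currents\<close>

lemma phi_exchange_coeff:
  assumes e: "e = 1 \<or> e = -1" and e': "e' = 1 \<or> e' = -1" and i: "i \<in> idx n"
    and u: "u < k" and bs: "length bs = k" and j: "act e j (bs ! u)"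
  defines "p \<equiv> q powi (e * cartan n i j)" and "W \<equiv> inverse (pt e u (bs ! u))"
  shows "W * phi_eig e' i r (move e u bs) - p * phi_eig e' i (r - 1) (move e u bs)
    = p * W * phi_eig e' i r bs - phi_eig e' i (r - 1) bs"
proof -
  define R where "R = (\<Prod>s\<in>{..<k} - {u}. expand e' (beig (a ! s) i (bs ! s)))"
  have P: "tensor_phi Vs e' i bs = expand e' (beig (a ! u) i (bs ! u)) * R"
    using u by (simp add: tensor_phi_eq R_def prod.remove[of _ u])
  have "(\<Prod>s\<in>{..<k} - {u}. expand e' (beig (a ! s) i (move e u bs ! s))) = R"
    unfolding R_def using u bs by (intro prod.cong) auto
  then have P': "tensor_phi Vs e' i (move e u bs) = expand e' (beig (a ! u) i (bs ! u - e)) * R"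
    using u bs by (simp add: tensor_phi_eq prod.remove[of _ u])
  have "lin_fps e' W (- p) * expand e' (beig (a ! u) i (bs ! u - e))
      = lin_fps e' (p * W) (-1) * expand e' (beig (a ! u) i (bs ! u))"
    using expand_exchange[OF i a_nz[OF u] e' e, of "bs ! u"] j
    by (simp add: p_def W_def pt_def act_def)
  then have "lin_fps e' W (- p) * tensor_phi Vs e' i (move e u bs) = lin_fps e' (p * W) (-1) * tensor_phi Vs e' i bs"
    unfolding P P' by (simp flip: mult.assoc)
  from zcoeff_lin_fps_mult_cong[OF e' this, of r] show ?thesis
    by (simp add: phi_eig_def)
qed

lemma phi_exchange:
  assumes e: "e = 1 \<or> e = -1" and e': "e' = 1 \<or> e' = -1" and i: "i \<in> idx n"
    and v: "v \<in> vecs boxes"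
  fixes j defines "p \<equiv> q powi (e * cartan n i j)" and "P \<equiv> \<lambda>r. diag_op (phi_eig e' i r)"
  shows "P r (X e j (b - 1) v) - smul p (P (r - 1) (X e j b v))
    = smul p (X e j (b - 1) (P r v)) - X e j b (P (r - 1) v)"
  unfolding P_def diag_op_def lin_ext_collect
proof (rule lin_ext_cong[OF _ v])
  fix bs assume "bs \<in> boxes"
  then have bs: "length bs = k" by simp
  have "phi_eig e' i r (move e u bs) * xc e j (b - 1) u bs - p * (phi_eig e' i (r - 1) (move e u bs) * xc e j b u bs)
    = p * (phi_eig e' i r bs * xc e j (b - 1) u bs) - phi_eig e' i (r - 1) bs * xc e j b u bs" if u: "u < k" for u
  proof (cases "act e j (bs ! u)")
    case True
    let ?c = "pt e u (bs ! u)"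
    have c: "?c \<noteq> 0" using pt_nonzero u by simp
    let ?x = "xc e j (b - 1) u bs"
    have "phi_eig e' i r (move e u bs) * ?x - p * (phi_eig e' i (r - 1) (move e u bs) * (?c * ?x))
      = ?c * ?x * (inverse ?c * phi_eig e' i r (move e u bs) - p * phi_eig e' i (r - 1) (move e u bs))"
      using c by (simp add: algebra_simps)
    also have "\<dots> = ?c * ?x * (p * inverse ?c * phi_eig e' i r bs - phi_eig e' i (r - 1) bs)"
      using phi_exchange_coeff[OF e e' i u bs True] by (simp add: p_def)
    also have "\<dots> = p * (phi_eig e' i r bs * ?x) - phi_eig e' i (r - 1) bs * (?c * ?x)"
      using c by (simp add: algebra_simps)
    finally show ?thesis
      by (simp only: xc_step[OF u, of e j b bs])
  qed (simp add: xc_def)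
  then show "lin_ext (\<lambda>b. single b (phi_eig e' i r b)) (tensor_x Vs e j (b - 1) bs)
      - lin_ext (\<lambda>b. smul p (single b (phi_eig e' i (r - 1) b))) (tensor_x Vs e j b bs)
    = lin_ext (\<lambda>bs. smul p (tensor_x Vs e j (b - 1) bs)) (single bs (phi_eig e' i r bs))
      - X e j b (single bs (phi_eig e' i (r - 1) bs))"
    by (simp add: tensor_x_eq[OF e] lin_ext_sum pm.scale_sum_right mult_ac
        flip: sum_subtractf single_diff)
qed

lemma tensor_weight_move:
  assumes e: "e = 1 \<or> e = -1" and u: "u < k" and bs: "length bs = k" and j: "act e j (bs ! u)"
  shows "tensor_weight Vs (move e u bs)
    = (if e = 1 then tensor_weight Vs bs + simple_root n j else tensor_weight Vs bs - simple_root n j)"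
proof -
  define R where "R = (\<Sum>s\<in>{..<k} - {u}. box_weight n (bs ! s))"
  have "(\<Sum>s\<in>{..<k} - {u}. box_weight n (move e u bs ! s)) = R"
    unfolding R_def using u bs by (intro sum.cong) auto
  then have "tensor_weight Vs (move e u bs) = box_weight n (bs ! u - e) + R"
    "tensor_weight Vs bs = box_weight n (bs ! u) + R"
    using u bs by (simp_all add: tensor_weight_eq sum.remove[of _ u] R_def)
  then show ?thesis
    using e j box_weight_pred[of n "bs ! u"] box_weight_pred[of n "bs ! u + 1"]
    by (auto simp: act_def bpos_def algebra_simps)
qed

lemma weight_eig_move:
  assumes e: "e = 1 \<or> e = -1" and u: "u < k" and bs: "length bs = k" and j: "act e j (bs ! u)"
  shows "weight_eig h (move e u bs) = qpow t (of_int e * pairing (simple_root n j) h) * weight_eig h bs"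
proof -
  have "pairing (tensor_weight Vs (move e u bs)) h
      = of_int e * pairing (simple_root n j) h + pairing (tensor_weight Vs bs) h"
    using e pairing_add_left[of "tensor_weight Vs bs" "- simple_root n j" h]
    by (auto simp: tensor_weight_move[OF assms] pairing_add_left pairing_minus_left)
  then show ?thesis
    by (simp add: weight_eig_def qpow_add)
qed

lemma weight_X:
  assumes e: "e = 1 \<or> e = -1" and v: "v \<in> vecs boxes"
  shows "diag_op (weight_eig h) (X e j r (diag_op (weight_eig (- h)) v))
    = smul (qpow t (of_int e * pairing (simple_root n j) h)) (X e j r v)"
  unfolding diag_op_def lin_ext_collect
proof (rule lin_ext_cong[OF _ v])
  fix bs assume "bs \<in> boxes"
  then have bs: "length bs = k" by simp
  have "weight_eig (- h) bs * weight_eig h bs = 1"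
    by (simp add: weight_eig_def pairing_minus_right flip: qpow_add)
  then have "weight_eig (- h) bs * (xc e j r u bs * weight_eig h (move e u bs))
      = qpow t (of_int e * pairing (simple_root n j) h) * xc e j r u bs" if u: "u < k" for u
    using weight_eig_move[OF e u bs, of j h]
    by (cases "act e j (bs ! u)") (simp_all add: xc_def mult_ac)
  then have "(\<Sum>u<k. single (move e u bs) (weight_eig (- h) bs * (xc e j r u bs * weight_eig h (move e u bs))))
    = (\<Sum>u<k. single (move e u bs) (qpow t (of_int e * pairing (simple_root n j) h) * xc e j r u bs))"
    by (intro sum.cong refl) (simp only: lessThan_iff)
  then show "lin_ext (\<lambda>bs. lin_ext (\<lambda>b. single b (weight_eig h b)) (tensor_x Vs e j r bs))
      (single bs (weight_eig (- h) bs))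
    = smul (qpow t (of_int e * pairing (simple_root n j) h)) (tensor_x Vs e j r bs)"
    by (simp only: tensor_x_eq[OF e] lin_ext_sum pm.scale_sum_right lin_ext_single smul_single)
qed

subsection \<open>The commutator of the two kinds of currents\<close>

text \<open>
  The factor that the other tensor factors contribute to the residue of the eigenvalue of \<open>\<phi>\<^sub>i\<close> at the pole
  coming from the factor \<open>u\<close>.
\<close>

definition pole_res :: "int \<Rightarrow> int list \<Rightarrow> nat \<Rightarrow> complex" where
  "pole_res i bs u = (\<Prod>s\<in>{..<k} - {u}. rf_value (beig (a ! s) i (bs ! s)) (inverse (eig_pole (a ! u) i (bs ! u))))"

lemma beig_active_cls:
  "beig_active i l \<Longrightarrow> i = cls n (if i = cls n l then l else l - 1)"
  by (auto simp: beig_active_def)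

text \<open>
  The two expansions of the partial fraction decomposition have the same constant term and otherwise
  differ by delta functions at the poles.
\<close>

lemma phi_eig_diff:
  "phi_eig 1 i r bs - phi_eig (-1) i r bs
    = (\<Sum>u<k. eig_residue i (bs ! u) * pole_res i bs u * eig_pole (a ! u) i (bs ! u) powi r)"
proof -
  let ?A = "\<lambda>s. eig_const i (bs ! s)" and ?B = "\<lambda>s. eig_residue i (bs ! s)" and ?c = "\<lambda>s. eig_pole (a ! s) i (bs ! s)"
  define Q where "Q u = ?B u * (\<Prod>s\<in>{..<k} - {u}. ?A s + ?B s / (1 - ?c s / ?c u))" for u
  have active: "beig_active i l" if "eig_residue i l \<noteq> 0" for l
    using that by (auto simp: eig_residue_def beig_active_def split: if_splits)
  have np: "\<not> rf_pole (beig (a ! s) i (bs ! s)) (inverse (?c u))"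
    if "s < k" "u < k" "s \<noteq> u" "?B u \<noteq> 0" for s u
    using no_pole[OF that(1-3) beig_active_cls[OF active[OF that(4)]]] by (simp add: eig_pole_def)
  have pf: "tensor_phi Vs e i bs = fps_const (\<Prod>s<k. ?A s) + (\<Sum>u<k. fps_const (Q u) * geom e (?c u))"
    if e: "e = 1 \<or> e = -1" for e
  proof -
    have "tensor_phi Vs e i bs = (\<Prod>s<k. fps_const (?A s) + fps_const (?B s) * geom e (?c s))"
      by (simp add: tensor_phi_eq expand_beig[OF e a_nz])
    also have "\<dots> = fps_const (\<Prod>s<k. ?A s) + (\<Sum>u<k. fps_const (Q u) * geom e (?c u))"
      unfolding Q_def
    proof (rule partial_fractions)
      fix s u assume su: "s \<in> {..<k}" "u \<in> {..<k}" "s \<noteq> u" "?B s \<noteq> 0" "?B u \<noteq> 0"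
      have "?c s * inverse (?c u) \<noteq> 1"
        using np[of s u] su active by (auto simp: rf_pole_beig)
      then have "?c s \<noteq> ?c u"
        using a_nz su eig_pole_nonzero by force
      then show "?c s \<noteq> ?c u \<and> geom e (?c s) * geom e (?c u)
          = fps_const (?c s / (?c s - ?c u)) * geom e (?c s) + fps_const (?c u / (?c u - ?c s)) * geom e (?c u)"
        using geom_product a_nz su eig_pole_nonzero by auto
    qed (auto simp: a_nz eig_pole_nonzero)
    finally show ?thesis .
  qed
  have Q: "Q u = ?B u * pole_res i bs u" if "u < k" for u
  proof (cases "?B u = 0")
    case False
    have "rf_value (beig (a ! s) i (bs ! s)) (inverse (?c u)) = ?A s + ?B s / (1 - ?c s / ?c u)"
      if "s \<in> {..<k} - {u}" for s
      using rf_value_beig[OF np[of s u]] that \<open>u < k\<close> False by (simp add: divide_inverse)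
    then show ?thesis
      unfolding Q_def pole_res_def by simp
  qed (simp add: Q_def)
  have zc: "zcoeff e (fps_const x) r = (if r = 0 then x else 0)" if "e = 1 \<or> e = -1" for e x
    using that by (auto simp: zcoeff_def)
  have "phi_eig 1 i r bs - phi_eig (-1) i r bs
    = (\<Sum>u<k. Q u * zcoeff 1 (geom 1 (?c u)) r) - (\<Sum>u<k. Q u * zcoeff (-1) (geom (-1) (?c u)) r)"
    by (simp add: phi_eig_def pf zcoeff_sum zc)
  also have "\<dots> = (\<Sum>u<k. Q u * ?c u powi r)"
    using zcoeff_geom_diff[OF eig_pole_nonzero[OF a_nz]]
    by (simp flip: sum_subtractf right_diff_distrib)
  finally show ?thesis
    by (simp add: Q)
qed

text \<open>
  The two currents act on the same box at the same point, one with the factors to the left and the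
  other with the factors to the right. Together these are all the other factors. The first summand is
  present if the box is in the class \<open>i\<close>, the second if its predecessor is, and this is the sign of
  the residue.
\<close>

lemma commutator_coeff:
  assumes u: "u < k" and bs: "length bs = k"
  shows "xc (-1) j b u bs * xc 1 i r u (move (-1) u bs) - xc 1 i r u bs * xc (-1) j b u (move 1 u bs)
    = (if i = j then 1 else 0) / (q - inverse q)
      * (eig_residue i (bs ! u) * pole_res i bs u * eig_pole (a ! u) i (bs ! u) powi (r + b))"
proof -
  let ?l = "bs ! u"
  note ne = cls_pred_ne[of ?l]
  have sides: "side (-1) k u \<union> side 1 k u = {..<k} - {u}" "side (-1) k u \<inter> side 1 k u = {}"
    using u by (auto simp: side_def)
  have pts: "pt 1 u (?l + 1) = pt (-1) u ?l" "pt (-1) u (?l - 1) = pt 1 u ?l"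
    by (simp_all add: pt_def bpos_def)
  have kap2: "kap e i u bs * kap (- e) i u (move e u bs)
      = (\<Prod>s\<in>{..<k} - {u}. rf_value (beig (a ! s) i (bs ! s)) (inverse (pt e u ?l)))"
    if e: "e = 1 \<or> e = -1" for e
  proof -
    have "kap (- e) i u (move e u bs)
        = (\<Prod>s\<in>side (- e) k u. rf_value (beig (a ! s) i (bs ! s)) (inverse (pt e u ?l)))"
      unfolding kap_def using side_subset[OF u] u bs e pts by (intro prod.cong) auto
    moreover have "{..<k} - {u} = side e k u \<union> side (- e) k u" "side e k u \<inter> side (- e) k u = {}"
      using e sides by auto
    ultimately show ?thesis
      by (simp add: kap_def prod.union_disjoint)
  qed
  have p: "pt e u ?l powi b * pt e u ?l powi r = pt e u ?l powi (r + b)" for e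
    using pt_nonzero[OF u, of e ?l] by (simp add: power_int_add mult.commute)
  have 1: "xc (-1) j b u bs * xc 1 i r u (move (-1) u bs) = (if i = j \<and> i = cls n ?l
      then (\<Prod>s\<in>{..<k} - {u}. rf_value (beig (a ! s) i (bs ! s)) (inverse (pt (-1) u ?l))) * pt (-1) u ?l powi (r + b) else 0)"
  proof (cases "i = j \<and> i = cls n ?l")
    case True
    then have "xc (-1) j b u bs = kap (-1) i u bs * pt (-1) u ?l powi b"
      "xc 1 i r u (move (-1) u bs) = kap 1 i u (move (-1) u bs) * pt (-1) u ?l powi r"
      using u bs by (auto simp: xc_def act_def pts bpos_def)
    then have "xc (-1) j b u bs * xc 1 i r u (move (-1) u bs)
        = (kap (-1) i u bs * kap (- (-1)) i u (move (-1) u bs)) * (pt (-1) u ?l powi b * pt (-1) u ?l powi r)"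
      by (simp only: mult_ac minus_minus)
    then show ?thesis
      using True kap2[of "-1"] p[of "-1"] by simp
  qed (use u bs in \<open>auto simp: xc_def act_def bpos_def\<close>)
  have 2: "xc 1 i r u bs * xc (-1) j b u (move 1 u bs) = (if i = j \<and> i = cls n (?l - 1)
      then (\<Prod>s\<in>{..<k} - {u}. rf_value (beig (a ! s) i (bs ! s)) (inverse (pt 1 u ?l))) * pt 1 u ?l powi (r + b) else 0)"
  proof (cases "i = j \<and> i = cls n (?l - 1)")
    case True
    then have "xc 1 i r u bs = kap 1 i u bs * pt 1 u ?l powi r"
      "xc (-1) j b u (move 1 u bs) = kap (-1) i u (move 1 u bs) * pt 1 u ?l powi b"
      using u bs by (auto simp: xc_def act_def pts bpos_def)
    then have "xc 1 i r u bs * xc (-1) j b u (move 1 u bs)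
        = (kap 1 i u bs * kap (- 1) i u (move 1 u bs)) * (pt 1 u ?l powi b * pt 1 u ?l powi r)"
      by (simp only: mult_ac)
    then show ?thesis
      using True kap2[of 1] p[of 1] by simp
  qed (use u bs in \<open>auto simp: xc_def act_def bpos_def\<close>)
  show ?thesis
    unfolding 1 2 using ne q_inv
    by (auto simp: eig_residue_def pole_res_def eig_pole_def pt_def bpos_def divide_simps) (simp add: algebra_simps)
qed

lemma single_sum: "(\<Sum>x\<in>S. single b (f x)) = single b (\<Sum>x\<in>S. f x)"
  by (induction S rule: infinite_finite_induct) (simp_all add: single_add)

lemma commutator:
  assumes v: "v \<in> vecs boxes"
  shows "X 1 i r (X (-1) j b v) - X (-1) j b (X 1 i r v)
    = smul ((if i = j then 1 else 0) / (q - inverse q))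
        (diag_op (phi_eig 1 i (r + b)) v - diag_op (phi_eig (-1) i (r + b)) v)"
  unfolding diag_op_def lin_ext_collect
proof (rule lin_ext_cong[OF _ v])
  fix bs assume "bs \<in> boxes"
  then have bs: "length bs = k" by simp
  let ?c = "\<lambda>u v. xc (-1) j b v bs * xc 1 i r u (move (-1) v bs) - xc 1 i r u bs * xc (-1) j b v (move 1 u bs)"
  have "X 1 i r (tensor_x Vs (-1) j b bs) - X (-1) j b (tensor_x Vs 1 i r bs)
    = (\<Sum>u<k. \<Sum>v<k. single (move 1 u (move (-1) v bs)) (?c u v))"
  proof -
    have "X (-1) j b (tensor_x Vs 1 i r bs) = (\<Sum>u<k. \<Sum>v<k. single (move (-1) v (move 1 u bs))
        (xc 1 i r u bs * xc (-1) j b v (move 1 u bs)))"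
      unfolding X_X_basis[of "-1" 1, simplified] by (rule sum.swap)
    also have "\<dots> = (\<Sum>u<k. \<Sum>v<k. single (move 1 u (move (-1) v bs))
        (xc 1 i r u bs * xc (-1) j b v (move 1 u bs)))"
      using bs move_commute[of _ bs _ 1 "-1"] by (intro sum.cong refl) simp
    finally show ?thesis
      by (simp add: X_X_basis sum_subtractf single_diff)
  qed
  also have "\<dots> = (\<Sum>u<k. \<Sum>v<k. if u = v then single bs (?c u u) else 0)"
  proof (intro sum.cong refl)
    fix u v assume "u \<in> {..<k}" "v \<in> {..<k}"
    then have uv: "u < k" "v < k" by auto
    show "single (move 1 u (move (-1) v bs)) (?c u v)
        = (if u = v then single bs (?c u u) else 0)"
    proof (cases "u = v")
      case True
      then show ?thesis using move_inverse[of u bs "-1"] uv bs by simp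
    next
      case False
      then show ?thesis using xc_commute_opposite[OF uv False bs, of j b i r] by simp
    qed
  qed
  also have "\<dots> = (\<Sum>u<k. single bs (?c u u))"
    by simp
  also have "\<dots> = single bs (\<Sum>u<k. ?c u u)"
    by (rule single_sum)
  also have "(\<Sum>u<k. ?c u u) = (if i = j then 1 else 0) / (q - inverse q)
      * (phi_eig 1 i (r + b) bs - phi_eig (-1) i (r + b) bs)"
    unfolding phi_eig_diff sum_distrib_left
    by (intro sum.cong refl commutator_coeff bs) simp
  finally show "X 1 i r (tensor_x Vs (-1) j b bs) - X (-1) j b (tensor_x Vs 1 i r bs)
    = smul ((if i = j then 1 else 0) / (q - inverse q))
        (single bs (phi_eig 1 i (r + b) bs) - single bs (phi_eig (-1) i (r + b) bs))"
    by (simp add: pm.scale_right_diff_distrib right_diff_distrib single_diff)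
qed

subsection \<open>The tensor product is a module\<close>

lemma diag_op_diag_op_commute: "diag_op d (diag_op d' v) = diag_op d' (diag_op d v)"
  by (rule poly_mapping_eqI) simp

lemma drinfeld_defined_V: "drinfeld_defined n Vs"
  unfolding drinfeld_defined_def
proof (intro allI impI ballI, elim conjE)
  fix bs i e u c b' s
  assume h: "length bs = length Vs" "i \<in> idx n" "e \<in> {1, - 1}" "u < length Vs"
    "cur (Vs ! u) e i (bs ! u) = Some (c, b')" "s \<in> side e (length Vs) u"
  then have u: "u < k" "s < k" "s \<noteq> u"
    using side_subset[of u s e] by (auto simp: len)
  have "i = cls n (bpos e (bs ! u)) \<and> c = a ! u * q powi bpos e (bs ! u)"
    using h(3,5) u by (auto simp: vector_rep_def len bpos_def split: if_splits)
  then show "\<not> rf_pole (eig (Vs ! s) i (bs ! s)) (inverse c)"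
    using no_pole[OF u(2,1,3)] u by (simp add: len)
qed

lemma diag_op_sm: "diag_op d (u + v) = diag_op d u + diag_op d v" "diag_op d (smul c v) = smul c (diag_op d v)"
  by (simp_all add: diag_op_def lin_ext_add lin_ext_smul)

lemma tor_relations_V: "tor_relations n t V"
proof -
  have sgn: "e = 1 \<or> e = -1" if "e \<in> {1, -1}" for e :: int using that by auto
  have K0: "diag_op (weight_eig 0) v = v" for v
    by (rule poly_mapping_eqI) (simp add: weight_eig_def)
  have KK: "diag_op (weight_eig h) (diag_op (weight_eig h') v) = diag_op (weight_eig (h + h')) v" for h h' v
    by (rule poly_mapping_eqI) (simp add: weight_eig_def pairing_add_right qpow_add)
  have quadratic: "X e i r (X e j (b - 1) v) - smul (q powi (e * cartan n i j)) (X e i (r - 1) (X e j b v))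
      = smul (q powi (e * cartan n i j)) (X e j (b - 1) (X e i r v)) - X e j b (X e i (r - 1) v)"
    if "i \<in> idx n" "j \<in> idx n" "e \<in> {1, -1}"
      and v: "v \<in> vecs boxes" for i j e r b v
    unfolding lin_ext_collect
    by (rule lin_ext_cong[OF _ v])
      (use quadratic_basis[OF sgn[OF that(3)] _ that(1,2)] in \<open>simp flip: lin_ext_fun_smul\<close>)
  have far: "X e i r (X e j b v) = X e j b (X e i r v)"
    if "i \<in> idx n" "j \<in> idx n" "i \<noteq> j \<and> \<not> adjacent n i j" "e \<in> {1, -1}"
      and v: "v \<in> vecs boxes" for i j e r b v
    unfolding lin_ext_collect
    by (rule lin_ext_cong[OF _ v]) (use far_basis[OF sgn[OF that(4)] _ that(1,2)] that(3) in simp)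
  have serre: "X e i r (X e i b (X e j c v)) - smul (q + inverse q) (X e i r (X e j c (X e i b v)))
        + X e j c (X e i r (X e i b v))
      + (X e i b (X e i r (X e j c v)) - smul (q + inverse q) (X e i b (X e j c (X e i r v)))
        + X e j c (X e i b (X e i r v))) = 0"
    if "i \<in> idx n" "j \<in> idx n" "adjacent n i j" "e \<in> {1, -1}"
      and v: "v \<in> vecs boxes" for i j e r b c v
    unfolding lin_ext_collect
    by (subst lin_ext_fun_zero[of v], rule lin_ext_cong[OF _ v])
      (use serre_basis[OF sgn[OF that(4)] _ that(1-3)] in
        \<open>simp flip: lin_ext_fun_smul lin_ext_lin_ext\<close>)
  show ?thesis
    unfolding tor_relations_def Let_def V_simps q_exp[symmetric]
    by (intro conjI ballI allI impI K0 KK quadratic serre far)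
      (simp_all only: phi_V[OF sgn] phi_V[of 1] phi_V[of "-1"] simp_thms weight_X[OF sgn] diag_op_diag_op_commute
        phi_exchange[OF sgn sgn] commutator)
qed

lemma all_generators_linear:
  assumes "f \<in> all_generators n V"
  shows "linear_on_carr V f"
proof -
  have lin: "linear_on_carr V (X e i r)" if "e = 1 \<or> e = -1" for e i r
    by (simp add: linear_on_carr_def X_in_vecs[OF that] lin_ext_add lin_ext_smul)
  have "linear_on_carr V (diag_op d)" for d
    by (simp add: linear_on_carr_def diag_op_in_vecs diag_op_sm)
  with lin assms show ?thesis
    by (auto simp: all_generators_def generators_def)
qed

lemma tor_module_V: "tor_module n t V"
  by (simp add: tor_module_def vector_space_smul subspace_vecs tor_relations_V all_generators_linear)

end

section \<open>Thinness and irreducibility\<close>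

context tensor_boxes
begin

subsection \<open>Separation of basis vectors by the Cartan currents\<close>

lemma beig_expand_poly:
  "expand 1 (beig a' i l) * fps_of_poly (snd (beig a' i l)) = fps_of_poly (fst (beig a' i l))"
proof -
  have "coeff (snd (beig a' i l)) 0 \<noteq> 0"
    by (simp add: vector_rep_def psi_def rf_inverse_def)
  then show ?thesis
    by (simp add: expand_def case_prod_unfold fps_divide_unit mult.assoc inverse_mult_eq_1)
qed

text \<open>
  If \<open>l\<close> is the box of one vector in the factor \<open>u\<close> and the other vector has a smaller box there, then
  at the class of \<open>l\<close> only the first vector has a pole at the inverse of \<open>a\<^sub>u q^l\<close>. The genericity
  conditions keep zeros and poles of the other factors away from this point.
\<close>

lemma tensor_phi_separates:
  assumes bs: "length bs = k" "length bs' = k"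
    and eq: "\<And>i. i \<in> idx n \<Longrightarrow> tensor_phi Vs 1 i bs = tensor_phi Vs 1 i bs'"
  shows "bs = bs'"
proof (rule ccontr)
  have le: "bs ! u \<le> bs' ! u"
    if u: "u < k" and eq: "\<And>i. i \<in> idx n \<Longrightarrow> tensor_phi Vs 1 i bs = tensor_phi Vs 1 i bs'" for u bs bs'
  proof (rule ccontr)
    assume "\<not> bs ! u \<le> bs' ! u"
    then have lt: "bs' ! u < bs ! u" by simp
    define i where "i = cls n (bs ! u)"
    define z where "z = inverse (a ! u * q powi (bs ! u))"
    let ?f = "\<lambda>s l. beig (a ! s) i l"
    have P: "tensor_phi Vs 1 i cs * fps_of_poly (\<Prod>s<k. snd (?f s (cs ! s)))
        = fps_of_poly (\<Prod>s<k. fst (?f s (cs ! s)))" for cs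
      by (simp add: tensor_phi_eq fps_of_poly_prod beig_expand_poly flip: prod.distrib)
    have E: "tensor_phi Vs 1 i bs = tensor_phi Vs 1 i bs'"
      by (rule eq) (simp add: i_def)
    \<comment> \<open>Equality of the series becomes equality of polynomials after multiplication by the denominators,
      and it fails at \<open>z\<close>, where exactly one side vanishes.\<close>
    have "fps_of_poly ((\<Prod>s<k. fst (?f s (bs ! s))) * (\<Prod>s<k. snd (?f s (bs' ! s))))
      = fps_of_poly ((\<Prod>s<k. fst (?f s (bs' ! s))) * (\<Prod>s<k. snd (?f s (bs ! s))))"
      by (simp only: fps_of_poly_mult P[symmetric] E mult_ac)
    then have "(\<Prod>s<k. fst (?f s (bs ! s))) * (\<Prod>s<k. snd (?f s (bs' ! s)))
      = (\<Prod>s<k. fst (?f s (bs' ! s))) * (\<Prod>s<k. snd (?f s (bs ! s)))"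
      by (simp only: fps_of_poly_eq_iff)
    from arg_cong[OF this, of "\<lambda>p. poly p z"] have ev: "(\<Prod>s<k. poly (fst (?f s (bs ! s))) z) * (\<Prod>s<k. poly (snd (?f s (bs' ! s))) z)
      = (\<Prod>s<k. poly (fst (?f s (bs' ! s))) z) * (\<Prod>s<k. poly (snd (?f s (bs ! s))) z)"
      by (simp only: poly_mult poly_prod)
    have az: "a ! u * q powi (bs ! u) * z = 1"
      using a_nz[OF u] right_inverse[of "a ! u * q powi (bs ! u)"] by (simp only: z_def) simp
    have "poly (snd (?f u (bs ! u))) z = 0"
      using az by (simp add: beig_simps i_def psi_def mult_ac)
    then have z0: "(\<Prod>s<k. poly (snd (?f s (bs ! s))) z) = 0"
      using u by (intro prod_zero) auto
    have n1: "poly (fst (?f s (bs ! s))) z \<noteq> 0" if "s < k" for s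
    proof (cases "s = u")
      case True
      have "poly (fst (psi q (a ! u * q powi (bs ! u)))) z = q - inverse q * (a ! u * q powi (bs ! u) * z)"
        by (simp add: psi_def mult_ac)
      then show ?thesis
        using q_inv True by (simp add: beig_simps i_def az)
    next
      case False
      then show ?thesis
        using value_nonzero[OF that u False i_def, of "bs ! s"] by (auto simp: rf_value_def z_def)
    qed
    have n2: "poly (snd (?f s (bs' ! s))) z \<noteq> 0" if "s < k" for s
    proof (cases "s = u")
      case True
      have "eig_pole (a ! u) i (bs' ! u) * z \<noteq> 1"
      proof
        assume "eig_pole (a ! u) i (bs' ! u) * z = 1"
        then have "q powi (if i = cls n (bs' ! u) then bs' ! u else bs' ! u - 1) = q powi (bs ! u)"
          using a_nz[OF u] by (simp add: eig_pole_def z_def field_simps)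
        then obtain m where m: "m \<le> bs' ! u" "q powi m = q powi (bs ! u)"
          using that[of "if i = cls n (bs' ! u) then bs' ! u else bs' ! u - 1"] by auto
        then have "q powi (bs ! u - m) = 1"
          by (simp add: power_int_diff)
        then show False
          using powi_ne_1[of "bs ! u - m"] m lt by auto
      qed
      then have "\<not> rf_pole (?f u (bs' ! u)) z"
        by (simp add: rf_pole_beig)
      then show ?thesis
        using True by (simp add: rf_pole_def)
    next
      case False
      then show ?thesis
        using no_pole[OF that u False i_def, of "bs' ! s"] by (auto simp: rf_pole_def z_def)
    qed
    have "(\<Prod>s<k. poly (fst (?f s (bs ! s))) z) \<noteq> 0" "(\<Prod>s<k. poly (snd (?f s (bs' ! s))) z) \<noteq> 0"
      using n1 n2 by simp_all
    moreover have "A * B \<noteq> C * D" if "A \<noteq> 0" "B \<noteq> 0" "D = 0" for A B C D :: complex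
      using that by simp
    ultimately show False
      using ev z0 by blast
  qed
  assume "bs \<noteq> bs'"
  then obtain u where "u < k" "bs ! u \<noteq> bs' ! u"
    using bs by (auto simp: list_eq_iff_nth_eq)
  then show False
    using le[of u bs bs'] le[of u bs' bs] eq by force
qed

text \<open>
  Exponentiating the eigenvalues of the \<open>h\<^sub>i\<^sub>,\<^sub>m\<close> and multiplying by that of \<open>k\<^sub>i\<close> returns the eigenvalue
  of \<open>\<phi>\<^sub>i\<close>. So vectors separated by the latter are separated by the Cartan generators.
\<close>

lemma tensor_phi_determined:
  assumes i: "i \<in> idx n"
    and w: "weight_eig (hvec_h i) bs = weight_eig (hvec_h i) bs'"
    and h: "\<And>m. m \<noteq> 0 \<Longrightarrow> tensor_h q Vs i m bs = tensor_h q Vs i m bs'"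
  shows "tensor_phi Vs 1 i bs = tensor_phi Vs 1 i bs'"
proof -
  define K where "K cs = fps_nth (tensor_phi Vs 1 i cs) 0" for cs
  define N where "N cs = fps_const (inverse (K cs)) * tensor_phi Vs 1 i cs - 1" for cs
  have K: "K cs = weight_eig (hvec_h i) cs" for cs
    using tensor_phi_0[of 1 i cs] i by (simp add: K_def weight_eig_def)
  have K0: "K cs \<noteq> 0" for cs
    by (simp add: K weight_eig_def)
  have N0: "fps_nth (N cs) 0 = 0" for cs
    using K0[of cs] by (simp add: N_def K_def)
  have L: "fps_ln 1 oo N bs = fps_ln 1 oo N bs'"
  proof (rule fps_ext)
    fix m
    show "fps_nth (fps_ln 1 oo N bs) m = fps_nth (fps_ln 1 oo N bs') m"
    proof (cases "m = 0")
      case False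
      then show ?thesis
        using h[of "int m"] q_inv by (simp add: tensor_h_def N_def K_def Let_def)
    qed (simp add: fps_ln_0)
  qed
  have F: "tensor_phi Vs 1 i cs = fps_const (K cs) * (fps_exp 1 oo (fps_ln 1 oo N cs))" for cs
    using K0[of cs] by (simp add: fps_exp_ln_compose[OF N0]) (simp add: N_def flip: mult.assoc)
  show ?thesis
    unfolding F[of bs] F[of bs'] L using K w by simp
qed

lemma cartan_separates:
  assumes "bs \<in> boxes" "bs' \<in> boxes" "bs \<noteq> bs'"
  obtains d where "diag_op d \<in> cartan_generators n V" "d bs \<noteq> d bs'"
proof (rule ccontr)
  assume "\<not> thesis"
  then have sep: "d bs = d bs'" if "diag_op d \<in> cartan_generators n V" for d
    using that \<open>\<And>d. diag_op d \<in> cartan_generators n V \<Longrightarrow> d bs \<noteq> d bs' \<Longrightarrow> thesis\<close> by blast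
  have "tensor_phi Vs 1 i bs = tensor_phi Vs 1 i bs'" if i: "i \<in> idx n" for i
  proof (rule tensor_phi_determined[OF i])
    have "hvec_h i \<in> hspace n"
      using i by (auto simp: hvec_h_def hspace_def hsupp_def)
    then show "weight_eig (hvec_h i) bs = weight_eig (hvec_h i) bs'"
      by (intro sep) (auto simp: cartan_generators_def)
    show "tensor_h q Vs i m bs = tensor_h q Vs i m bs'" if "m \<noteq> 0" for m
      using i that by (intro sep) (auto simp: cartan_generators_def)
  qed
  then show False
    using tensor_phi_separates[of bs bs'] assms by simp
qed

lemma cartan_generators_diag_op:
  "f \<in> cartan_generators n V \<Longrightarrow> \<exists>d. f = diag_op d"
  by (auto simp: cartan_generators_def)

text \<open>
  As long as two basis vectors occur in \<open>w\<close>, some Cartan generator has different eigenvalues on them,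
  and subtracting one of these eigenvalues from it makes the support of \<open>w\<close> smaller without killing \<open>w\<close>.
\<close>

lemma basis_vector_in_invariant_subspace:
  assumes W: "pm.subspace W" "W \<subseteq> vecs boxes"
    and inv: "\<And>f w. f \<in> cartan_generators n V \<Longrightarrow> w \<in> W \<Longrightarrow> f w \<in> W"
    and w: "w \<in> W" "w \<noteq> 0"
  shows "\<exists>bs\<in>keys w. single bs 1 \<in> W"
  using w
proof (induction "card (keys w)" arbitrary: w rule: less_induct)
  case less
  then obtain bs where bs: "bs \<in> keys w"
    by (metis keys_eq_empty ex_in_conv)
  show ?case
  proof (cases "keys w = {bs}")
    case True
    have "lookup w bs \<noteq> 0"
      using bs by (simp add: in_keys_iff)
    moreover have "lookup w b = 0" if "b \<noteq> bs" for b
      using True that by (metis in_keys_iff singletonD)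
    ultimately have "single bs 1 = smul (inverse (lookup w bs)) w"
      by (intro poly_mapping_eqI) (auto simp: lookup_single when_def)
    then show ?thesis
      using W(1) less.prems(1) bs pm.subspace_scale by metis
  next
    case False
    then obtain bs' where bs': "bs' \<in> keys w" "bs' \<noteq> bs"
      using bs by blast
    have "bs \<in> boxes" "bs' \<in> boxes"
      using bs bs' less.prems W(2) by (auto simp: vecs_def)
    then obtain d where d: "diag_op d \<in> cartan_generators n V" "d bs \<noteq> d bs'"
      using cartan_separates bs'(2) by metis
    define w' where "w' = diag_op d w - smul (d bs') w"
    have lw: "lookup w' b = (d b - d bs') * lookup w b" for b
      by (simp add: w'_def lookup_minus algebra_simps)
    have "w' \<in> W"
      unfolding w'_def using W(1) inv[OF d(1)] less.prems(1)
      by (intro pm.subspace_diff pm.subspace_scale) auto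
    moreover have "w' \<noteq> 0"
      using lw[of bs] d(2) bs by (auto simp: in_keys_iff)
    moreover have sub: "keys w' \<subset> keys w"
      using lw bs' by (auto simp: in_keys_iff)
    ultimately show ?thesis
      using less.hyps[of w'] psubset_card_mono[OF _ sub] by auto
  qed
qed

lemma gen_algebra_cartan_diag_op:
  assumes "f \<in> gen_algebra smul (cartan_generators n V)"
  shows "\<exists>d. f = diag_op d"
  using assms
proof induction
  case one
  have "(\<lambda>v. v) = diag_op (\<lambda>_. 1)"
    by (intro ext poly_mapping_eqI) simp
  then show ?case by blast
next
  case (gen f)
  then show ?case by (rule cartan_generators_diag_op)
next
  case (add f g)
  then obtain d d' where "f = diag_op d" "g = diag_op d'" by blast
  then have "(\<lambda>v. f v + g v) = diag_op (\<lambda>b. d b + d' b)"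
    by (intro ext poly_mapping_eqI) (simp add: lookup_add algebra_simps)
  then show ?case by blast
next
  case (scale f c)
  then obtain d where "f = diag_op d" by blast
  then have "(\<lambda>v. smul c (f v)) = diag_op (\<lambda>b. c * d b)"
    by (intro ext poly_mapping_eqI) simp
  then show ?case by blast
next
  case (comp f g)
  then obtain d d' where "f = diag_op d" "g = diag_op d'" by blast
  then have "(\<lambda>v. f (g v)) = diag_op (\<lambda>b. d b * d' b)"
    by (intro ext poly_mapping_eqI) simp
  then show ?case by blast
qed

lemma diag_op_eq_smul_iff: "diag_op d v = smul c v \<longleftrightarrow> (\<forall>b\<in>keys v. d b = c)"
proof -
  have "diag_op d v = smul c v \<longleftrightarrow> (\<forall>b. d b * lookup v b = c * lookup v b)"
    by (simp add: poly_mapping_eq_iff fun_eq_iff)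
  then show ?thesis by (auto simp: in_keys_iff)
qed

lemma single_one_nonzero: "single b (1 :: complex) \<noteq> 0"
proof
  assume "single b (1 :: complex) = 0"
  from arg_cong[OF this, of "\<lambda>v. lookup v b"] show False by simp
qed

lemma joint_eigenspace_lines:
  assumes "joint_eigenspace n V \<chi> \<noteq> {0}"
  obtains bs where "joint_eigenspace n V \<chi> = vecs {bs}"
proof -
  let ?J = "joint_eigenspace n V \<chi>"
  have sub: "?J \<subseteq> vecs boxes"
    by (auto simp: joint_eigenspace_def)
  have J: "?J = {v \<in> vecs boxes. \<forall>d. diag_op d \<in> gen_algebra smul (cartan_generators n V)
      \<longrightarrow> (\<forall>b\<in>keys v. d b = \<chi> (diag_op d))}"
  proof -
    have all: "(\<forall>f\<in>gen_algebra smul (cartan_generators n V). P f)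
        \<longleftrightarrow> (\<forall>d. diag_op d \<in> gen_algebra smul (cartan_generators n V) \<longrightarrow> P (diag_op d))" for P
      by (metis gen_algebra_cartan_diag_op)
    show ?thesis
      by (simp only: joint_eigenspace_def V_simps all diag_op_eq_smul_iff)
  qed
  have "0 \<in> ?J" by (simp add: J)
  with assms obtain v where v: "v \<in> ?J" "v \<noteq> 0" by blast
  then obtain bs where bs: "bs \<in> keys v"
    by (metis keys_eq_empty ex_in_conv)
  then have box: "bs \<in> boxes" using v sub by (auto simp: vecs_def)
  have "?J = vecs {bs}"
  proof
    show "?J \<subseteq> vecs {bs}"
    proof (rule subsetI, unfold vecs_def, intro CollectI subsetI, rule ccontr)
      fix w b assume w: "w \<in> ?J" "b \<in> keys w" "b \<notin> {bs}"
      then have "b \<in> boxes" "b \<noteq> bs" using sub by (auto simp: vecs_def)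
      then obtain d where d: "diag_op d \<in> cartan_generators n V" "d b \<noteq> d bs"
        using cartan_separates box by metis
      then show False
        using v(1) w(1,2) bs gen_algebra.gen[OF d(1), of smul] unfolding J by auto
    qed
    show "vecs {bs} \<subseteq> ?J"
    proof
      fix w assume "w \<in> vecs {bs}"
      then show "w \<in> ?J"
        using v(1) bs box unfolding J vecs_def by auto
    qed
  qed
  with that show ?thesis .
qed

lemma dim_vecs_singleton: "pm.dim (vecs {b}) = 1"
proof -
  let ?x = "single b (1 :: complex)"
  have "pm.independent {?x}"
    by (simp add: pm.independent_insert single_one_nonzero)
  moreover have "vecs {b} = pm.span {?x}"
    by (simp add: vecs_eq_span)
  ultimately show ?thesis
    using pm.dim_span_eq_card_independent[of "{?x}"] by simp
qed

lemma thin_V: "thin_rep n t V"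
  unfolding thin_rep_def V_simps
proof (intro conjI allI impI tor_module_V)
  show "vecs boxes = pm.span (\<Union>\<chi>. joint_eigenspace n V \<chi>)"
  proof
    show "pm.span (\<Union>\<chi>. joint_eigenspace n V \<chi>) \<subseteq> vecs boxes"
      by (intro pm.span_minimal subspace_vecs) (auto simp: joint_eigenspace_def)
    have "single bs 1
        \<in> joint_eigenspace n V (\<lambda>f. lookup (f (single bs 1)) bs)"
      if "bs \<in> boxes" for bs
    proof -
      have "f (single bs 1)
          = smul (lookup (f (single bs 1)) bs) (single bs 1)"
        if "f \<in> gen_algebra smul (cartan_generators n V)" for f
        using gen_algebra_cartan_diag_op[OF that] by auto
      then show ?thesis
        unfolding joint_eigenspace_def V_simps using single_in_vecs[OF that] by blast
    qed
    then show "vecs boxes \<subseteq> pm.span (\<Union>\<chi>. joint_eigenspace n V \<chi>)"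
      unfolding vecs_eq_span[of boxes] by (intro pm.span_mono) blast
  qed
  show "pm.dim (joint_eigenspace n V \<chi>) = 1" if "joint_eigenspace n V \<chi> \<noteq> {0}" for \<chi>
    using joint_eigenspace_lines[OF that] dim_vecs_singleton by metis
qed

subsection \<open>Extraction of the components of a current\<close>

text \<open>
  Applying \<open>x\<^sub>i\<^sub>,\<^sub>r\<close> with the coefficients of a polynomial \<open>P\<close> in place of the powers of the point \<open>c\<^sub>v\<close>
  multiplies the component at \<open>v\<close> by \<open>P(c\<^sub>v)\<close>. For \<open>P\<close> with zeros at all the points except \<open>c\<^sub>u\<close> only
  the component at \<open>u\<close> survives.
\<close>

lemma component_in_submodule:
  assumes W: "pm.subspace W" and inv: "\<And>r w. w \<in> W \<Longrightarrow> X e i r w \<in> W"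
    and e: "e = 1 \<or> e = -1" and u: "u < k" and bs: "bs \<in> boxes"
    and act: "act e i (bs ! u)" and mem: "single bs 1 \<in> W"
  shows "single (move e u bs) 1 \<in> W"
proof -
  let ?c = "\<lambda>v. pt e v (bs ! v)"
  define A where "A = {v. v < k \<and> v \<noteq> u \<and> act e i (bs ! v)}"
  define P where "P = (\<Prod>v\<in>A. [:- ?c v, 1:])"
  have fin: "finite A" by (simp add: A_def)
  have c: "?c v \<noteq> ?c u" if "v \<in> A" for v
  proof
    assume "?c v = ?c u"
    then have "a ! v = a ! u * q powi (bpos e (bs ! u) - bpos e (bs ! v))"
      by (simp add: pt_def power_int_diff divide_simps)
    moreover have "(int n + 1) dvd (bpos e (bs ! u) - bpos e (bs ! v))"
      using that act by (simp add: A_def act_def flip: cls_eq_iff)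
    ultimately show False
      using generic[of v u] that u by (auto simp: A_def)
  qed
  have P0: "poly P (?c u) \<noteq> 0"
  proof -
    have "poly P (?c u) = (\<Prod>v\<in>A. ?c u - ?c v)"
      by (simp add: P_def poly_prod)
    moreover have "?c u - ?c v \<noteq> 0" if "v \<in> A" for v
      using c[OF that] by simp
    ultimately show ?thesis
      using fin by simp
  qed
  have Pv: "poly P (?c v) = 0" if "v \<in> A" for v
    using that fin by (auto simp: P_def poly_prod intro!: bexI[of _ v])
  have comp: "(\<Sum>r\<le>degree P. coeff P r * xc e i (int r) v bs)
      = (if act e i (bs ! v) then kap e i v bs * poly P (?c v) else 0)" for v
    by (simp add: xc_def poly_altdef sum_distrib_left mult_ac)
  have "(\<Sum>r\<le>degree P. smul (coeff P r) (X e i (int r) (single bs 1)))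
    = (\<Sum>v<k. \<Sum>r\<le>degree P. single (move e v bs) (coeff P r * xc e i (int r) v bs))"
    by (simp add: tensor_x_eq[OF e] pm.scale_sum_right) (rule sum.swap)
  also have "\<dots> = (\<Sum>v<k. if v = u then single (move e u bs) (kap e i u bs * poly P (?c u)) else 0)"
    using Pv act by (intro sum.cong refl) (auto simp: single_sum comp A_def)
  also have "\<dots> = single (move e u bs) (kap e i u bs * poly P (?c u))"
    using u by simp
  finally have "single (move e u bs) (kap e i u bs * poly P (?c u)) \<in> W"
    using W inv[OF mem] by (metis (no_types, lifting) pm.subspace_sum pm.subspace_scale)
  from pm.subspace_scale[OF W this, of "inverse (kap e i u bs * poly P (?c u))"]
  have "single (move e u bs)
      (inverse (kap e i u bs * poly P (?c u)) * (kap e i u bs * poly P (?c u))) \<in> W"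
    by (simp only: smul_single)
  then show ?thesis
    using P0 kap_nonzero[OF u act] by (subst (asm) left_inverse) simp_all
qed

lemma boxes_connected:
  assumes S: "bs \<in> S" "bs \<in> boxes"
    and step: "\<And>cs u e. cs \<in> S \<Longrightarrow> cs \<in> boxes \<Longrightarrow> u < k \<Longrightarrow> e = 1 \<or> e = -1 \<Longrightarrow> cs[u := cs ! u - e] \<in> S"
    and cs: "cs \<in> boxes"
  shows "cs \<in> S"
proof -
  have upd: "ds[u := l] \<in> S" if ds: "ds \<in> S" "ds \<in> boxes" and u: "u < k" for ds u l
  proof (induction l rule: int_induct[of _ "ds ! u"])
    case base
    then show ?case using ds by simp
  next
    case (step1 l)
    then show ?case using step[of "ds[u := l]" u "-1"] ds u by simp
  next
    case (step2 l)
    then show ?case using step[of "ds[u := l]" u 1] ds u by simp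
  qed
  have "take m cs @ drop m bs \<in> S" if "m \<le> k" for m
    using that
  proof (induction m)
    case (Suc m)
    have "take (Suc m) cs @ drop (Suc m) bs = (take m cs @ drop m bs)[m := cs ! m]"
      using Suc.prems S cs by (intro nth_equalityI) (auto simp: nth_append nth_list_update less_Suc_eq)
    then show ?case
      using upd[of "take m cs @ drop m bs" m "cs ! m"] Suc S cs by simp
  qed (use S in simp)
  from this[of k] show ?thesis
    using cs S by simp
qed

lemma submodule_V:
  assumes "submodule n V W" "W \<noteq> {0}"
  shows "W = vecs boxes"
proof -
  have W: "pm.subspace W" "W \<subseteq> vecs boxes"
    and inv: "\<And>f w. f \<in> all_generators n V \<Longrightarrow> w \<in> W \<Longrightarrow> f w \<in> W"
    using assms(1) by (auto simp: submodule_def)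
  have "cartan_generators n V \<subseteq> all_generators n V"
    by (auto simp: cartan_generators_def all_generators_def generators_def)
  moreover obtain w where "w \<in> W" "w \<noteq> 0"
    using assms(2) pm.subspace_0[OF W(1)] by blast
  ultimately obtain bs where bs: "bs \<in> keys w" "single bs 1 \<in> W"
    using basis_vector_in_invariant_subspace[OF W, of w] inv by blast
  then have box: "bs \<in> boxes" using W \<open>w \<in> W\<close> by (auto simp: vecs_def)
  have gen: "X e i r \<in> all_generators n V" if "e = 1 \<or> e = -1" "i \<in> idx n" for e i r
  proof -
    have "xx V e i r \<in> all_generators n V"
      unfolding all_generators_def generators_def using that by blast
    then show ?thesis by simp
  qed
  have all: "cs \<in> {cs. single cs 1 \<in> W}" if "cs \<in> boxes" for cs
  proof (rule boxes_connected[OF _ box _ that])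
    fix ds u e assume ds: "ds \<in> {cs. single cs 1 \<in> W}" "ds \<in> boxes" "u < k" "e = 1 \<or> e = (-1 :: int)"
    have "single (move e u ds) 1 \<in> W"
    proof (rule component_in_submodule[OF W(1) _ ds(4,3,2)])
      show "act e (cls n (bpos e (ds ! u))) (ds ! u)" by (simp add: act_def)
      show "X e (cls n (bpos e (ds ! u))) r w \<in> W" if "w \<in> W" for r w
        by (rule inv[OF gen[OF ds(4) cls_in_idx] that])
    qed (use ds in simp)
    then show "ds[u := ds ! u - e] \<in> {cs. single cs 1 \<in> W}"
      by (simp add: move_def)
  qed (use bs in simp)
  then have "vecs boxes \<subseteq> W"
    unfolding vecs_eq_span by (intro pm.span_minimal W) auto
  with W(2) show ?thesis by blast
qed

lemma irreducible_V: "irreducible_rep n t V"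
  unfolding irreducible_rep_def
proof (intro conjI allI impI tor_module_V)
  have "single (replicate k 1) 1 \<in> vecs boxes"
    by (simp add: single_in_vecs)
  then show "carr V \<noteq> {0}"
    using single_one_nonzero[of "replicate k (1 :: int)"] by auto
  show "W = {0} \<or> W = carr V" if "submodule n V W" for W
    using submodule_V[OF that] by auto
qed

lemma orbit_V:
  assumes "v \<in> vecs boxes" "v \<noteq> 0"
  shows "orbit V (all_generators n V) v = vecs boxes"
proof (rule submodule_V)
  let ?O = "orbit V (all_generators n V) v"
  let ?A = "gen_algebra smul (all_generators n V)"
  have lin: "linear_on_carr V f" if "f \<in> ?A" for f
    using that
  proof induction
    case (gen f)
    then show ?case by (rule all_generators_linear)
  qed (auto simp: linear_on_carr_def add_in_vecs smul_in_vecs algebra_simps pm.scale_right_distrib)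
  have mem: "f v \<in> ?O" if "f \<in> ?A" for f
    using that by (auto simp: orbit_def)
  have "pm.subspace (?O)"
    unfolding pm.subspace_def
  proof (intro conjI ballI allI)
    have "(\<lambda>v. smul 0 v) \<in> ?A"
      using gen_algebra.scale[OF gen_algebra.one] .
    from mem[OF this] show "0 \<in> ?O" by simp
    show "x + y \<in> ?O"
      if "x \<in> ?O" "y \<in> ?O" for x y
      using that gen_algebra.add[of _ smul "all_generators n V"] by (fastforce simp: orbit_def)
    show "smul c x \<in> ?O"
      if "x \<in> ?O" for c x
      using that gen_algebra.scale[of _ smul "all_generators n V"] by (fastforce simp: orbit_def)
  qed
  moreover have "?O \<subseteq> vecs boxes"
    using lin assms(1) by (auto simp: orbit_def linear_on_carr_def)
  moreover have "f ` ?O \<subseteq> ?O"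
    if "f \<in> all_generators n V" for f
    using gen_algebra.comp[OF gen_algebra.gen[OF that]] by (fastforce simp: orbit_def)
  ultimately show "submodule n V (?O)"
    by (simp add: submodule_def)
  show "?O \<noteq> {0}"
    using mem[OF gen_algebra.one] assms(2) by auto
qed

end

section \<open>Integrability and extremality\<close>

context tensor_boxes
begin

subsection \<open>Weight spaces\<close>

lemma tensor_weight_lattice: "tensor_weight Vs bs \<in> weight_lattice n"
proof -
  have "keys (\<Sum>s\<in>S. box_weight n (bs ! s)) \<subseteq> hsupp n" if "finite S" for S
    using that
  proof induction
    case (insert x S)
    then show ?case
      using Poly_Mapping.keys_add[of "box_weight n (bs ! x)" "\<Sum>s\<in>S. box_weight n (bs ! s)"]
        keys_box_weight[OF n2, of "bs ! x"] by auto
  qed simp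
  then show ?thesis
    by (auto simp: weight_lattice_def hspace_dual_def tensor_weight_eq hvec_h_def lookup_sum
        lookup_box_weight[OF n2])
qed

text \<open>
  The values of two different weights on some \<open>h\<close> of the rational space \<open>\<hh>\<close> differ by a nonzero integer
  once denominators are cleared, and \<open>q\<close> is not a root of unity.
\<close>

lemma weight_character_inj:
  assumes l: "l \<in> hspace_dual n" "l' \<in> hspace_dual n"
    and eq: "\<And>h. h \<in> hspace n \<Longrightarrow> qpow t (pairing l h) = qpow t (pairing l' h)"
  shows "l = l'"
proof (rule poly_mapping_eqI, rule ccontr)
  fix b
  let ?x = "lookup l b" and ?y = "lookup l' b"
  assume ne: "?x \<noteq> ?y"
  then have b: "b \<in> hsupp n"
  proof -
    have "lookup l b = 0 \<and> lookup l' b = 0" if "b \<notin> hsupp n"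
      using l that unfolding hspace_dual_def by (blast intro: not_in_keys_iff_lookup_eq_zero[THEN iffD1])
    with ne show ?thesis by metis
  qed
  obtain p r where pr: "quotient_of (?x - ?y) = (p, r)"
    by (cases "quotient_of (?x - ?y)")
  then have r: "r > 0" and x: "?x - ?y = of_int p / of_int r"
    using quotient_of_denom_pos quotient_of_div by blast+
  then have p: "p \<noteq> 0" and xr: "?x * of_int r - ?y * of_int r = of_int p"
    using ne by (auto simp: field_simps)
  let ?h = "single b (of_int r :: rat)"
  have "?h \<in> hspace n"
    using b by (simp add: hspace_def)
  then have "qpow t (?x * of_int r) = qpow t (?y * of_int r)"
    using eq[of ?h] by simp
  moreover have "qpow t (?x * of_int r) = qpow t (of_int p) * qpow t (?y * of_int r)"
    by (simp flip: qpow_add xr)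
  ultimately have "q powi p = 1"
    by (simp add: qpow_int)
  then show False
    using powi_ne_1[OF p] by simp
qed

lemma weight_space_V:
  assumes "l \<in> weight_lattice n"
  shows "weight_space n t V l = vecs {bs \<in> boxes. tensor_weight Vs bs = l}"
proof -
  have dual: "l \<in> hspace_dual n" "tensor_weight Vs bs \<in> hspace_dual n" for bs
    using assms tensor_weight_lattice[of bs] by (auto simp: weight_lattice_def)
  have "(\<forall>h\<in>hspace n. weight_eig h bs = qpow t (pairing l h)) \<longleftrightarrow> tensor_weight Vs bs = l" for bs
    using weight_character_inj[OF dual(2,1)] by (auto simp: weight_eig_def)
  then show ?thesis
    unfolding weight_space_def V_simps diag_op_eq_smul_iff by (auto simp: vecs_def)
qed

text \<open>
  Basis vectors are weight vectors, and the weight spaces are spanned by those of a given weight. A family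
  of components is therefore the decomposition of \<open>v\<close> if and only if it sorts the coefficients of \<open>v\<close>
  by weight; this description, \<open>Q\<close> below, determines it.
\<close>

lemma weight_decomposition:
  assumes v: "v \<in> vecs boxes"
  shows "\<exists>!c :: weight \<Rightarrow>\<^sub>0 (int list \<Rightarrow>\<^sub>0 complex).
    keys c \<subseteq> weight_lattice n \<and>
    (\<forall>l\<in>keys c. lookup c l \<in> weight_space n t V l) \<and>
    v = (\<Sum>l\<in>keys c. lookup c l)"
    (is "\<exists>!c. ?P c")
proof -
  let ?w = "tensor_weight Vs"
  define Q where "Q c \<longleftrightarrow> (\<forall>l b. lookup (lookup c l) b
      = (if ?w b = l then lookup v b else 0))"
    for c :: "weight \<Rightarrow>\<^sub>0 (int list \<Rightarrow>\<^sub>0 complex)"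
  have v0: "lookup v b = 0" if "b \<notin> boxes" for b
    using v that by (auto simp: vecs_iff_lookup)
  have QP: "?P c" if Q: "Q c" for c
  proof (intro conjI subsetI ballI)
    show lat: "l \<in> weight_lattice n" if "l \<in> keys c" for l
    proof -
      have "lookup c l \<noteq> 0" using that by (simp add: in_keys_iff)
      then obtain b where "lookup (lookup c l) b \<noteq> 0"
        by (metis poly_mapping_eqI lookup_zero)
      then have "?w b = l" using Q by (auto simp: Q_def split: if_splits)
      then show ?thesis using tensor_weight_lattice by metis
    qed
    show "lookup c l \<in> weight_space n t V l" if "l \<in> keys c" for l
      using Q v0 unfolding weight_space_V[OF lat[OF that]] vecs_iff_lookup Q_def by auto
    show "v = (\<Sum>l\<in>keys c. lookup c l)"
    proof (rule poly_mapping_eqI)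
      fix b
      have "lookup v b = 0" if "?w b \<notin> keys c"
      proof -
        have "lookup c (?w b) = 0" using that by (simp add: in_keys_iff)
        moreover have "lookup (lookup c (?w b)) b = lookup v b"
          using Q by (simp add: Q_def)
        ultimately show ?thesis by simp
      qed
      then show "lookup v b = lookup (\<Sum>l\<in>keys c. lookup c l) b"
        using Q by (auto simp: Q_def lookup_sum)
    qed
  qed
  have PQ: "Q c" if P: "?P c" for c
  proof -
    have z: "lookup (lookup c l) b = 0" if "?w b \<noteq> l" for l b
    proof (cases "l \<in> keys c")
      case True
      then have "l \<in> weight_lattice n" "lookup c l \<in> weight_space n t V l"
        using P by auto
      then have "lookup c l \<in> vecs {bs \<in> boxes. ?w bs = l}"
        using weight_space_V by simp
      then show ?thesis using that by (simp add: vecs_iff_lookup)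
    qed (simp add: in_keys_iff)
    have "lookup (lookup c (?w b)) b = lookup v b" for b
    proof -
      have "lookup v b
          = (\<Sum>l\<in>keys c. lookup (lookup c l) b)"
        using P by (metis lookup_sum)
      also have "\<dots> = (\<Sum>l\<in>keys c. if l = ?w b
          then lookup (lookup c (?w b)) b else 0)"
        using z by (intro sum.cong) auto
      also have "\<dots> = lookup (lookup c (?w b)) b"
        by (simp add: in_keys_iff)
      finally show ?thesis by simp
    qed
    then show ?thesis
      using z by (auto simp: Q_def)
  qed
  define c0 where "c0 = (\<Sum>b\<in>keys v.
      single (?w b) (single b (lookup v b)))"
  have "Q c0"
    unfolding Q_def
  proof (intro allI)
    fix l b
    have "lookup (lookup c0 l) b
      = (\<Sum>b'\<in>keys v. if b' = b then (if ?w b = l then lookup v b else 0) else 0)"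
      unfolding c0_def lookup_sum
      by (intro sum.cong refl) (auto simp: lookup_single when_def)
    also have "\<dots> = (if ?w b = l then lookup v b else 0)"
      by (simp add: in_keys_iff)
    finally show "lookup (lookup c0 l) b
      = (if ?w b = l then lookup v b else 0)" .
  qed
  then have uniq: "c = c0" if "Q c" for c
    using that by (intro poly_mapping_eqI) (simp add: Q_def)
  show ?thesis
    by (rule ex1I[of _ c0], rule QP[OF \<open>Q c0\<close>], rule uniq, rule PQ)
qed

subsection \<open>Local nilpotency\<close>

lemma X_maps:
  assumes e: "e = 1 \<or> e = -1" and v: "v \<in> vecs B"
    and step: "\<And>bs u. bs \<in> B \<Longrightarrow> u < k \<Longrightarrow> act e i (bs ! u) \<Longrightarrow> move e u bs \<in> B'"
  shows "X e i r v \<in> vecs B'"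
proof (rule lin_ext_in_vecs[OF _ v])
  fix bs assume "bs \<in> B"
  have "single (move e u bs) (xc e i r u bs) \<in> vecs B'" if "u \<in> {..<k}" for u
  proof (cases "act e i (bs ! u)")
    case True
    then show ?thesis
      using step[OF \<open>bs \<in> B\<close>] that by (intro single_in_vecs) simp
  qed (simp add: xc_def)
  then show "tensor_x Vs e i r bs \<in> vecs B'"
    unfolding tensor_x_eq[OF e] by (rule sum_in_vecs)
qed

text \<open>
  A box that was moved by a current at \<open>i\<close> cannot be moved by it again, so each application lowers
  the number of movable boxes by one.
\<close>

lemma X_nilpotent:
  assumes e: "e = 1 \<or> e = -1" and v: "v \<in> vecs boxes"
  shows "(X e i 0 ^^ Suc k) v = 0"
proof -
  let ?A = "\<lambda>bs. {u. u < k \<and> act e i (bs ! u)}"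
  define U where "U m = {bs \<in> boxes. card (?A bs) < m}" for m
  have step: "X e i 0 w \<in> vecs (U m)" if "w \<in> vecs (U (Suc m))" for w m
  proof (rule X_maps[OF e that])
    fix bs u assume h: "bs \<in> U (Suc m)" "u < k" "act e i (bs ! u)"
    then have bs: "length bs = k" and less: "card (?A bs) < Suc m"
      by (simp_all add: U_def)
    have "\<not> act e i (bs ! u - e)"
      using act_twice[OF e h(3)] by blast
    then have "?A (move e u bs) \<subset> ?A bs"
      using h(2,3) bs by auto
    then have "card (?A (move e u bs)) < card (?A bs)"
      by (intro psubset_card_mono) simp_all
    with less bs show "move e u bs \<in> U m"
      by (simp add: U_def)
  qed
  have pow: "(X e i 0 ^^ m) w \<in> vecs (U 0)" if "w \<in> vecs (U m)" for m w
    using that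
  proof (induction m arbitrary: w)
    case (Suc m)
    then show ?case using step by (simp only: funpow_Suc_right comp_def)
  qed simp
  have "card (?A bs) \<le> k" for bs
    using card_mono[of "{..<k}" "?A bs"] by auto
  then have "U (Suc k) = boxes"
    by (simp add: U_def less_Suc_eq_le)
  then have "(X e i 0 ^^ Suc k) v \<in> vecs (U 0)"
    using v by (intro pow) simp
  moreover have "U 0 = {}"
    by (simp add: U_def)
  ultimately show ?thesis
    by (simp only: vecs_def) (simp del: funpow.simps)
qed

lemma integrable_V: "integrable_rep n t V"
  unfolding integrable_rep_def
proof (intro conjI tor_module_V ballI)
  fix v assume "v \<in> carr V"
  then have v: "v \<in> vecs boxes" by simp
  show "\<exists>!c :: weight \<Rightarrow>\<^sub>0 (int list \<Rightarrow>\<^sub>0 complex). keys c \<subseteq> weight_lattice n \<and>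
    (\<forall>l\<in>keys c. lookup c l \<in> weight_space n t V l) \<and>
    v = (\<Sum>l\<in>keys c. lookup c l)"
    by (rule weight_decomposition[OF v])
  fix i e assume "e \<in> {1, - 1 :: int}"
  then have e: "e = 1 \<or> e = - 1" by simp
  show "\<exists>N. (xx V e i 0 ^^ N) v = 0"
    unfolding V_simps by (rule exI, rule X_nilpotent[OF e v])
qed

subsection \<open>Finiteness for vertical subalgebras\<close>

text \<open>
  The blocks are the intervals of \<open>n + 1\<close> boxes between two consecutive moves at node \<open>j\<close>.
\<close>

definition block :: "int \<Rightarrow> int \<Rightarrow> int" where
  "block j l = (l - 1 - j) div (int n + 1)"

lemma div_pred:
  assumes "\<not> N dvd x" "N > (0 :: int)"
  shows "(x - 1) div N = x div N"
proof -
  have "x mod N > 0"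
    using assms pos_mod_sign[of N x] by (simp add: dvd_eq_mod_eq_0 order_less_le)
  then have "x - 1 = N * (x div N) + (x mod N - 1)" "0 \<le> x mod N - 1" "x mod N - 1 < N"
    using pos_mod_bound[OF assms(2), of x] by (simp_all add: algebra_simps)
  then show ?thesis
    by (rule int_div_pos_eq)
qed

lemma block_move:
  assumes e: "e = 1 \<or> e = -1" and j: "j \<in> idx n" and i: "act e i l" "i \<noteq> j"
  shows "block j (l - e) = block j l"
proof -
  have "\<not> (int n + 1) dvd (bpos e l - j)"
    using i j cls_eq_iff[of n "bpos e l" j] by (simp add: act_def cls_idx)
  then have d: "(bpos e l - j - 1) div (int n + 1) = (bpos e l - j) div (int n + 1)"
    by (rule div_pred) simp
  have "l - e - 1 - j = bpos e l - j - 1 \<and> l - 1 - j = bpos e l - j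
      \<or> l - e - 1 - j = bpos e l - j \<and> l - 1 - j = bpos e l - j - 1"
    using e by (auto simp: bpos_def)
  then show ?thesis
    using d unfolding block_def by metis
qed

lemma finite_block: "finite {l. block j l = m}"
proof (rule finite_subset)
  show "{l. block j l = m} \<subseteq> {(int n + 1) * m + 1 + j..(int n + 1) * m + 1 + j + int n}"
  proof
    fix l assume "l \<in> {l. block j l = m}"
    then have "(l - 1 - j) div (int n + 1) = m"
      by (simp add: block_def)
    moreover define r where "r = (l - 1 - j) mod (int n + 1)"
    ultimately have "l - 1 - j = (int n + 1) * m + r"
      using mult_div_mod_eq[of "int n + 1" "l - 1 - j"] by metis
    moreover have "0 \<le> r"
      by (simp add: r_def)
    moreover have "r < int n + 1"
      unfolding r_def by (rule pos_mod_bound) simp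
    ultimately have "l - 1 - j = (int n + 1) * m + r" "0 \<le> r" "r \<le> int n"
      by linarith+
    then show "l \<in> {(int n + 1) * m + 1 + j..(int n + 1) * m + 1 + j + int n}"
      by (simp only: atLeastAtMost_iff) linarith
  qed
qed simp

lemma vertical_finite:
  assumes j: "j \<in> idx n" and w: "w \<in> vecs boxes"
  shows "finite_dim V (orbit V (vertical_generators n V j) w)"
proof -
  define B where "B = {bs \<in> boxes. \<exists>b\<in>keys w. \<forall>u<k. block j (bs ! u) = block j (b ! u)}"
  define F where "F = (\<Union>b\<in>keys w. \<Union>u<k. {l. block j l = block j (b ! u)})"
  have "finite F"
    by (simp add: F_def finite_block)
  moreover have "B \<subseteq> {bs. set bs \<subseteq> F \<and> length bs = k}"
    by (fastforce simp: B_def F_def in_set_conv_nth)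
  ultimately have fin: "finite B"
    using finite_subset finite_lists_length_eq[of F k] by blast
  have wB: "w \<in> vecs B"
    using w by (auto simp: vecs_def B_def)
  have gen: "f v \<in> vecs B" if f: "f \<in> vertical_generators n V j" and v: "v \<in> vecs B" for f v
  proof -
    have "X e i r v \<in> vecs B" if e: "e = 1 \<or> e = -1" and i: "i \<noteq> j" for e i r
    proof (rule X_maps[OF e v])
      fix bs u assume h: "bs \<in> B" "u < k" "act e i (bs ! u)"
      have "block j (move e u bs ! s) = block j (bs ! s)" if "s < k" for s
        using h block_move[OF e j h(3) i] by (auto simp: B_def)
      then show "move e u bs \<in> B"
        using h by (auto simp: B_def)
    qed
    then show ?thesis
      using f diag_op_in_vecs[OF v] by (auto simp: vertical_generators_def generators_def)
  qed
  have "f v \<in> vecs B" if "f \<in> gen_algebra smul (vertical_generators n V j)" "v \<in> vecs B" for f v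
    using that by (induction arbitrary: v) (auto simp: gen add_in_vecs smul_in_vecs)
  then have "orbit V (vertical_generators n V j) w \<subseteq> vecs B"
    using wB by (auto simp: orbit_def)
  then show ?thesis
    using fin unfolding finite_dim_def V_simps vecs_eq_span
    by (intro exI[of _ "(\<lambda>b. single b 1) ` B"]) simp
qed

subsection \<open>Extremal vectors\<close>

text \<open>
  The multiples of tensors of \<open>k\<close> equal boxes. Zero is included, so that the scalars occurring in the
  operators \<open>S\<^sub>i\<close> need not be followed.
\<close>

definition diagonal_vectors :: "(int list \<Rightarrow>\<^sub>0 complex) set" where
  "diagonal_vectors = (\<Union>l. vecs {replicate k l})"

text \<open>
  Each of the \<open>k\<close> applications moves one of the boxes that have not been moved yet, and in the end
  all of them have been moved.
\<close>

lemma X_pow_diagonal: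
  assumes e: "e = 1 \<or> e = -1" and w: "w \<in> vecs {replicate k l}" and i: "act e i l"
  shows "(X e i 0 ^^ k) w \<in> vecs {replicate k (l - e)}"
proof -
  let ?A = "\<lambda>bs. {u. u < k \<and> bs ! u = l - e}"
  define C where "C m = {bs \<in> boxes. (\<forall>u<k. bs ! u = l \<or> bs ! u = l - e) \<and> card (?A bs) = m}" for m
  have e0: "e \<noteq> 0" using e by auto
  have na: "\<not> act e i (l - e)" using act_twice[OF e i] by blast
  have step: "X e i 0 v \<in> vecs (C (Suc m))" if "v \<in> vecs (C m)" for v m
  proof (rule X_maps[OF e that])
    fix bs u assume h: "bs \<in> C m" "u < k" "act e i (bs ! u)"
    have bu: "bs ! u = l"
      using h na by (auto simp: C_def)
    then have "?A (move e u bs) = insert u (?A bs)" "u \<notin> ?A bs"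
      using h e0 by (auto simp: C_def)
    then show "move e u bs \<in> C (Suc m)"
      using h bu by (auto simp: C_def)
  qed
  have "(X e i 0 ^^ m) v \<in> vecs (C m)" if "v \<in> vecs (C 0)" for m v
    using that step by (induction m) auto
  moreover have "w \<in> vecs (C 0)"
    using w e0 by (auto simp: vecs_def C_def)
  ultimately have "(X e i 0 ^^ k) w \<in> vecs (C k)"
    by blast
  moreover have "C k \<subseteq> {replicate k (l - e)}"
  proof
    fix bs assume "bs \<in> C k"
    then have bs: "length bs = k" "card (?A bs) = card {..<k}" by (simp_all add: C_def)
    then have "?A bs = {..<k}"
      by (intro card_subset_eq) auto
    then have "bs ! u = l - e" if "u < k" for u using that by blast
    then show "bs \<in> {replicate k (l - e)}"
      using bs by (auto simp: list_eq_iff_nth_eq)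
  qed
  ultimately show ?thesis
    unfolding vecs_def by blast
qed

lemma X_kills_diagonal:
  assumes e: "e = 1 \<or> e = -1" and w: "w \<in> vecs {replicate k l}" and i: "\<not> act e i l"
  shows "X e i 0 w = 0"
proof -
  have "X e i 0 w \<in> vecs {}"
    using i by (intro X_maps[OF e w]) simp
  then show ?thesis by (simp add: vecs_def)
qed

lemma wt_at_diagonal:
  assumes w: "w \<in> vecs {replicate k l}" "w \<noteq> 0" and i: "i \<in> idx n"
  shows "wt_at n t V w i = int k * ((if i = cls n l then 1 else 0) - (if i = cls n (l - 1) then 1 else 0))"
proof -
  let ?W = "tensor_weight Vs (replicate k l)"
  have keys: "keys w = {replicate k l}"
    using w by (auto simp: vecs_def subset_singleton_iff)
  have "has_weight n t V w l' \<longleftrightarrow> l' = ?W" for l'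
  proof
    assume "has_weight n t V w l'"
    then show "l' = ?W"
      using weight_space_V[of l'] keys by (auto simp: has_weight_def vecs_def)
  next
    assume "l' = ?W"
    then show "has_weight n t V w l'"
      using weight_space_V[of l'] keys tensor_weight_lattice by (auto simp: has_weight_def vecs_def)
  qed
  then have "weight_of n t V w = ?W"
    by (simp add: weight_of_def)
  moreover have "lookup ?W (Hb i)
      = of_int (int k * ((if i = cls n l then 1 else 0) - (if i = cls n (l - 1) then 1 else 0)))"
    using lookup_tensor_weight[OF i, of "replicate k l"] by simp
  ultimately show ?thesis
    unfolding wt_at_def hvec_h_def pairing_single mult_1_right by (metis floor_of_int)
qed

lemma funpow_zero: "(X e i 0 ^^ N) 0 = 0"
  by (induction N) auto

text \<open>
  The weight of a tensor of \<open>k\<close> boxes \<open>l\<close> is \<open>k\<close> at the class of \<open>l\<close>, \<open>-k\<close> at the class of \<open>l - 1\<close> and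
  zero elsewhere. The current that has to vanish is in each case one that moves no box \<open>l\<close>. For \<open>w = 0\<close>
  the weight is not determined, but all the claims hold trivially.
\<close>

lemma diagonal_extremal:
  assumes w: "w \<in> diagonal_vectors" and i: "i \<in> idx n"
  shows "i_extremal n t V i w" "S_op n t V i w \<in> diagonal_vectors"
proof -
  obtain l where l: "w \<in> vecs {replicate k l}"
    using w by (auto simp: diagonal_vectors_def)
  let ?W = "tensor_weight Vs (replicate k l)"
  have hw: "has_weight n t V w ?W"
    using weight_space_V[OF tensor_weight_lattice[of "replicate k l"]] l tensor_weight_lattice
    by (auto simp: has_weight_def vecs_def)
  note ne = cls_pred_ne[of l]
  note wt = wt_at_diagonal[OF l _ i]
  have act: "act 1 i l \<longleftrightarrow> i = cls n (l - 1)" "act (-1) i l \<longleftrightarrow> i = cls n l"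
    by (simp_all add: act_def bpos_def)
  show "i_extremal n t V i w"
  proof (cases "w = 0")
    case True
    then show ?thesis using hw by (auto simp: i_extremal_def)
  next
    case False
    have "X 1 i 0 w = 0" if "wt_at n t V w i \<ge> 0"
      using that wt[OF False] kpos ne act by (intro X_kills_diagonal[OF _ l]) auto
    moreover have "X (-1) i 0 w = 0" if "wt_at n t V w i \<le> 0"
      using that wt[OF False] kpos ne act by (intro X_kills_diagonal[OF _ l]) auto
    ultimately show ?thesis using hw by (auto simp: i_extremal_def)
  qed
  have D: "smul c v \<in> diagonal_vectors" if "v \<in> vecs {replicate k m}" for c v m
    using smul_in_vecs[OF that] by (auto simp: diagonal_vectors_def)
  show "S_op n t V i w \<in> diagonal_vectors"
  proof (cases "w = 0")
    case True
    then show ?thesis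
      by (auto simp: S_op_def Let_def funpow_zero diagonal_vectors_def)
  next
    case False
    consider "i = cls n l" | "i = cls n (l - 1)" | "i \<noteq> cls n l" "i \<noteq> cls n (l - 1)" by blast
    then show ?thesis
    proof cases
      case 1
      then have "wt_at n t V w i = int k" using wt[OF False] ne by simp
      then show ?thesis
        using X_pow_diagonal[of "-1" w l i] l 1 act by (simp add: S_op_def D)
    next
      case 2
      then have "wt_at n t V w i = - int k" using wt[OF False] ne by simp
      then show ?thesis
        using X_pow_diagonal[of 1 w l i] l 2 act kpos by (simp add: S_op_def D)
    next
      case 3
      then have "wt_at n t V w i = 0" using wt[OF False] by simp
      then show ?thesis using l by (simp add: S_op_def D)
    qed
  qed
qed

lemma extremal_diagonal:
  assumes "w \<in> diagonal_vectors"
  shows "extremal n t V w"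
proof -
  have "foldr (S_op n t V) js w \<in> diagonal_vectors" if "set js \<subseteq> idx n" for js
    using that assms diagonal_extremal(2) by (induction js) auto
  then show ?thesis
    using diagonal_extremal(1) by (simp add: extremal_def)
qed

subsection \<open>The \<open>\<ell>\<close>-weight of the generating vector\<close>

definition ext_monomial :: "int \<times> complex \<Rightarrow>\<^sub>0 int" where
  "ext_monomial = (\<Sum>s<k. single (1, a ! s) 1 - single (0, q * a ! s) 1)"

lemma nth_inj: "s < k \<Longrightarrow> u < k \<Longrightarrow> a ! s = a ! u \<longleftrightarrow> s = u"
  using generic[of s u 0] by auto

text \<open>
  The parameters \<open>a\<^sub>s\<close> are distinct, so no two of the variables in the monomial coincide.
\<close>

lemma lookup_ext_monomial:
  "lookup ext_monomial (i, c)
    = (if i = 1 \<and> c \<in> (!) a ` {..<k} then 1 else if i = 0 \<and> c \<in> (\<lambda>s. q * a ! s) ` {..<k} then -1 else 0)"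
proof -
  have one: "(\<Sum>s<k. (if f s = c then 1 else 0)) = (if c \<in> f ` {..<k} then 1 else (0 :: int))"
    if "inj_on f {..<k}" for f
  proof (cases "c \<in> f ` {..<k}")
    case True
    then obtain u where u: "u < k" "c = f u" by auto
    then have "(\<Sum>s<k. (if f s = c then 1 else 0)) = (\<Sum>s<k. (if s = u then 1 else (0 :: int)))"
      using that by (intro sum.cong refl) (auto simp: inj_on_def)
    then show ?thesis using u True by simp
  qed (auto intro!: sum.neutral)
  have "inj_on ((!) a) {..<k}" "inj_on (\<lambda>s. q * a ! s) {..<k}"
    by (auto simp: inj_on_def nth_inj)
  note ones = one[OF this(1)] one[OF this(2)]
  have "lookup ext_monomial (i, c)
    = (\<Sum>s<k. (if i = 1 then (if a ! s = c then 1 else 0) else 0)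
        - (if i = 0 then (if q * a ! s = c then 1 else 0) else 0))"
    unfolding ext_monomial_def lookup_sum
    by (intro sum.cong refl) (auto simp: lookup_minus lookup_single when_def)
  also have "\<dots> = (if i = 1 then (\<Sum>s<k. (if a ! s = c then 1 else 0)) else 0)
        - (if i = 0 then (\<Sum>s<k. (if q * a ! s = c then 1 else 0)) else 0)"
    by (simp add: sum_subtractf)
  finally show ?thesis
    unfolding ones by simp
qed

lemma keys_ext_monomial:
  "{c. (i, c) \<in> keys ext_monomial}
    = (if i = 1 then (!) a ` {..<k} else if i = 0 then (\<lambda>s. q * a ! s) ` {..<k} else {})"
  by (auto simp: in_keys_iff lookup_ext_monomial)

lemma cls_0_1: "cls n 1 = 1" "cls n 0 = 0"
  using n2 by (simp_all add: cls_def)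

lemma weight_replicate_1: "tensor_weight Vs (replicate k 1) = (\<Sum>s<k. varpi1)"
  by (simp add: tensor_weight_eq box_weight_def)

lemma ext_monomial_in: "(\<Sum>s<k. varpi1, ext_monomial) \<in> lmonomials n"
proof -
  have "of_int (\<Sum>c\<in>{c. (i, c) \<in> keys ext_monomial}. lookup ext_monomial (i, c))
    = pairing (tensor_weight Vs (replicate k 1)) (hvec_h i)" if i: "i \<in> idx n" for i
  proof -
    have c: "card ((!) a ` {..<k}) = k" "card ((\<lambda>s. q * a ! s) ` {..<k}) = k"
      using card_image[of "(!) a" "{..<k}"] card_image[of "\<lambda>s. q * a ! s" "{..<k}"]
      by (auto simp: inj_on_def nth_inj)
    have "(\<Sum>c\<in>{c. (i, c) \<in> keys ext_monomial}. lookup ext_monomial (i, c))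
      = int k * ((if i = 1 then 1 else 0) - (if i = 0 then 1 else 0))"
      unfolding keys_ext_monomial by (auto simp: lookup_ext_monomial c)
    moreover have "pairing (tensor_weight Vs (replicate k 1)) (hvec_h i)
        = of_int (int k * ((if i = 1 then 1 else 0) - (if i = 0 then 1 else 0)))"
      using lookup_tensor_weight[OF i, of "replicate k 1"] by (simp add: hvec_h_def cls_0_1)
    ultimately show ?thesis by simp
  qed
  moreover have "keys ext_monomial \<subseteq> idx n \<times> (- {0})"
    using n2 a_nz by (auto simp: in_keys_iff lookup_ext_monomial idx_def split: if_splits)
  ultimately show ?thesis
    using tensor_weight_lattice[of "replicate k 1"]
    by (simp add: lmonomials_def flip: weight_replicate_1)
qed

lemma expand_rf_inverse_psi:
  assumes e: "e = 1 \<or> e = -1" and c: "c \<noteq> 0"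
  shows "expand e (rf_inverse (psi q c)) = inverse (expand e (psi q c))"
proof -
  let ?L = "lin_fps e 1 (- c)" and ?R = "lin_fps e q (- (inverse q * c))"
  have "expand e (psi q c) * expand e (rf_inverse (psi q c)) * (?L * ?R)
      = (expand e (psi q c) * ?L) * (expand e (rf_inverse (psi q c)) * ?R)"
    by (simp only: mult_ac)
  also have "\<dots> = 1 * (?L * ?R)"
    unfolding expand_psi[OF e c] by (simp only: mult_1_left mult.commute)
  finally have "expand e (psi q c) * expand e (rf_inverse (psi q c)) = 1"
    using lin_fps_nonzero[of "- c" e 1] lin_fps_nonzero[of "- (inverse q * c)" e q] c
    by (subst (asm) mult_right_cancel) auto
  then show ?thesis
    by (metis fps_inverse_unique)
qed

text \<open>
  \<open>Y\<^sub>i\<^sub>,\<^sub>c\<close> stands for \<open>\<psi>(c q z)\<close>. So \<open>Y\<^sub>1\<^sub>,\<^sub>a\<close> gives the eigenvalue \<open>\<psi>(a q z)\<close> of \<open>\<phi>\<^sub>1\<close> on the box \<open>1\<close>, and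
  the inverse of \<open>Y\<^sub>0\<^sub>,\<^sub>q\<^sub>a\<close> the eigenvalue \<open>1 / \<psi>(a q^2 z)\<close> of \<open>\<phi>\<^sub>0\<close>.
\<close>

lemma tensor_phi_replicate_1:
  assumes e: "e = 1 \<or> e = -1" and i: "i \<in> idx n"
  shows "tensor_phi Vs e i (replicate k 1) = lmonomial_series q ext_monomial e i"
proof -
  consider "i = 1" | "i = 0" | "i \<noteq> 1" "i \<noteq> 0" by blast
  then show ?thesis
  proof cases
    case 1
    have "lmonomial_series q ext_monomial e i = (\<Prod>c\<in>(!) a ` {..<k}. expand e (psi q (c * q)))"
      unfolding lmonomial_series_def keys_ext_monomial using 1
      by (auto simp: lookup_ext_monomial intro!: prod.cong)
    also have "\<dots> = (\<Prod>s<k. expand e (psi q (a ! s * q)))"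
      by (subst prod.reindex) (auto simp: inj_on_def nth_inj)
    finally show ?thesis
      using 1 beig_simps(1)[of _ 1] by (simp add: tensor_phi_eq cls_0_1)
  next
    case 2
    have "lmonomial_series q ext_monomial e i
        = (\<Prod>c\<in>(\<lambda>s. q * a ! s) ` {..<k}. inverse (expand e (psi q (c * q))))"
      unfolding lmonomial_series_def keys_ext_monomial using 2
      by (auto simp: lookup_ext_monomial power_int_minus intro!: prod.cong)
    also have "\<dots> = (\<Prod>s<k. inverse (expand e (psi q (q * a ! s * q))))"
      by (subst prod.reindex) (auto simp: inj_on_def nth_inj)
    also have "\<dots> = (\<Prod>s<k. expand e (rf_inverse (psi q (a ! s * q powi 2))))"
      using a_nz by (intro prod.cong refl) (simp add: expand_rf_inverse_psi[OF e] power2_eq_square mult_ac)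
    finally show ?thesis
      using 2 beig_simps(2)[of _ 1] by (simp add: tensor_phi_eq cls_0_1)
  next
    case 3
    then show ?thesis
      using beig_simps(3)[of i 1]
      by (simp add: tensor_phi_eq cls_0_1 lmonomial_series_def keys_ext_monomial expand_one)
  qed
qed

lemma extremal_loop_weight_V: "extremal_loop_weight_rep n t V (\<Sum>s<k. varpi1, ext_monomial)"
  unfolding extremal_loop_weight_rep_def
proof (intro conjI ext_monomial_in integrable_V bexI[where x = "single (replicate k 1) 1"] ballI)
  let ?v = "single (replicate k 1) (1 :: complex)"
  have v: "?v \<in> vecs boxes" by (simp add: single_in_vecs)
  have "?v \<noteq> 0"
    by (rule single_one_nonzero)
  then show "orbit V (all_generators n V) ?v = carr V"
    using orbit_V[OF v] by simp
  show "extremal n t V ?v"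
    by (rule extremal_diagonal) (auto simp: diagonal_vectors_def intro!: single_in_vecs exI[of _ 1])
  show "finite_dim V (orbit V (vertical_generators n V j) w)" if "j \<in> idx n" "w \<in> carr V" for j w
    using vertical_finite that by simp
  have ws: "?v \<in> weight_space n t V (\<Sum>s<k. varpi1)"
    using weight_space_V[OF tensor_weight_lattice[of "replicate k 1"]]
    by (simp add: weight_replicate_1 single_in_vecs)
  have ev: "phi t V e i (e * int s) ?v = smul (fps_nth (lmonomial_series (exp t) ext_monomial e i) s) ?v"
    if i: "i \<in> idx n" and "e \<in> {1, -1}" for i e s
  proof -
    have e: "e = 1 \<or> e = -1" using that by auto
    then have "phi_eig e i (e * int s) bs = fps_nth (tensor_phi Vs e i bs) s" for bs
      by (auto simp: phi_eig_def zcoeff_def)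
    then show ?thesis
      using tensor_phi_replicate_1[OF e i] by (simp add: phi_V[OF e i] flip: q_exp)
  qed
  show "?v \<in> lweight_space n t V (\<Sum>s<k. varpi1, ext_monomial)"
    unfolding lweight_space_def prod.case mem_Collect_eq V_simps(2)
  proof (intro conjI ws exI[of _ "Suc 0"] ballI allI)
    fix i e s assume "i \<in> idx n" "e \<in> {1, - 1 :: int}"
    from ev[OF this] show "((\<lambda>y. phi t V e i (e * int s) y
        - smul (fps_nth (lmonomial_series (exp t) ext_monomial e i) s) y) ^^ Suc 0) ?v = 0"
      by (simp only: funpow.simps comp_def id_apply diff_self)
  qed
qed

end

theorem theorem4p2:
  fixes n k :: nat and t q :: complex and a :: "complex list"
  assumes "n \<ge> 2"
    and "q = exp t"
    and "\<forall>m::nat. m > 0 \<longrightarrow> q ^ m \<noteq> 1"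
    and "k \<ge> 1"
    and "length a = k"
    and "\<forall>i<k. a ! i \<noteq> 0"
    and "\<forall>i j. i < j \<and> j < k \<longrightarrow>
           a ! i / a ! j \<notin> {q powi ((int n + 1) * m) | m. True}"
    and "\<forall>i j. i < j \<and> j < k \<longrightarrow>
           a ! i / a ! j \<notin> {q powi (2 + (int n + 1) * m) | m. True}
                          \<union> {q powi (- 2 + (int n + 1) * m) | m. True}"
  shows "let Vs = map (vector_rep n q) a; V = drinfeld_tensor t Vs in
         drinfeld_defined n Vs \<and>
         tor_module n t V \<and>
         irreducible_rep n t V \<and>
         thin_rep n t V \<and>
         extremal_loop_weight_rep n t V
           (\<Sum>s<k. varpi1,
            \<Sum>s<k. Poly_Mapping.single (1, a ! s) 1 - Poly_Mapping.single (0, q * a ! s) 1)"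
proof -
  let ?N = "int n + 1"
  define bad where "bad d \<longleftrightarrow> ?N dvd d \<or> ?N dvd (d - 2) \<or> ?N dvd (d + 2)" for d
  have lt: "a ! s / a ! u \<noteq> q powi d" if su: "s < u" "u < k" and d: "bad d" for s u d
  proof -
    obtain m where "d = ?N * m \<or> d = 2 + ?N * m \<or> d = - 2 + ?N * m"
      using d by (auto simp: bad_def dvd_def algebra_simps)
    then show ?thesis
      using assms(7,8) su by blast
  qed
  have bad_minus: "bad (- d)" if "bad d" for d
    using that dvd_minus_iff[of ?N "d - 2"] dvd_minus_iff[of ?N "d + 2"] by (auto simp: bad_def)
  have q0: "q \<noteq> 0" using assms(2) by simp
  interpret tensor_boxes n t q a k
  proof
    fix s u d
    assume h: "s < k" "u < k" "s \<noteq> u" "?N dvd d \<or> ?N dvd (d - 2) \<or> ?N dvd (d + 2)"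
    then have bad: "bad d" by (simp add: bad_def)
    show "a ! s \<noteq> a ! u * q powi d"
    proof
      assume eq: "a ! s = a ! u * q powi d"
      have nz: "a ! s \<noteq> 0" "a ! u \<noteq> 0" using assms(6) h by auto
      show False
      proof (cases "s < u")
        case True
        then show False
          using lt[OF True h(2) bad] eq nz by simp
      next
        case False
        then have "u < s" using h by simp
        moreover have "a ! u / a ! s = q powi (- d)"
          using eq nz q0 by (simp add: power_int_minus divide_simps)
        ultimately show False
          using lt[OF _ h(1) bad_minus[OF bad]] by blast
      qed
    qed
  qed (use assms in auto)
  show ?thesis
    using drinfeld_defined_V tor_module_V irreducible_V thin_V extremal_loop_weight_V
    by (simp add: ext_monomial_def)
qed

end
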